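(* Let $(R,\mathfrak{m})$ be an $F$-finite complete local ring of prime characteristic $p$, and let $i\in\mathbb{Z}$. If the annihilator $J\subseteq R$ of an $F$-stable subquotient of $H^i_{\mathfrak{m}}(R)$ is radical (e.g., if the Frobenius action on that subquotient is injective), then $J$ is a uniformly compatible ideal. In particular, if $R$ is $F$-anti-nilpotent, then the annihilator of any $F$-stable subquotient of $H^i_{\mathfrak{m}}(R)$ is uniformly compatible.
   Context: All rings are commutative, Noetherian, with $1$. Let $R$ be a ring of prime characteristic $p$. $F^e_*M$ denotes an $R$-module $M$ regarded as an $R$-module by restriction of scalars along the $e$-th iterate of Frobenius $F^e:R\to R$, $r\mapsto r^{p^e}$. $R$ is $F$-finite if $F_*R$ is a finitely generated $R$-module. A Frobenius action on an $R$-module $M$ is an additive map $F:M\to M$ with $F(rx)=r^pF(x)$ for all $r\in R$, $x\in M$; a submodule $N\subseteq M$ is $F$-stable if $F(N)\subseteq N$. An $F$-stable subquotient of $M$ is a quotient $L/N$ with $N\subseteq L\subseteq M$ $F$-stable submodules, with the induced Frobenius action. For $(R,\mathfrak m)$ local, $H^i_{\mathfrak{m}}(R)$ carries the natural Frobenius action induced by the Frobenius endomorphism of $R$. $M$ is anti-nilpotent if for every $F$-stable submodule $N\subseteq M$ the induced Frobenius action on $M/N$ is injective; $R$ is $F$-anti-nilpotent if $H^j_{\mathfrak{m}}(R)$ is anti-nilpotent for all $j$. For an $F$-finite ring $R$, an ideal $I\subseteq R$ is uniformly compatible if $\phi(F^e_*I)\subseteq I$ for all $e\in\mathbb{N}$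 and all $\phi\in\mathrm{Hom}_R(F^e_*R,R)$. *)

theory Defs
  imports "HOL-Computational_Algebra.Primes" "HOL-Algebra.Ring_Divisibility" "HOL-Algebra.Ideal_Product"
begin

section \<open>Rings\<close>

definition noetherian_local_ring :: "('a, 'b) ring_scheme \<Rightarrow> 'a set \<Rightarrow> bool" where
  "noetherian_local_ring R \<mm> \<longleftrightarrow>
     cring R \<and> noetherian_ring R \<and> maximalideal \<mm> R \<and> (\<forall>I. maximalideal I R \<longrightarrow> I = \<mm>)"

text \<open>\<^term>\<open>Factorial_Ring.prime\<close> is primality of numbers; the unqualified name is the predicate for
  abstract monoids from \<^theory>\<open>HOL-Algebra.Divisibility\<close>.\<close>

definition prime_characteristic :: "('a, 'b) ring_scheme \<Rightarrow> nat \<Rightarrow> bool" where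
  "prime_characteristic R p \<longleftrightarrow>
     Factorial_Ring.prime p \<and> \<one>\<^bsub>R\<^esub> \<noteq> \<zero>\<^bsub>R\<^esub> \<and> add_pow R p \<one>\<^bsub>R\<^esub> = \<zero>\<^bsub>R\<^esub>"

text \<open>Bijectivity of the canonical map from \<open>R\<close> to the inverse limit of the rings \<open>R / \<mm>\<^sup>n\<close>,
  unfolded in terms of coherent sequences of representatives. Powers of \<open>\<mm>\<close> are taken in the
  monoid of ideals.\<close>

definition adically_complete :: "('a, 'b) ring_scheme \<Rightarrow> 'a set \<Rightarrow> bool" where
  "adically_complete R \<mm> \<longleftrightarrow>
     (\<forall>x :: nat \<Rightarrow> 'a.
        (\<forall>n. x n \<in> carrier R) \<and>
        (\<forall>n. x (Suc n) \<ominus>\<^bsub>R\<^esub> x n \<in> \<mm> [^]\<^bsub>ideals_set R\<^esub> n) \<longrightarrow>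
        (\<exists>!y. y \<in> carrier R \<and> (\<forall>n. y \<ominus>\<^bsub>R\<^esub> x n \<in> \<mm> [^]\<^bsub>ideals_set R\<^esub> n)))"

definition ideal_radical :: "('a, 'b) ring_scheme \<Rightarrow> 'a set \<Rightarrow> 'a set" where
  "ideal_radical R I = {r \<in> carrier R. \<exists>n::nat. r [^]\<^bsub>R\<^esub> n \<in> I}"


section \<open>Modules\<close>

text \<open>The fields \<open>mult\<close> and \<open>one\<close> of a \<open>module\<close> record play no role for modules; they are left
  \<open>undefined\<close> where there is no natural multiplication.\<close>

definition regular_module :: "('a, 'b) ring_scheme \<Rightarrow> ('a, 'a) module" where
  "regular_module R =
     \<lparr>carrier = carrier R, mult = mult R, one = \<one>\<^bsub>R\<^esub>,
      zero = \<zero>\<^bsub>R\<^esub>, add = add R, smult = mult R\<rparr>"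

definition finitely_generated_module ::
    "('a, 'b) ring_scheme \<Rightarrow> ('a, 'c, 'd) module_scheme \<Rightarrow> bool" where
  "finitely_generated_module R M \<longleftrightarrow>
     (\<exists>A. finite A \<and> A \<subseteq> carrier M \<and> carrier M = \<Inter>{N. submodule N R M \<and> A \<subseteq> N})"

definition Hom_module ::
    "('a, 'b) ring_scheme \<Rightarrow> ('a, 'c, 'd) module_scheme \<Rightarrow> ('a, 'e, 'f) module_scheme
      \<Rightarrow> ('c \<Rightarrow> 'e) set" where
  "Hom_module R M N =
     {\<phi> \<in> carrier M \<rightarrow> carrier N.
        (\<forall>x\<in>carrier M. \<forall>y\<in>carrier M. \<phi> (x \<oplus>\<^bsub>M\<^esub> y) = \<phi> x \<oplus>\<^bsub>N\<^esub> \<phi> y) \<and>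
        (\<forall>r\<in>carrier R. \<forall>x\<in>carrier M. \<phi> (r \<odot>\<^bsub>M\<^esub> x) = r \<odot>\<^bsub>N\<^esub> \<phi> x)}"

definition annihilator :: "('a, 'b) ring_scheme \<Rightarrow> ('a, 'c, 'd) module_scheme \<Rightarrow> 'a set" where
  "annihilator R M = {r \<in> carrier R. \<forall>x\<in>carrier M. r \<odot>\<^bsub>M\<^esub> x = \<zero>\<^bsub>M\<^esub>}"

definition quotient_module ::
    "('a, 'c, 'd) module_scheme \<Rightarrow> 'c set \<Rightarrow> ('a, 'c set) module" where
  "quotient_module M N =
     \<lparr>carrier = a_rcosets\<^bsub>M\<^esub> N, mult = undefined, one = undefined, zero = N, add = set_add M,
      smult = (\<lambda>r X. \<Union>x\<in>X. N +>\<^bsub>M\<^esub> (r \<odot>\<^bsub>M\<^esub> x))\<rparr>"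

text \<open>The map induced on \<open>M / N\<close> by an additive \<open>F : M \<rightarrow> M\<close> with \<open>F(N) \<subseteq> N\<close>; the cosets in the
  union then all coincide.\<close>

definition quotient_map ::
    "('a, 'c, 'd) module_scheme \<Rightarrow> 'c set \<Rightarrow> ('c \<Rightarrow> 'c) \<Rightarrow> 'c set \<Rightarrow> 'c set" where
  "quotient_map M N F X = (\<Union>x\<in>X. N +>\<^bsub>M\<^esub> F x)"

definition subquotient ::
    "('a, 'c, 'd) module_scheme \<Rightarrow> 'c set \<Rightarrow> 'c set \<Rightarrow> ('a, 'c set) module" where
  "subquotient M L N = quotient_module (M\<lparr>carrier := L\<rparr>) N"


section \<open>Frobenius pushforwards and uniformly compatible ideals\<close>

text \<open>\<open>F\<^sup>e\<^sub>*M\<close> for a module \<open>M\<close> over a ring \<open>R\<close> of characteristic \<open>p\<close>.\<close>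

definition frobenius_pushforward ::
    "('a, 'b) ring_scheme \<Rightarrow> nat \<Rightarrow> nat \<Rightarrow> ('a, 'c, 'd) module_scheme
      \<Rightarrow> ('a, 'c, 'd) module_scheme" where
  "frobenius_pushforward R p e M = M\<lparr>smult := \<lambda>r x. (r [^]\<^bsub>R\<^esub> (p ^ e)) \<odot>\<^bsub>M\<^esub> x\<rparr>"

definition F_finite :: "('a, 'b) ring_scheme \<Rightarrow> nat \<Rightarrow> bool" where
  "F_finite R p \<longleftrightarrow>
     finitely_generated_module R (frobenius_pushforward R p 1 (regular_module R))"

definition uniformly_compatible :: "('a, 'b) ring_scheme \<Rightarrow> nat \<Rightarrow> 'a set \<Rightarrow> bool" where
  "uniformly_compatible R p I \<longleftrightarrow>
     ideal I R \<and>
     (\<forall>e. \<forall>\<phi> \<in> Hom_module R (frobenius_pushforward R p e (regular_module R)) (regular_module R).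
        \<phi> ` I \<subseteq> I)"


section \<open>Modules with a Frobenius action\<close>

definition F_stable ::
    "('a, 'b) ring_scheme \<Rightarrow> ('a, 'c, 'd) module_scheme \<Rightarrow> ('c \<Rightarrow> 'c) \<Rightarrow> 'c set \<Rightarrow> bool" where
  "F_stable R M F N \<longleftrightarrow> submodule N R M \<and> F ` N \<subseteq> N"

definition anti_nilpotent ::
    "('a, 'b) ring_scheme \<Rightarrow> ('a, 'c, 'd) module_scheme \<Rightarrow> ('c \<Rightarrow> 'c) \<Rightarrow> bool" where
  "anti_nilpotent R M F \<longleftrightarrow>
     (\<forall>N. F_stable R M F N \<longrightarrow> inj_on (quotient_map M N F) (carrier (quotient_module M N)))"


section \<open>Localization\<close>

text \<open>The fraction \<open>a / s\<close> is the equivalence class of \<open>(a, s)\<close>; operations on fractions are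
  defined as unions over representatives, all of which give the same class.\<close>

definition fraction :: "('a, 'b) ring_scheme \<Rightarrow> 'a set \<Rightarrow> 'a \<Rightarrow> 'a \<Rightarrow> ('a \<times> 'a) set" where
  "fraction R S a s =
     {(b, t). b \<in> carrier R \<and> t \<in> S \<and>
        (\<exists>u\<in>S. u \<otimes>\<^bsub>R\<^esub> (t \<otimes>\<^bsub>R\<^esub> a) = u \<otimes>\<^bsub>R\<^esub> (s \<otimes>\<^bsub>R\<^esub> b))}"

definition localization :: "('a, 'b) ring_scheme \<Rightarrow> 'a set \<Rightarrow> ('a, ('a \<times> 'a) set) module" where
  "localization R S =
     \<lparr>carrier = {fraction R S a s |a s. a \<in> carrier R \<and> s \<in> S},
      mult = (\<lambda>X Y. \<Union>(a, s)\<in>X. \<Union>(b, t)\<in>Y. fraction R S (a \<otimes>\<^bsub>R\<^esub> b) (s \<otimes>\<^bsub>R\<^esub> t)),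
      one = fraction R S \<one>\<^bsub>R\<^esub> \<one>\<^bsub>R\<^esub>,
      zero = fraction R S \<zero>\<^bsub>R\<^esub> \<one>\<^bsub>R\<^esub>,
      add = (\<lambda>X Y. \<Union>(a, s)\<in>X. \<Union>(b, t)\<in>Y.
               fraction R S (t \<otimes>\<^bsub>R\<^esub> a \<oplus>\<^bsub>R\<^esub> s \<otimes>\<^bsub>R\<^esub> b) (s \<otimes>\<^bsub>R\<^esub> t)),
      smult = (\<lambda>r X. \<Union>(a, s)\<in>X. fraction R S (r \<otimes>\<^bsub>R\<^esub> a) s)\<rparr>"

inductive_set mult_closure :: "('a, 'b) ring_scheme \<Rightarrow> 'a set \<Rightarrow> 'a set"
  for R :: "('a, 'b) ring_scheme" (structure) and A :: "'a set" where
  one: "\<one> \<in> mult_closure R A"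
| step: "a \<in> A \<Longrightarrow> s \<in> mult_closure R A \<Longrightarrow> a \<otimes> s \<in> mult_closure R A"


section \<open>Local cohomology via the Cech complex\<close>

text \<open>For \<open>fs = [f\<^sub>0, \<dots>, f\<^sub>n\<^sub>-\<^sub>1]\<close>, \<open>cech_ring R fs S\<close> is the localization of \<open>R\<close> at \<open>\<Prod>\<^sub>j\<^sub>\<in>\<^sub>S f\<^sub>j\<close>,
  with the monomials in the \<open>f\<^sub>j\<close>, \<open>j \<in> S\<close>, as denominators, so that for \<open>S \<subseteq> T\<close> the canonical map
  \<open>cech_ring R fs S \<rightarrow> cech_ring R fs T\<close> is \<open>a / s \<mapsto> a / s\<close>.\<close>

definition cech_denoms :: "('a, 'b) ring_scheme \<Rightarrow> 'a list \<Rightarrow> nat set \<Rightarrow> 'a set" where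
  "cech_denoms R fs S = mult_closure R ((!) fs ` S)"

definition cech_ring ::
    "('a, 'b) ring_scheme \<Rightarrow> 'a list \<Rightarrow> nat set \<Rightarrow> ('a, ('a \<times> 'a) set) module" where
  "cech_ring R fs S = localization R (cech_denoms R fs S)"

definition cech_restriction ::
    "('a, 'b) ring_scheme \<Rightarrow> 'a list \<Rightarrow> nat set \<Rightarrow> ('a \<times> 'a) set \<Rightarrow> ('a \<times> 'a) set" where
  "cech_restriction R fs T X = (\<Union>(a, s)\<in>X. fraction R (cech_denoms R fs T) a s)"

text \<open>The degree is an integer; there are no index sets in negative degrees, hence the complex and
  its cohomology vanish there.\<close>

definition cech_index :: "'a list \<Rightarrow> int \<Rightarrow> nat set set" where
  "cech_index fs i = {S. S \<subseteq> {..<length fs} \<and> int (card S) = i}"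

type_synonym 'a cochain = "nat set \<Rightarrow> ('a \<times> 'a) set"

definition cech_module ::
    "('a, 'b) ring_scheme \<Rightarrow> 'a list \<Rightarrow> int \<Rightarrow> ('a, 'a cochain) module" where
  "cech_module R fs i =
     \<lparr>carrier = (\<Pi>\<^sub>E S\<in>cech_index fs i. carrier (cech_ring R fs S)),
      mult = undefined,
      one = undefined,
      zero = (\<lambda>S\<in>cech_index fs i. \<zero>\<^bsub>cech_ring R fs S\<^esub>),
      add = (\<lambda>c c'. \<lambda>S\<in>cech_index fs i. c S \<oplus>\<^bsub>cech_ring R fs S\<^esub> c' S),
      smult = (\<lambda>r c. \<lambda>S\<in>cech_index fs i. r \<odot>\<^bsub>cech_ring R fs S\<^esub> c S)\<rparr>"

text \<open>The differential from degree \<open>i\<close> to degree \<open>i + 1\<close>; the summand for \<open>j \<in> T\<close> carries the sign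
  \<open>(-1)\<close> to the number of elements of \<open>T\<close> below \<open>j\<close>.\<close>

definition cech_differential ::
    "('a, 'b) ring_scheme \<Rightarrow> 'a list \<Rightarrow> int \<Rightarrow> 'a cochain \<Rightarrow> 'a cochain" where
  "cech_differential R fs i c =
     (\<lambda>T\<in>cech_index fs (i + 1).
        \<Oplus>\<^bsub>cech_ring R fs T\<^esub> j\<in>T.
          (let x = cech_restriction R fs T (c (T - {j}))
           in if even (card {k\<in>T. k < j}) then x else \<ominus>\<^bsub>cech_ring R fs T\<^esub> x))"

definition cech_cocycles :: "('a, 'b) ring_scheme \<Rightarrow> 'a list \<Rightarrow> int \<Rightarrow> 'a cochain set" where
  "cech_cocycles R fs i =
     {c \<in> carrier (cech_module R fs i).
        cech_differential R fs i c = \<zero>\<^bsub>cech_module R fs (i + 1)\<^esub>}"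

definition cech_coboundaries :: "('a, 'b) ring_scheme \<Rightarrow> 'a list \<Rightarrow> int \<Rightarrow> 'a cochain set" where
  "cech_coboundaries R fs i =
     cech_differential R fs (i - 1) ` carrier (cech_module R fs (i - 1))"

text \<open>\<open>H\<^sup>i\<^sub>I(R)\<close> for the ideal \<open>I\<close> generated by \<open>fs\<close>, and the Frobenius action on it, which is induced
  by the Frobenius endomorphisms \<open>x \<mapsto> x\<^sup>p\<close> of the rings in the Cech complex.\<close>

definition local_cohomology ::
    "('a, 'b) ring_scheme \<Rightarrow> 'a list \<Rightarrow> int \<Rightarrow> ('a, 'a cochain set) module" where
  "local_cohomology R fs i =
     subquotient (cech_module R fs i) (cech_cocycles R fs i) (cech_coboundaries R fs i)"

definition cech_frobenius ::
    "('a, 'b) ring_scheme \<Rightarrow> nat \<Rightarrow> 'a list \<Rightarrow> int \<Rightarrow> 'a cochain \<Rightarrow> 'a cochain" where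
  "cech_frobenius R p fs i c = (\<lambda>S\<in>cech_index fs i. c S [^]\<^bsub>cech_ring R fs S\<^esub> p)"

definition local_cohomology_frobenius ::
    "('a, 'b) ring_scheme \<Rightarrow> nat \<Rightarrow> 'a list \<Rightarrow> int \<Rightarrow> 'a cochain set \<Rightarrow> 'a cochain set" where
  "local_cohomology_frobenius R p fs i =
     quotient_map (cech_module R fs i) (cech_coboundaries R fs i) (cech_frobenius R p fs i)"

text \<open>Here \<open>fs\<close> is a sequence of generators of the maximal ideal.\<close>

definition F_anti_nilpotent :: "('a, 'b) ring_scheme \<Rightarrow> nat \<Rightarrow> 'a list \<Rightarrow> bool" where
  "F_anti_nilpotent R p fs \<longleftrightarrow>
     (\<forall>j. anti_nilpotent R (local_cohomology R fs j) (local_cohomology_frobenius R p fs j))"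

end

theory Submission
  imports Defs
begin

text \<open>
  Let \<open>H = H\<^sup>i\<^sub>\<mm>(R)\<close> with Frobenius action \<open>F\<close>, let \<open>N \<subseteq> L\<close> be \<open>F\<close>-stable submodules whose quotient has a radical
  annihilator \<open>J\<close>, and let \<open>\<phi> : F\<^sup>e\<^sub>*R \<rightarrow> R\<close> be linear and \<open>q = p\<^sup>e > 1\<close>. On fractions, \<open>a / s = a s\<^sup>q\<^sup>-\<^sup>1 / s\<^sup>q\<close>
  suggests the map \<open>a / s \<mapsto> \<phi>(a s\<^sup>q\<^sup>-\<^sup>1) / s\<close>. It commutes with the Cech differential and hence induces an additive
  map \<open>\<psi>\<close> on \<open>H\<close> with \<open>\<psi>(s F\<^sup>e(x)) = \<phi>(s) x\<close>. For \<open>r \<in> J\<close> the element \<open>c = \<phi>(r)\<close> has to be shown to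
  lie in \<open>J\<close>. The map \<open>G = r F\<^sup>e\<close> takes \<open>L\<close> into \<open>N\<close>, and \<open>\<psi>(G(x)) = c x\<close>. If \<open>c\<close> were a unit, one could
  argue as follows. Since \<open>H\<close> is artinian, some \<open>G\<^sup>K(\<eta>)\<close> with \<open>\<eta> \<in> L\<close> is a combination of the \<open>G\<^sup>j(\<eta>)\<close> with \<open>j > K\<close>;
  undoing \<open>G\<close> by \<open>\<psi>\<close> exactly \<open>K\<close> times exhibits \<open>\<eta>\<close> as a combination of the \<open>G\<^sup>j(\<eta>)\<close> with \<open>j > 0\<close>, that is
  as an element of \<open>N\<close>. For general \<open>c\<close> the same computation, with powers of \<open>c\<close> inserted, shows \<open>c\<^sup>2 \<eta> \<in> N\<close>
  (\<open>trace_square_annihilates\<close>). So \<open>c\<^sup>2 \<in> J\<close>, and \<open>c \<in> J\<close> because \<open>J\<close> is radical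
  (\<open>trace_preserves_radical_annihilator\<close>).

  It remains to see that \<open>H\<close> is artinian. A module whose elements are killed by powers of \<open>x\<close> is artinian as soon as
  the elements killed by \<open>x\<close> form an artinian module (\<open>artinian_between_torsion\<close>). This criterion is applied to the
  cohomology of a family of complexes, indexed by the sets \<open>V\<close> of generators of \<open>\<mm>\<close>, which are of Cech type in the
  directions in \<open>V\<close> and of Koszul type in the others. Their cohomology is torsion with respect to every generator
  (\<open>cocycle_torsion\<close>). For the Koszul complex the classes killed by \<open>\<mm>\<close> form a finite-dimensional vector space
  (\<open>artinian_koszul\<close>). When a generator \<open>f\<^sub>v\<close> is added to \<open>V\<close>, the classes killed by \<open>f\<^sub>v\<close> are images of classes of the
  preceding complex (\<open>colon_in_image\<close>). The last complex of the family is the Cech complex.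

  Finally, if the Frobenius action on \<open>L / N\<close> is injective, then \<open>r\<^sup>p L \<subseteq> N\<close> implies \<open>r L \<subseteq> N\<close>, because
  \<open>F(r x) = r\<^sup>p F(x)\<close>; hence \<open>J\<close> is radical (\<open>radical_annihilator_if_injective\<close>). Anti-nilpotency supplies the
  injectivity for all \<open>F\<close>-stable subquotients.
\<close>

section \<open>Artinian subquotients\<close>

text \<open>The descending chain condition for \<open>Z / B\<close>, phrased with the submodules of the ambient module
  that lie between \<open>B\<close> and \<open>Z\<close>. Cohomology can thus be treated at the level of cochains,
  without forming quotients.\<close>

definition artinian_between ::
    "('a, 'b) ring_scheme \<Rightarrow> ('a, 'c, 'd) module_scheme \<Rightarrow> 'c set \<Rightarrow> 'c set \<Rightarrow> bool" where
  "artinian_between R M Z B \<longleftrightarrow>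
     (\<forall>N :: nat \<Rightarrow> 'c set.
        (\<forall>k. submodule (N k) R M \<and> B \<subseteq> N k \<and> N k \<subseteq> Z \<and> N (Suc k) \<subseteq> N k) \<longrightarrow>
        (\<exists>K. \<forall>k\<ge>K. N k = N K))"

lemma artinian_betweenI:
  fixes R :: "('a, 'b) ring_scheme" and M :: "('a, 'c, 'd) module_scheme"
  assumes "\<And>N :: nat \<Rightarrow> 'c set. (\<And>k. submodule (N k) R M) \<Longrightarrow> (\<And>k. B \<subseteq> N k) \<Longrightarrow> (\<And>k. N k \<subseteq> Z) \<Longrightarrow>
             (\<And>j k. j \<le> k \<Longrightarrow> N k \<subseteq> N j) \<Longrightarrow> \<exists>K. \<forall>k\<ge>K. N K \<subseteq> N k"
  shows "artinian_between R M Z B"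
  unfolding artinian_between_def
proof (intro allI impI)
  fix N :: "nat \<Rightarrow> 'c set"
  assume N: "\<forall>k. submodule (N k) R M \<and> B \<subseteq> N k \<and> N k \<subseteq> Z \<and> N (Suc k) \<subseteq> N k"
  have anti: "N k \<subseteq> N j" if "j \<le> k" for j k
    by (rule lift_Suc_antimono_le[of N, OF _ that]) (use N in blast)
  obtain K where "\<forall>k\<ge>K. N K \<subseteq> N k"
    using assms[of N] N anti by auto
  then have "\<forall>k\<ge>K. N k = N K"
    using anti by blast
  then show "\<exists>K. \<forall>k\<ge>K. N k = N K" ..
qed

lemma artinian_betweenD:
  assumes "artinian_between R M Z B"
    and "\<And>k. submodule (N k) R M" "\<And>k. B \<subseteq> N k" "\<And>k. N k \<subseteq> Z" "\<And>k. N (Suc k) \<subseteq> N k"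
  shows "\<exists>K. \<forall>k\<ge>K. N k = N K"
  using assms unfolding artinian_between_def by simp

context module
begin

lemma submodule_zero: "submodule N R M \<Longrightarrow> \<zero>\<^bsub>M\<^esub> \<in> N"
  using subgroup.one_closed[OF submodule.axioms(1), of N R M] by simp

lemma submodule_minus: "submodule N R M \<Longrightarrow> x \<in> N \<Longrightarrow> y \<in> N \<Longrightarrow> x \<ominus>\<^bsub>M\<^esub> y \<in> N"
  using submoduleE(3,5) by (simp add: a_minus_def)

lemma submodule_carrier: "submodule N R M \<Longrightarrow> x \<in> N \<Longrightarrow> x \<in> carrier M"
  using submoduleE(1) by blast

lemma submodule_diff_cancel:
  assumes "submodule N R M" "x \<in> carrier M" "y \<in> N" "x \<ominus>\<^bsub>M\<^esub> y \<in> N"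
  shows "x \<in> N"
proof -
  have "(x \<ominus>\<^bsub>M\<^esub> y) \<oplus>\<^bsub>M\<^esub> y = x"
    using assms submodule_carrier by (simp add: a_minus_def M.a_assoc M.l_neg)
  then show ?thesis
    using submoduleE(5)[OF assms(1,4,3)] by simp
qed

lemma add_minus_cancel:
  assumes "x \<in> carrier M" "y \<in> carrier M"
  shows "(x \<oplus>\<^bsub>M\<^esub> y) \<ominus>\<^bsub>M\<^esub> x = y"
proof -
  have "(x \<oplus>\<^bsub>M\<^esub> y) \<ominus>\<^bsub>M\<^esub> x = (y \<oplus>\<^bsub>M\<^esub> x) \<ominus>\<^bsub>M\<^esub> x"
    using assms by (simp add: M.a_comm)
  also have "\<dots> = y"
    using assms by (simp add: a_minus_def M.a_assoc M.r_neg)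
  finally show ?thesis .
qed

lemma submodule_Int:
  assumes "submodule N R M" "submodule P R M"
  shows "submodule (N \<inter> P) R M"
  by (rule submoduleI) (use assms submodule_zero submoduleE in auto)

lemma submodule_colon:
  assumes "submodule Z R M" "submodule B R M" "A \<subseteq> carrier R"
  shows "submodule {z \<in> Z. \<forall>a\<in>A. a \<odot>\<^bsub>M\<^esub> z \<in> B} R M"
proof (rule submoduleI)
  fix a z assume a: "a \<in> carrier R" and z: "z \<in> {z \<in> Z. \<forall>a\<in>A. a \<odot>\<^bsub>M\<^esub> z \<in> B}"
  have "b \<odot>\<^bsub>M\<^esub> (a \<odot>\<^bsub>M\<^esub> z) \<in> B" if "b \<in> A" for b
  proof -
    have "b \<odot>\<^bsub>M\<^esub> (a \<odot>\<^bsub>M\<^esub> z) = a \<odot>\<^bsub>M\<^esub> (b \<odot>\<^bsub>M\<^esub> z)"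
      using a z that assms submodule_carrier[OF assms(1)]
      by (metis (no_types, lifting) R.m_comm mem_Collect_eq smult_assoc1 subsetD)
    then show ?thesis
      using that z a submoduleE(4)[OF assms(2)] by auto
  qed
  then show "a \<odot>\<^bsub>M\<^esub> z \<in> {z \<in> Z. \<forall>a\<in>A. a \<odot>\<^bsub>M\<^esub> z \<in> B}"
    using a z submoduleE(4)[OF assms(1)] by auto
next
  fix x y assume xy: "x \<in> {z \<in> Z. \<forall>a\<in>A. a \<odot>\<^bsub>M\<^esub> z \<in> B}" "y \<in> {z \<in> Z. \<forall>a\<in>A. a \<odot>\<^bsub>M\<^esub> z \<in> B}"
  then show "x \<oplus>\<^bsub>M\<^esub> y \<in> {z \<in> Z. \<forall>a\<in>A. a \<odot>\<^bsub>M\<^esub> z \<in> B}"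
    using assms submoduleE(5) submodule_carrier[OF assms(1)] by (auto simp: smult_r_distr subsetD)
next
  fix x assume "x \<in> {z \<in> Z. \<forall>a\<in>A. a \<odot>\<^bsub>M\<^esub> z \<in> B}"
  then show "\<ominus>\<^bsub>M\<^esub> x \<in> {z \<in> Z. \<forall>a\<in>A. a \<odot>\<^bsub>M\<^esub> z \<in> B}"
    using assms submoduleE(3) submodule_carrier[OF assms(1)] by (auto simp: smult_r_minus subsetD)
next
  show "\<zero>\<^bsub>M\<^esub> \<in> {z \<in> Z. \<forall>a\<in>A. a \<odot>\<^bsub>M\<^esub> z \<in> B}"
    using assms submodule_zero by (auto simp: subsetD)
next
  show "{z \<in> Z. \<forall>a\<in>A. a \<odot>\<^bsub>M\<^esub> z \<in> B} \<subseteq> carrier M"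
    using submodule_carrier[OF assms(1)] by auto
qed

lemma submodule_add:
  assumes N: "submodule N R M" and P: "submodule P R M"
  shows "submodule (N <+>\<^bsub>M\<^esub> P) R M"
proof (rule submoduleI)
  note c = submodule_carrier[OF N] submodule_carrier[OF P]
  show "N <+>\<^bsub>M\<^esub> P \<subseteq> carrier M"
    using c by (auto simp: set_add_def')
  show "\<zero>\<^bsub>M\<^esub> \<in> N <+>\<^bsub>M\<^esub> P"
    unfolding set_add_def' using submodule_zero[OF N] submodule_zero[OF P] M.l_zero[OF M.zero_closed]
    by (metis (no_types, lifting) UN_I singletonI)
  fix x assume "x \<in> N <+>\<^bsub>M\<^esub> P"
  then obtain a b where ab: "x = a \<oplus>\<^bsub>M\<^esub> b" "a \<in> N" "b \<in> P"
    by (auto simp: set_add_def')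
  have "\<ominus>\<^bsub>M\<^esub> x = (\<ominus>\<^bsub>M\<^esub> a) \<oplus>\<^bsub>M\<^esub> (\<ominus>\<^bsub>M\<^esub> b)"
    using ab c by (simp add: M.minus_add)
  then show "\<ominus>\<^bsub>M\<^esub> x \<in> N <+>\<^bsub>M\<^esub> P"
    using ab submoduleE(3)[OF N] submoduleE(3)[OF P] by (auto simp: set_add_def')
  show "r \<odot>\<^bsub>M\<^esub> x \<in> N <+>\<^bsub>M\<^esub> P" if r: "r \<in> carrier R" for r
  proof -
    have "r \<odot>\<^bsub>M\<^esub> x = (r \<odot>\<^bsub>M\<^esub> a) \<oplus>\<^bsub>M\<^esub> (r \<odot>\<^bsub>M\<^esub> b)"
      using ab c r by (simp add: smult_r_distr)
    moreover have "r \<odot>\<^bsub>M\<^esub> a \<in> N" "r \<odot>\<^bsub>M\<^esub> b \<in> P"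
      using ab r submoduleE(4)[OF N] submoduleE(4)[OF P] by auto
    ultimately show ?thesis unfolding set_add_def' by blast
  qed
  fix y assume "y \<in> N <+>\<^bsub>M\<^esub> P"
  then obtain a' b' where ab': "y = a' \<oplus>\<^bsub>M\<^esub> b'" "a' \<in> N" "b' \<in> P"
    by (auto simp: set_add_def')
  have "x \<oplus>\<^bsub>M\<^esub> y = (a \<oplus>\<^bsub>M\<^esub> a') \<oplus>\<^bsub>M\<^esub> (b \<oplus>\<^bsub>M\<^esub> b')"
    using ab ab' c by (simp add: M.add.m_ac)
  moreover have "a \<oplus>\<^bsub>M\<^esub> a' \<in> N" "b \<oplus>\<^bsub>M\<^esub> b' \<in> P"
    using ab ab' submoduleE(5)[OF N] submoduleE(5)[OF P] by auto
  ultimately show "x \<oplus>\<^bsub>M\<^esub> y \<in> N <+>\<^bsub>M\<^esub> P"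
    unfolding set_add_def' by blast
qed

lemma subset_set_add:
  assumes N: "submodule N R M" and P: "submodule P R M"
  shows "N \<subseteq> N <+>\<^bsub>M\<^esub> P" "P \<subseteq> N <+>\<^bsub>M\<^esub> P"
proof -
  have "x \<in> N <+>\<^bsub>M\<^esub> P" if "x \<in> N" for x
    unfolding set_add_def' using that submodule_zero[OF P] submodule_carrier[OF N] M.r_zero
    by (metis (no_types, lifting) UN_I singletonI)
  then show "N \<subseteq> N <+>\<^bsub>M\<^esub> P" by blast
  have "x \<in> N <+>\<^bsub>M\<^esub> P" if "x \<in> P" for x
    unfolding set_add_def' using that submodule_zero[OF N] submodule_carrier[OF P] M.l_zero
    by (metis (no_types, lifting) UN_I singletonI)
  then show "P \<subseteq> N <+>\<^bsub>M\<^esub> P" by blast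
qed

lemma set_add_least:
  assumes "submodule Q R M" "N \<subseteq> Q" "P \<subseteq> Q"
  shows "N <+>\<^bsub>M\<^esub> P \<subseteq> Q"
  using assms(2,3) submoduleE(5)[OF assms(1)] by (auto simp: set_add_def' subsetD)

text \<open>A chain in \<open>Z / B\<close> is controlled by its traces on \<open>W\<close> and its images modulo \<open>W\<close>: if
  both stand still from \<open>K\<close> on, then an element of \<open>N\<^sub>K\<close> differs from one of \<open>N\<^sub>k\<close> by an element of
  \<open>N\<^sub>K \<inter> W = N\<^sub>k \<inter> W\<close>.\<close>

lemma artinian_between_trans:
  assumes W: "submodule W R M" and Z: "submodule Z R M" and "B \<subseteq> W" "W \<subseteq> Z"
    and art1: "artinian_between R M W B" and art2: "artinian_between R M Z W"
  shows "artinian_between R M Z B"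
proof (rule artinian_betweenI)
  fix N :: "nat \<Rightarrow> _ set" assume N: "\<And>k. submodule (N k) R M" "\<And>k. B \<subseteq> N k" "\<And>k. N k \<subseteq> Z"
    and anti: "\<And>j k. j \<le> k \<Longrightarrow> N k \<subseteq> N j"
  have "\<exists>K. \<forall>k\<ge>K. N k \<inter> W = N K \<inter> W"
  proof (rule artinian_betweenD[OF art1])
    show "submodule (N k \<inter> W) R M" for k
      by (rule submodule_Int[OF N(1) W])
    show "B \<subseteq> N k \<inter> W" "N k \<inter> W \<subseteq> W" "N (Suc k) \<inter> W \<subseteq> N k \<inter> W" for k
      using N(2)[of k] anti[of k "Suc k"] \<open>B \<subseteq> W\<close> by auto
  qed
  then obtain K1 where K1: "\<And>k. k \<ge> K1 \<Longrightarrow> N k \<inter> W = N K1 \<inter> W" by blast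
  have "\<exists>K. \<forall>k\<ge>K. N k <+>\<^bsub>M\<^esub> W = N K <+>\<^bsub>M\<^esub> W"
  proof (rule artinian_betweenD[OF art2])
    show "N (Suc k) <+>\<^bsub>M\<^esub> W \<subseteq> N k <+>\<^bsub>M\<^esub> W" for k
      using anti[of k "Suc k"] by (auto simp: set_add_def')
  qed (use N W Z \<open>W \<subseteq> Z\<close> in \<open>auto intro: submodule_add simp: set_add_least subset_set_add\<close>)
  then obtain K2 where K2: "\<And>k. k \<ge> K2 \<Longrightarrow> N k <+>\<^bsub>M\<^esub> W = N K2 <+>\<^bsub>M\<^esub> W" by blast
  define K where "K = max K1 K2"
  have "N K \<subseteq> N k" if "k \<ge> K" for k
  proof
    fix x assume x: "x \<in> N K"
    have "x \<in> N K <+>\<^bsub>M\<^esub> W"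
      using subset_set_add(1)[OF N(1) W] x by blast
    then have "x \<in> N k <+>\<^bsub>M\<^esub> W"
      using K2[of K] K2[of k] that by (simp add: K_def)
    then obtain a w where aw: "x = a \<oplus>\<^bsub>M\<^esub> w" "a \<in> N k" "w \<in> W"
      by (auto simp: set_add_def')
    have ac: "a \<in> carrier M" "w \<in> carrier M" "x \<in> carrier M"
      using aw x N(1) W submodule_carrier by blast+
    have "w = x \<ominus>\<^bsub>M\<^esub> a"
      using aw(1) ac add_minus_cancel by simp
    moreover have "x \<ominus>\<^bsub>M\<^esub> a \<in> N K"
      using x aw(2) anti[OF that] submodule_minus[OF N(1)] by blast
    ultimately have "w \<in> N k"
      using K1[of K] K1[of k] that aw(3) by (auto simp: K_def)
    then show "x \<in> N k"
      using aw submoduleE(5)[OF N(1)] by blast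
  qed
  then show "\<exists>K. \<forall>k\<ge>K. N K \<subseteq> N k" by blast
qed

definition multiples :: "'c \<Rightarrow> 'c set" where
  "multiples g = (\<lambda>r. r \<odot>\<^bsub>M\<^esub> g) ` carrier R"

lemma submodule_multiples:
  assumes "g \<in> carrier M"
  shows "submodule (multiples g) R M"
proof (rule submoduleI)
  show "\<zero>\<^bsub>M\<^esub> \<in> multiples g"
    unfolding multiples_def using smult_l_null[OF assms] R.zero_closed by (metis image_eqI)
  fix x assume "x \<in> multiples g"
  then obtain r where r: "r \<in> carrier R" "x = r \<odot>\<^bsub>M\<^esub> g" by (auto simp: multiples_def)
  show "\<ominus>\<^bsub>M\<^esub> x \<in> multiples g"
    using r smult_l_minus[OF r(1) assms] by (metis R.a_inv_closed image_eqI multiples_def)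
  show "a \<odot>\<^bsub>M\<^esub> x \<in> multiples g" if "a \<in> carrier R" for a
    using r smult_assoc1[OF that r(1) assms] that by (metis R.m_closed image_eqI multiples_def)
  fix y assume "y \<in> multiples g"
  then obtain s where s: "s \<in> carrier R" "y = s \<odot>\<^bsub>M\<^esub> g" by (auto simp: multiples_def)
  show "x \<oplus>\<^bsub>M\<^esub> y \<in> multiples g"
    using r s smult_l_distr[OF r(1) s(1) assms] by (metis R.a_closed image_eqI multiples_def)
qed (use assms in \<open>auto simp: multiples_def\<close>)

lemma generator_in_multiples: "g \<in> carrier M \<Longrightarrow> g \<in> multiples g"
  unfolding multiples_def using smult_one R.one_closed by (metis image_eqI)

text \<open>The module \<open>(B + R g) / B\<close> is zero or isomorphic to \<open>R / \<mm>\<close>, hence has only the two obvious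
  submodules: a coefficient \<open>r \<notin> \<mm>\<close> satisfies \<open>1 = a + s r\<close> with \<open>a \<in> \<mm>\<close>, so that \<open>g\<close> lies in every
  submodule that contains \<open>B\<close> and \<open>r g\<close>.\<close>

lemma artinian_between_simple:
  assumes mx: "maximalideal \<mm> R" and B: "submodule B R M" and g: "g \<in> carrier M"
    and kill: "\<And>r. r \<in> \<mm> \<Longrightarrow> r \<odot>\<^bsub>M\<^esub> g \<in> B"
  shows "artinian_between R M (B <+>\<^bsub>M\<^esub> multiples g) B"
proof (rule artinian_betweenI)
  interpret mx: maximalideal \<mm> R by fact
  have dich: "B <+>\<^bsub>M\<^esub> multiples g \<subseteq> N"
    if N: "submodule N R M" "B \<subseteq> N" "N \<subseteq> B <+>\<^bsub>M\<^esub> multiples g" "\<not> N \<subseteq> B" for N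
  proof -
    from N(4) obtain x where x: "x \<in> N" "x \<notin> B" by blast
    then obtain b r where br: "x = b \<oplus>\<^bsub>M\<^esub> r \<odot>\<^bsub>M\<^esub> g" "b \<in> B" "r \<in> carrier R"
      using N(3) by (fastforce simp: set_add_def' multiples_def)
    have bc: "b \<in> carrier M" using B br(2) submodule_carrier by blast
    have "r \<notin> \<mm>"
      using br x(2) kill submoduleE(5)[OF B] by blast
    have rgN: "r \<odot>\<^bsub>M\<^esub> g \<in> N"
    proof -
      have "r \<odot>\<^bsub>M\<^esub> g = x \<ominus>\<^bsub>M\<^esub> b"
        using br(1,3) bc g add_minus_cancel by simp
      then show ?thesis
        using x(1) br(2) N(2) submodule_minus[OF N(1)] by auto
    qed
    have "\<mm> <+> PIdl r = carrier R"
    proof -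
      have id: "ideal (\<mm> <+> PIdl r) R"
        by (intro add_ideals mx.is_ideal cgenideal_ideal br(3))
      have "\<mm> \<subseteq> \<mm> <+> PIdl r" "r \<in> \<mm> <+> PIdl r"
      proof -
        have "x \<oplus> \<zero> \<otimes> r \<in> \<mm> <+> PIdl r" if "x \<in> \<mm>" for x
          using that unfolding set_add_def' cgenideal_def by auto
        then show "\<mm> \<subseteq> \<mm> <+> PIdl r"
          using mx.a_Hcarr br(3) by auto
        have "\<zero> \<in> \<mm>" "r \<in> PIdl r"
          using additive_subgroup.zero_closed[OF ideal.axioms(1)[OF mx.is_ideal]] cgenideal_self[OF br(3)]
          by auto
        then have "\<zero> \<oplus> r \<in> \<mm> <+> PIdl r"
          unfolding set_add_def' by blast
        then show "r \<in> \<mm> <+> PIdl r" using br(3) by simp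
      qed
      then show ?thesis
        using mx.I_maximal[OF id _ ideal.Icarr[OF id, THEN subsetI]] \<open>r \<notin> \<mm>\<close> by blast
    qed
    then have "\<one> \<in> \<mm> <+> PIdl r" by simp
    then obtain a s where as: "a \<in> \<mm>" "s \<in> carrier R" "\<one> = a \<oplus> s \<otimes> r"
      by (auto simp: set_add_def' cgenideal_def)
    have "g = a \<odot>\<^bsub>M\<^esub> g \<oplus>\<^bsub>M\<^esub> s \<odot>\<^bsub>M\<^esub> (r \<odot>\<^bsub>M\<^esub> g)"
      using as br(3) g mx.a_Hcarr smult_l_distr[of a "s \<otimes> r" g] smult_assoc1[of s r g] smult_one[OF g]
      by auto
    moreover have "a \<odot>\<^bsub>M\<^esub> g \<in> N" "s \<odot>\<^bsub>M\<^esub> (r \<odot>\<^bsub>M\<^esub> g) \<in> N"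
      using kill as N(2) rgN submoduleE(4)[OF N(1)] by auto
    ultimately have "g \<in> N" using submoduleE(5)[OF N(1)] by metis
    then have "multiples g \<subseteq> N"
      using submoduleE(4)[OF N(1)] by (auto simp: multiples_def)
    then show ?thesis
      using set_add_least[OF N(1,2)] by blast
  qed
  fix N :: "nat \<Rightarrow> _ set" assume N: "\<And>k. submodule (N k) R M" "\<And>k. B \<subseteq> N k" "\<And>k. N k \<subseteq> B <+>\<^bsub>M\<^esub> multiples g"
    "\<And>j k. j \<le> k \<Longrightarrow> N k \<subseteq> N j"
  show "\<exists>K. \<forall>k\<ge>K. N K \<subseteq> N k"
  proof (cases "\<exists>K. N K \<subseteq> B")
    case True
    then show ?thesis using N(2) by blast
  next
    case False
    then have "B <+>\<^bsub>M\<^esub> multiples g \<subseteq> N k" for k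
      using dich[OF N(1,2,3)] by blast
    then show ?thesis using N(3) by blast
  qed
qed

text \<open>A finitely generated module killed by \<open>\<mm>\<close> is a finite-dimensional vector space over \<open>R / \<mm>\<close>;
  adding one generator at a time gives a filtration with simple or zero steps.\<close>

lemma artinian_between_fin_gen:
  assumes mx: "maximalideal \<mm> R" and A: "finite A"
    and B: "submodule B R M" and W: "submodule W R M" "B \<subseteq> W" "A \<subseteq> W"
    and gen: "\<And>P. submodule P R M \<Longrightarrow> B \<union> A \<subseteq> P \<Longrightarrow> W \<subseteq> P"
    and kill: "\<And>r a. r \<in> \<mm> \<Longrightarrow> a \<in> A \<Longrightarrow> r \<odot>\<^bsub>M\<^esub> a \<in> B"
  shows "artinian_between R M W B"
  using A B W(2,3) gen kill
proof (induction A arbitrary: B rule: finite_induct)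
  case empty
  then have "W = B" by (metis Un_empty_right subset_antisym subset_refl)
  show ?case
    by (rule artinian_betweenI) (metis \<open>W = B\<close> subset_trans)
next
  case (insert g A)
  let ?B = "B <+>\<^bsub>M\<^esub> multiples g"
  have gW: "g \<in> W" "A \<subseteq> W" using insert.prems(3) by auto
  have g: "g \<in> carrier M" using submodule_carrier[OF W(1) gW(1)] .
  note mg = submodule_multiples[OF g]
  have sB: "submodule ?B R M" using insert.prems(1) mg by (rule submodule_add)
  have incl: "B \<subseteq> ?B" "multiples g \<subseteq> ?B"
    using subset_set_add[OF insert.prems(1) mg] by auto
  have gB: "g \<in> ?B" using incl generator_in_multiples[OF g] by blast
  have BW: "?B \<subseteq> W"
    using insert.prems(2) gW(1) submoduleE(4)[OF W(1)]
    by (intro set_add_least W(1)) (auto simp: multiples_def)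
  have "artinian_between R M W ?B"
  proof (rule insert.IH[OF sB BW gW(2)])
    show "W \<subseteq> P" if "submodule P R M" "?B \<union> A \<subseteq> P" for P
      by (rule insert.prems(4)[OF that(1)]) (use that(2) gB incl(1) in blast)
    show "r \<odot>\<^bsub>M\<^esub> a \<in> ?B" if "r \<in> \<mm>" "a \<in> A" for r a
      using insert.prems(5)[OF that(1), of a] that(2) incl(1) by blast
  qed
  moreover have "artinian_between R M ?B B"
    by (rule artinian_between_simple[OF mx insert.prems(1) g]) (use insert.prems(5) in blast)
  ultimately show ?case
    using artinian_between_trans[OF sB W(1) incl(1) BW] by blast
qed

text \<open>Melkersson's criterion for a principal ideal: if every element of \<open>M = Z / B\<close> is killed by a
  power of \<open>x\<close>, then \<open>M\<close> is artinian as soon as the elements killed by \<open>x\<close> form an artinian module.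
  A chain \<open>N\<^sub>k\<close> in \<open>M\<close> gives the doubly descending family of the \<open>x\<close>-torsion parts of \<open>x\<^sup>n N\<^sub>k\<close>, which
  stabilises uniformly in \<open>n\<close>. This determines \<open>N\<^sub>k\<close>: the last nonzero multiple \<open>x\<^sup>n y\<close> of an element
  of \<open>N\<^sub>K\<close> agrees with some \<open>x\<^sup>n z\<close>, \<open>z \<in> N\<^sub>k\<close>, and \<open>y - z\<close> is killed by \<open>x\<^sup>n\<close> already.\<close>

lemma artinian_between_torsion:
  assumes Z: "submodule Z R M" and B: "submodule B R M" and BZ: "B \<subseteq> Z" and x: "x \<in> carrier R"
    and tors: "\<And>z. z \<in> Z \<Longrightarrow> \<exists>n::nat. (x [^] n) \<odot>\<^bsub>M\<^esub> z \<in> B"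
    and art: "artinian_between R M {z \<in> Z. x \<odot>\<^bsub>M\<^esub> z \<in> B} B"
  shows "artinian_between R M Z B"
proof (rule artinian_betweenI)
  fix N :: "nat \<Rightarrow> _ set" assume N: "\<And>k. submodule (N k) R M" "\<And>k. B \<subseteq> N k" "\<And>k. N k \<subseteq> Z"
    and anti: "\<And>j k. j \<le> k \<Longrightarrow> N k \<subseteq> N j"
  have Zc: "z \<in> carrier M" if "z \<in> Z" for z using submodule_carrier[OF Z that] .
  have Nc: "z \<in> carrier M" if "z \<in> N k" for z k using submodule_carrier[OF N(1) that] .
  define V where "V k n = {y \<in> Z. x \<odot>\<^bsub>M\<^esub> y \<in> B} \<inter> (B <+>\<^bsub>M\<^esub> ((\<lambda>z. (x [^] n) \<odot>\<^bsub>M\<^esub> z) ` N k))"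
    for k and n :: nat
  have img: "submodule ((\<lambda>z. (x [^] n) \<odot>\<^bsub>M\<^esub> z) ` N k) R M" for k and n :: nat
  proof (rule submoduleI)
    let ?h = "\<lambda>z. (x [^] n) \<odot>\<^bsub>M\<^esub> z"
    have xn: "x [^] n \<in> carrier R" using x by simp
    show "?h ` N k \<subseteq> carrier M" using xn Nc by auto
    show "\<zero>\<^bsub>M\<^esub> \<in> ?h ` N k" using submodule_zero[OF N(1)] smult_r_null[OF xn] by (metis image_eqI)
    fix y assume "y \<in> ?h ` N k"
    then obtain a where a: "a \<in> N k" "y = ?h a" by blast
    show "\<ominus>\<^bsub>M\<^esub> y \<in> ?h ` N k"
      using a smult_r_minus[OF xn Nc[OF a(1)]] submoduleE(3)[OF N(1) a(1)] by (metis image_eqI)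
    show "r \<odot>\<^bsub>M\<^esub> y \<in> ?h ` N k" if r: "r \<in> carrier R" for r
    proof -
      have "r \<odot>\<^bsub>M\<^esub> y = ?h (r \<odot>\<^bsub>M\<^esub> a)"
        using a r xn Nc[OF a(1)] by (metis R.m_comm smult_assoc1)
      then show ?thesis using submoduleE(4)[OF N(1) r a(1)] by blast
    qed
    fix y' assume "y' \<in> ?h ` N k"
    then obtain a' where a': "a' \<in> N k" "y' = ?h a'" by blast
    show "y \<oplus>\<^bsub>M\<^esub> y' \<in> ?h ` N k"
      using a a' smult_r_distr[OF xn Nc[OF a(1)] Nc[OF a'(1)]] submoduleE(5)[OF N(1) a(1) a'(1)]
      by (metis image_eqI)
  qed
  have col: "submodule {z \<in> Z. x \<odot>\<^bsub>M\<^esub> z \<in> B} R M"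
    using submodule_colon[OF Z B, of "{x}"] x by simp
  have V: "submodule (V k n) R M" "B \<subseteq> V k n" "V k n \<subseteq> {z \<in> Z. x \<odot>\<^bsub>M\<^esub> z \<in> B}" for k n
    unfolding V_def
    using submodule_Int[OF col submodule_add[OF B img]] subset_set_add(1)[OF B img] BZ
      submoduleE(4)[OF B x] by auto
  have Vk: "V k n \<subseteq> V j n" if "j \<le> k" for j k n
    unfolding V_def set_add_def' using anti[OF that] by blast
  have Vn: "V k (Suc n) \<subseteq> V k n" for k n
  proof -
    have "(x [^] Suc n) \<odot>\<^bsub>M\<^esub> z \<in> (\<lambda>z. (x [^] n) \<odot>\<^bsub>M\<^esub> z) ` N k" if "z \<in> N k" for z
      using that smult_assoc1[OF _ x Nc[OF that], of "x [^] n"] x submoduleE(4)[OF N(1) x that] by auto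
    then have "(\<lambda>z. (x [^] Suc n) \<odot>\<^bsub>M\<^esub> z) ` N k \<subseteq> (\<lambda>z. (x [^] n) \<odot>\<^bsub>M\<^esub> z) ` N k"
      by (rule image_subsetI)
    then show ?thesis unfolding V_def set_add_def' by (intro Int_mono UN_mono subset_refl)
  qed
  have Vn': "V k n \<subseteq> V k m" if "m \<le> n" for k m n
    using lift_Suc_antimono_le[of "V k", OF Vn that] .
  have stab: "\<exists>K. \<forall>k\<ge>K. V k n = V K n" for n
    by (rule artinian_betweenD[OF art]) (use V Vk in auto)
  \<comment> \<open>Beyond the diagonal index \<open>K0\<close> both indices are irrelevant; the finitely many columns
      \<open>n < K0\<close> stabilise one by one.\<close>
  have "\<exists>K. \<forall>k\<ge>K. V k k = V K K"
  proof (rule artinian_betweenD[OF art])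
    show "V (Suc k) (Suc k) \<subseteq> V k k" for k
      using Vk[of k "Suc k" "Suc k"] Vn[of k k] by auto
  qed (use V in auto)
  then obtain K0 where K0: "\<And>k. k \<ge> K0 \<Longrightarrow> V k k = V K0 K0" by metis
  have V0: "V k n = V K0 K0" if "k \<ge> K0" "n \<ge> K0" for k n
  proof
    show "V k n \<subseteq> V K0 K0" using Vk[OF that(1), of n] Vn'[OF that(2), of K0] by blast
    have "V K0 K0 = V (max k n) (max k n)" using K0[of "max k n"] that by simp
    also have "\<dots> \<subseteq> V k n" using Vk[of k "max k n" "max k n"] Vn'[of n "max k n" k] by auto
    finally show "V K0 K0 \<subseteq> V k n" .
  qed
  obtain Kn where Kn: "\<And>n k. k \<ge> Kn n \<Longrightarrow> V k n = V (Kn n) n"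
    using stab by metis
  define K where "K = Max (insert K0 (Kn ` {..<K0}))"
  have Kge: "K \<ge> K0" "\<And>n. n < K0 \<Longrightarrow> K \<ge> Kn n"
    unfolding K_def by (auto intro: Max_ge)
  have VK: "V k n = V K n" if "k \<ge> K" for k n
  proof (cases "n < K0")
    case True
    then show ?thesis using Kn[of n k] Kn[of n K] Kge(2)[OF True] that by simp
  next
    case False
    then show ?thesis using V0[of k n] V0[of K n] Kge that by simp
  qed
  have "N K \<subseteq> N k" if k: "k \<ge> K" for k
  proof -
    have "y \<in> N k" if "y \<in> N K" "(x [^] n) \<odot>\<^bsub>M\<^esub> y \<in> B" for n :: nat and y
      using that
    proof (induction n arbitrary: y)
      case 0
      then show ?case using Nc[OF 0(1)] N(2) by auto
    next
      case (Suc n)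
      have xn: "x [^] n \<in> carrier R" using x by simp
      note yc = Nc[OF Suc.prems(1)]
      have *: "x \<odot>\<^bsub>M\<^esub> (x [^] n \<odot>\<^bsub>M\<^esub> y) = (x [^] Suc n) \<odot>\<^bsub>M\<^esub> y"
        using smult_assoc1[OF x xn yc] x by (simp add: R.m_comm)
      have "x [^] n \<odot>\<^bsub>M\<^esub> y \<in> Z"
        using submoduleE(4)[OF Z xn] N(3) Suc.prems(1) by blast
      then have "x [^] n \<odot>\<^bsub>M\<^esub> y \<in> V K n"
        unfolding V_def using * Suc.prems subset_set_add(2)[OF B img, of n K] by auto
      then have "x [^] n \<odot>\<^bsub>M\<^esub> y \<in> V k n" using VK[OF k] by simp
      then obtain b z where bz: "b \<in> B" "z \<in> N k" "x [^] n \<odot>\<^bsub>M\<^esub> y = b \<oplus>\<^bsub>M\<^esub> x [^] n \<odot>\<^bsub>M\<^esub> z"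
        unfolding V_def set_add_def' by auto
      have bc: "b \<in> carrier M" using submodule_carrier[OF B bz(1)] .
      note zc = Nc[OF bz(2)]
      have "y \<ominus>\<^bsub>M\<^esub> z \<in> N K"
        using Suc.prems(1) bz(2) anti[OF k] submodule_minus[OF N(1)] by blast
      moreover have "(x [^] n) \<odot>\<^bsub>M\<^esub> (y \<ominus>\<^bsub>M\<^esub> z) = b"
        using bz(3) bc zc yc xn
        by (simp add: a_minus_def smult_r_distr smult_r_minus M.a_assoc M.r_neg)
      ultimately have "y \<ominus>\<^bsub>M\<^esub> z \<in> N k" using Suc.IH bz(1) by simp
      then show ?case using submodule_diff_cancel[OF N(1) yc bz(2)] by blast
    qed
    then show ?thesis using tors N(3) by blast
  qed
  then show "\<exists>K. \<forall>k\<ge>K. N K \<subseteq> N k" by blast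
qed

lemma artinian_between_torsion_finite:
  assumes "finite A" and Z: "submodule Z R M" and B: "submodule B R M" and BZ: "B \<subseteq> Z"
    and A: "A \<subseteq> carrier R"
    and tors: "\<And>a z. a \<in> A \<Longrightarrow> z \<in> Z \<Longrightarrow> \<exists>n::nat. (a [^] n) \<odot>\<^bsub>M\<^esub> z \<in> B"
    and art: "artinian_between R M {z \<in> Z. \<forall>a\<in>A. a \<odot>\<^bsub>M\<^esub> z \<in> B} B"
  shows "artinian_between R M Z B"
  using assms
proof (induction A arbitrary: Z rule: finite_induct)
  case empty
  then show ?case by simp
next
  case (insert x A)
  let ?Z = "{z \<in> Z. x \<odot>\<^bsub>M\<^esub> z \<in> B}"
  have x: "x \<in> carrier R" using insert.prems by simp
  have col: "submodule ?Z R M"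
    using submodule_colon[OF insert.prems(1) B, of "{x}"] x by simp
  have eq: "{z \<in> ?Z. \<forall>a\<in>A. a \<odot>\<^bsub>M\<^esub> z \<in> B} = {z \<in> Z. \<forall>a\<in>insert x A. a \<odot>\<^bsub>M\<^esub> z \<in> B}"
    by auto
  have BZ: "B \<subseteq> ?Z" using insert.prems submoduleE(4)[OF B x] by auto
  have "artinian_between R M ?Z B"
    by (rule insert.IH[OF col B BZ]) (use insert.prems eq in auto)
  then show ?case
    by (intro artinian_between_torsion[OF insert.prems(1) B insert.prems(3) x]) (use insert.prems in auto)
qed

end

text \<open>Chains over \<open>B'\<close> pull back to chains over \<open>B\<close>, and each is recovered from its pullback because
  \<open>h\<close> maps \<open>Z\<close> onto \<open>Z'\<close> modulo \<open>B'\<close>: quotients of artinian modules are artinian.\<close>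

lemma artinian_between_hom:
  fixes R (structure)
  assumes M: "module R M" and M': "module R M'" and h: "h \<in> Hom_module R M M'"
    and Z: "submodule Z R M" and B: "submodule B R M" "B \<subseteq> Z" and B': "submodule B' R M'"
    and hB: "\<And>b. b \<in> B \<Longrightarrow> h b \<in> B'"
    and sur: "\<And>z. z \<in> Z' \<Longrightarrow> \<exists>u\<in>Z. z \<ominus>\<^bsub>M'\<^esub> h u \<in> B'" and Z': "Z' \<subseteq> carrier M'"
    and art: "artinian_between R M Z B"
  shows "artinian_between R M' Z' B'"
proof (rule artinian_betweenI)
  interpret M: module R M by fact
  interpret M': module R M' by fact
  have hc: "h x \<in> carrier M'" if "x \<in> carrier M" for x
    using h that by (auto simp: Hom_module_def)
  have ha: "h (x \<oplus>\<^bsub>M\<^esub> y) = h x \<oplus>\<^bsub>M'\<^esub> h y" if "x \<in> carrier M" "y \<in> carrier M" for x y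
    using h that by (auto simp: Hom_module_def)
  have hs: "h (r \<odot>\<^bsub>M\<^esub> y) = r \<odot>\<^bsub>M'\<^esub> h y" if "r \<in> carrier R" "y \<in> carrier M" for r y
    using h that by (auto simp: Hom_module_def)
  have h0: "h \<zero>\<^bsub>M\<^esub> = \<zero>\<^bsub>M'\<^esub>"
    using hs[of \<zero> "\<zero>\<^bsub>M\<^esub>"] hc[of "\<zero>\<^bsub>M\<^esub>"] by simp
  have hm: "h (\<ominus>\<^bsub>M\<^esub> x) = \<ominus>\<^bsub>M'\<^esub> h x" if "x \<in> carrier M" for x
    using hs[of "\<ominus> \<one>" x] hc[of x] that by (simp add: M.smult_l_minus M'.smult_l_minus)
  fix N :: "nat \<Rightarrow> _ set" assume N: "\<And>k. submodule (N k) R M'" "\<And>k. B' \<subseteq> N k" "\<And>k. N k \<subseteq> Z'"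
    and anti: "\<And>j k. j \<le> k \<Longrightarrow> N k \<subseteq> N j"
  have "\<exists>K. \<forall>k\<ge>K. {u \<in> Z. h u \<in> N k} = {u \<in> Z. h u \<in> N K}"
  proof (rule artinian_betweenD[OF art])
    show "submodule {u \<in> Z. h u \<in> N k} R M" for k
    proof (rule M.submoduleI)
      fix x y assume "x \<in> {u \<in> Z. h u \<in> N k}" "y \<in> {u \<in> Z. h u \<in> N k}"
      then show "x \<oplus>\<^bsub>M\<^esub> y \<in> {u \<in> Z. h u \<in> N k}"
        using M.submoduleE(5)[OF Z] M'.submoduleE(5)[OF N(1)] M.submodule_carrier[OF Z] ha by auto
    qed (use M.submoduleE[OF Z] M'.submoduleE[OF N(1)] M.submodule_carrier[OF Z] h0 hm hs
         M.submodule_zero[OF Z] M'.submodule_zero[OF N(1)] in auto)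
    show "B \<subseteq> {u \<in> Z. h u \<in> N k}" "{u \<in> Z. h u \<in> N k} \<subseteq> Z"
      "{u \<in> Z. h u \<in> N (Suc k)} \<subseteq> {u \<in> Z. h u \<in> N k}" for k
      using B(2) hB N(2)[of k] anti[of k "Suc k"] by auto
  qed
  then obtain K where K: "\<And>k. k \<ge> K \<Longrightarrow> {u \<in> Z. h u \<in> N k} = {u \<in> Z. h u \<in> N K}" by metis
  have "N K \<subseteq> N k" if "k \<ge> K" for k
  proof
    fix x assume x: "x \<in> N K"
    then obtain u where u: "u \<in> Z" "x \<ominus>\<^bsub>M'\<^esub> h u \<in> B'" using sur N(3) by blast
    have c: "x \<in> carrier M'" "h u \<in> carrier M'"
      using x u M'.submodule_carrier[OF N(1)] M.submodule_carrier[OF Z] hc by auto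
    have "h u = x \<ominus>\<^bsub>M'\<^esub> (x \<ominus>\<^bsub>M'\<^esub> h u)"
      using c by (simp add: a_minus_def M'.minus_add M'.r_neg2)
    then have "h u \<in> N K"
      using M'.submodule_minus[OF N(1) x, of "x \<ominus>\<^bsub>M'\<^esub> h u"] u(2) N(2) by auto
    then have "h u \<in> N k" using K[OF that] u(1) by auto
    then show "x \<in> N k" using M'.submodule_diff_cancel[OF N(1) c(1)] u(2) N(2) by auto
  qed
  then show "\<exists>K. \<forall>k\<ge>K. N K \<subseteq> N k" by blast
qed

section \<open>Complexes between the Koszul and the Cech complex\<close>

text \<open>The sum is over ordered pairs of distinct elements, and the two orders of a pair cancel. This is
  the reason for \<open>d \<circ> d = 0\<close> below.\<close>

lemma (in abelian_group) finsum_antisymmetric: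
  assumes "finite A"
    and "\<And>i j. i \<in> A \<Longrightarrow> j \<in> A \<Longrightarrow> i \<noteq> j \<Longrightarrow> g i j \<in> carrier G"
    and "\<And>i j. i \<in> A \<Longrightarrow> j \<in> A \<Longrightarrow> i \<noteq> j \<Longrightarrow> g i j \<oplus> g j i = \<zero>"
  shows "(\<Oplus>i\<in>A. \<Oplus>j\<in>A - {i}. g i j) = \<zero>"
  using assms
proof (induction A rule: finite_induct)
  case empty
  then show ?case by simp
next
  case (insert a A)
  have c: "g i j \<in> carrier G" if "i \<in> insert a A" "j \<in> insert a A" "i \<noteq> j" for i j
    using insert.prems(1) that by blast
  have c1: "g a i \<in> carrier G" "g i a \<in> carrier G" if "i \<in> A" for i
    using c[of a i] c[of i a] that insert.hyps by auto
  have c2: "(\<Oplus>j\<in>A - {i}. g i j) \<in> carrier G" if "i \<in> A" for i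
    using c that by (intro finsum_closed) auto
  have inner: "(\<Oplus>j\<in>insert a A - {i}. g i j) = g i a \<oplus> (\<Oplus>j\<in>A - {i}. g i j)" if "i \<in> A" for i
  proof -
    have "insert a A - {i} = insert a (A - {i})" using insert.hyps that by auto
    moreover have "g i \<in> A - {i} \<rightarrow> carrier G" using c that by auto
    ultimately show ?thesis
      using insert.hyps c1[OF that] by (simp add: finsum_insert)
  qed
  have "insert a A - {a} = A" using insert.hyps by auto
  then have "(\<Oplus>i\<in>insert a A. \<Oplus>j\<in>insert a A - {i}. g i j)
      = (\<Oplus>j\<in>A. g a j) \<oplus> (\<Oplus>i\<in>A. \<Oplus>j\<in>insert a A - {i}. g i j)"
    using insert.hyps c1 c2 inner by (simp add: finsum_insert Pi_def)
  also have "(\<Oplus>i\<in>A. \<Oplus>j\<in>insert a A - {i}. g i j) = (\<Oplus>i\<in>A. g i a \<oplus> (\<Oplus>j\<in>A - {i}. g i j))"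
    using inner c1 c2 by (intro finsum_cong') auto
  also have "\<dots> = (\<Oplus>i\<in>A. g i a) \<oplus> (\<Oplus>i\<in>A. \<Oplus>j\<in>A - {i}. g i j)"
    using c1 c2 by (intro finsum_addf) auto
  also have "(\<Oplus>i\<in>A. \<Oplus>j\<in>A - {i}. g i j) = \<zero>"
    using insert.IH insert.prems by simp
  also have "(\<Oplus>j\<in>A. g a j) \<oplus> ((\<Oplus>i\<in>A. g i a) \<oplus> \<zero>) = (\<Oplus>j\<in>A. g a j) \<oplus> (\<Oplus>i\<in>A. g i a)"
    using c1 by (simp add: finsum_closed Pi_def)
  also have "\<dots> = (\<Oplus>i\<in>A. g a i \<oplus> g i a)"
    using c1 by (intro finsum_addf[symmetric]) auto
  also have "\<dots> = (\<Oplus>i\<in>A. \<zero>)"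
    using insert.prems(2)[of a] insert.hyps by (intro finsum_cong') auto
  finally show ?case by simp
qed

lemma additive_finsum:
  assumes "abelian_group G" "abelian_group H" "finite A"
    and h: "\<And>x. x \<in> carrier G \<Longrightarrow> h x \<in> carrier H"
      "\<And>x y. x \<in> carrier G \<Longrightarrow> y \<in> carrier G \<Longrightarrow> h (x \<oplus>\<^bsub>G\<^esub> y) = h x \<oplus>\<^bsub>H\<^esub> h y"
    and g: "\<And>i. i \<in> A \<Longrightarrow> g i \<in> carrier G"
  shows "h (\<Oplus>\<^bsub>G\<^esub>i\<in>A. g i) = (\<Oplus>\<^bsub>H\<^esub>i\<in>A. h (g i))"
proof -
  interpret G: abelian_group G by fact
  interpret H: abelian_group H by fact
  have h0: "h \<zero>\<^bsub>G\<^esub> = \<zero>\<^bsub>H\<^esub>"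
    using h(2)[of "\<zero>\<^bsub>G\<^esub>" "\<zero>\<^bsub>G\<^esub>"] h(1)[of "\<zero>\<^bsub>G\<^esub>"] by simp
  show ?thesis
    using \<open>finite A\<close> g by (induction A rule: finite_induct) (auto simp: h0 h Pi_def)
qed

definition product_module ::
    "'i set \<Rightarrow> ('i \<Rightarrow> ('a, 'c, 'm) module_scheme) \<Rightarrow> ('a, 'i \<Rightarrow> 'c) module" where
  "product_module I Q =
     \<lparr>carrier = (\<Pi>\<^sub>E i\<in>I. carrier (Q i)),
      mult = undefined, one = undefined,
      zero = (\<lambda>i\<in>I. \<zero>\<^bsub>Q i\<^esub>),
      add = (\<lambda>c c'. \<lambda>i\<in>I. c i \<oplus>\<^bsub>Q i\<^esub> c' i),
      smult = (\<lambda>r c. \<lambda>i\<in>I. r \<odot>\<^bsub>Q i\<^esub> c i)\<rparr>"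

lemma product_module_simps:
  assumes "i \<in> I"
  shows "\<zero>\<^bsub>product_module I Q\<^esub> i = \<zero>\<^bsub>Q i\<^esub>"
    and "(c \<oplus>\<^bsub>product_module I Q\<^esub> c') i = c i \<oplus>\<^bsub>Q i\<^esub> c' i"
    and "(r \<odot>\<^bsub>product_module I Q\<^esub> c) i = r \<odot>\<^bsub>Q i\<^esub> c i"
  using assms by (auto simp: product_module_def)

lemma product_module_closed: "c \<in> carrier (product_module I Q) \<Longrightarrow> i \<in> I \<Longrightarrow> c i \<in> carrier (Q i)"
  by (auto simp: product_module_def)

lemma product_moduleI:
  "(\<And>i. i \<in> I \<Longrightarrow> g i \<in> carrier (Q i)) \<Longrightarrow> (\<lambda>i\<in>I. g i) \<in> carrier (product_module I Q)"
  by (auto simp: product_module_def)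

lemma product_module_eqI:
  assumes "c \<in> carrier (product_module I Q)" "c' \<in> carrier (product_module I Q)"
    and "\<And>i. i \<in> I \<Longrightarrow> c i = c' i"
  shows "c = c'"
proof (rule PiE_ext)
  show "c \<in> (\<Pi>\<^sub>E i\<in>I. carrier (Q i))" "c' \<in> (\<Pi>\<^sub>E i\<in>I. carrier (Q i))"
    using assms by (auto simp: product_module_def)
qed (use assms(3) in blast)

lemma (in cring) product_module_is_module:
  fixes Q :: "'i \<Rightarrow> ('a, 'c, 'm) module_scheme"
  assumes Q: "\<And>i. i \<in> I \<Longrightarrow> module R (Q i)"
  shows "module R (product_module I Q)"
proof (rule moduleI)
  show "cring R" by (rule is_cring)
  note group = module.axioms(2)[OF Q]
  have add: "a \<oplus>\<^bsub>product_module I Q\<^esub> b \<in> carrier (product_module I Q)"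
    if "a \<in> carrier (product_module I Q)" "b \<in> carrier (product_module I Q)" for a b
  proof -
    have "(\<lambda>i\<in>I. a i \<oplus>\<^bsub>Q i\<^esub> b i) \<in> carrier (product_module I Q)"
      by (rule product_moduleI, rule abelian_groupE(1)[OF group])
         (auto intro: product_module_closed[OF that(1)] product_module_closed[OF that(2)])
    then show ?thesis by (simp add: product_module_def)
  qed
  have zero: "\<zero>\<^bsub>product_module I Q\<^esub> \<in> carrier (product_module I Q)"
    using abelian_groupE(2)[OF group] by (auto simp: product_module_def)
  have smult: "r \<odot>\<^bsub>product_module I Q\<^esub> x \<in> carrier (product_module I Q)"
    if "r \<in> carrier R" "x \<in> carrier (product_module I Q)" for r x
  proof -
    have "(\<lambda>i\<in>I. r \<odot>\<^bsub>Q i\<^esub> x i) \<in> carrier (product_module I Q)"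
      by (rule product_moduleI, rule module.smult_closed[OF Q])
         (auto intro: product_module_closed[OF that(2)] that(1))
    then show ?thesis by (simp add: product_module_def)
  qed
  note cl = add zero smult product_module_closed[of _ I Q]
  show "abelian_group (product_module I Q)"
  proof (rule abelian_groupI)
    show "a \<oplus>\<^bsub>product_module I Q\<^esub> b \<in> carrier (product_module I Q)"
      if "a \<in> carrier (product_module I Q)" "b \<in> carrier (product_module I Q)" for a b
      using that by (rule add)
    show "\<zero>\<^bsub>product_module I Q\<^esub> \<in> carrier (product_module I Q)" by (rule zero)
    show "x \<oplus>\<^bsub>product_module I Q\<^esub> y \<oplus>\<^bsub>product_module I Q\<^esub> z = x \<oplus>\<^bsub>product_module I Q\<^esub> (y \<oplus>\<^bsub>product_module I Q\<^esub> z)"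
      if "x \<in> carrier (product_module I Q)" "y \<in> carrier (product_module I Q)"
        "z \<in> carrier (product_module I Q)" for x y z
      by (rule product_module_eqI[where I = I and Q = Q])
         (use that in \<open>simp_all add: product_module_simps cl abelian_groupE(3)[OF group]\<close>)
    show "x \<oplus>\<^bsub>product_module I Q\<^esub> y = y \<oplus>\<^bsub>product_module I Q\<^esub> x"
      if "x \<in> carrier (product_module I Q)" "y \<in> carrier (product_module I Q)" for x y
      by (rule product_module_eqI[where I = I and Q = Q])
         (use that in \<open>simp_all add: product_module_simps cl abelian_groupE(4)[OF group]\<close>)
    show "\<zero>\<^bsub>product_module I Q\<^esub> \<oplus>\<^bsub>product_module I Q\<^esub> x = x" if "x \<in> carrier (product_module I Q)" for x
      by (rule product_module_eqI[where I = I and Q = Q])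
         (use that in \<open>simp_all add: product_module_simps cl abelian_groupE(5)[OF group]\<close>)
    show "\<exists>y\<in>carrier (product_module I Q). y \<oplus>\<^bsub>product_module I Q\<^esub> x = \<zero>\<^bsub>product_module I Q\<^esub>"
      if x: "x \<in> carrier (product_module I Q)" for x
    proof (intro bexI)
      let ?y = "\<lambda>i\<in>I. \<ominus>\<^bsub>Q i\<^esub> x i"
      show y: "?y \<in> carrier (product_module I Q)"
        using abelian_group.a_inv_closed[OF group] product_module_closed[OF x]
        by (intro product_moduleI) auto
      show "?y \<oplus>\<^bsub>product_module I Q\<^esub> x = \<zero>\<^bsub>product_module I Q\<^esub>"
        by (rule product_module_eqI[where I = I and Q = Q])
           (use x y in \<open>simp_all add: product_module_simps cl abelian_group.l_neg[OF group]\<close>)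
    qed
  qed
  show "r \<odot>\<^bsub>product_module I Q\<^esub> x \<in> carrier (product_module I Q)"
    if "r \<in> carrier R" "x \<in> carrier (product_module I Q)" for r x
    using that by (rule smult)
  show "(r \<oplus> s) \<odot>\<^bsub>product_module I Q\<^esub> x = r \<odot>\<^bsub>product_module I Q\<^esub> x \<oplus>\<^bsub>product_module I Q\<^esub> s \<odot>\<^bsub>product_module I Q\<^esub> x"
    if "r \<in> carrier R" "s \<in> carrier R" "x \<in> carrier (product_module I Q)" for r s x
    by (rule product_module_eqI[where I = I and Q = Q])
       (use that in \<open>simp_all add: product_module_simps cl module.smult_l_distr[OF Q]\<close>)
  show "r \<odot>\<^bsub>product_module I Q\<^esub> (x \<oplus>\<^bsub>product_module I Q\<^esub> y) = r \<odot>\<^bsub>product_module I Q\<^esub> x \<oplus>\<^bsub>product_module I Q\<^esub> r \<odot>\<^bsub>product_module I Q\<^esub> y"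
    if "r \<in> carrier R" "x \<in> carrier (product_module I Q)" "y \<in> carrier (product_module I Q)" for r x y
    by (rule product_module_eqI[where I = I and Q = Q])
       (use that in \<open>simp_all add: product_module_simps cl module.smult_r_distr[OF Q]\<close>)
  show "(r \<otimes> s) \<odot>\<^bsub>product_module I Q\<^esub> x = r \<odot>\<^bsub>product_module I Q\<^esub> (s \<odot>\<^bsub>product_module I Q\<^esub> x)"
    if "r \<in> carrier R" "s \<in> carrier R" "x \<in> carrier (product_module I Q)" for r s x
    by (rule product_module_eqI[where I = I and Q = Q])
       (use that in \<open>simp_all add: product_module_simps cl module.smult_assoc1[OF Q]\<close>)
  show "\<one> \<odot>\<^bsub>product_module I Q\<^esub> x = x" if "x \<in> carrier (product_module I Q)" for x
    by (rule product_module_eqI[where I = I and Q = Q])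
       (use that in \<open>simp_all add: product_module_simps cl module.smult_one[OF Q]\<close>)
qed

text \<open>The sign with which the face \<open>T - {j}\<close> enters the differential at \<open>T\<close>.\<close>

definition (in ring) shuffle_sign :: "nat set \<Rightarrow> nat \<Rightarrow> 'a" where
  "shuffle_sign T j = (\<ominus> \<one>) [^] card {k\<in>T. k < j}"

context cring
begin

lemma neg_one_pow: "(\<ominus> \<one>) [^] (m::nat) = (if even m then \<one> else \<ominus> \<one>)"
  by (induction m) (auto simp: l_minus)

lemma shuffle_sign_closed [simp]: "shuffle_sign T j \<in> carrier R"
  by (simp add: shuffle_sign_def)

lemma shuffle_sign_square: "shuffle_sign T j \<otimes> shuffle_sign T j = \<one>"
  by (simp add: shuffle_sign_def neg_one_pow l_minus r_minus)

lemma shuffle_sign_swap: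
  assumes "finite T" "i \<in> T" "j \<in> T" "i \<noteq> j"
  shows "shuffle_sign T i \<otimes> shuffle_sign (T - {i}) j = \<ominus> (shuffle_sign T j \<otimes> shuffle_sign (T - {j}) i)"
proof -
  have *: "shuffle_sign T i \<otimes> shuffle_sign (T - {i}) j = \<ominus> (shuffle_sign T j \<otimes> shuffle_sign (T - {j}) i)"
    if ij: "i < j" "i \<in> T" "j \<in> T" for i j
  proof -
    have "{k\<in>T. k < j} = insert i {k\<in>T - {i}. k < j}" using ij by auto
    then have "card {k\<in>T. k < j} = Suc (card {k\<in>T - {i}. k < j})"
      using \<open>finite T\<close> by simp
    moreover have "{k\<in>T - {j}. k < i} = {k\<in>T. k < i}" using ij by auto
    ultimately show ?thesis
      by (simp add: shuffle_sign_def neg_one_pow l_minus r_minus)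
  qed
  show ?thesis
  proof (cases "i < j")
    case True
    then show ?thesis using * assms by blast
  next
    case False
    then show ?thesis using *[of j i] assms by simp
  qed
qed

end

text \<open>The properties of the modules \<open>Q S = M\<^sub>f\<^sub>S\<close>, the localizations of one module at the products \<open>f\<^sub>S\<close> of the
  \<open>f\<^sub>v\<close>, \<open>v \<in> S\<close>, that the comparison of Koszul and Cech cohomology rests on. The canonical map
  to \<open>Q T\<close> is called \<open>res T\<close> whatever its source is, since fractions keep their representatives.\<close>

locale localization_cube = cring R for R :: "('a, 'b) ring_scheme" (structure) +
  fixes n :: nat and f :: "nat \<Rightarrow> 'a"
    and Q :: "nat set \<Rightarrow> ('a, 'c, 'm) module_scheme" and res :: "nat set \<Rightarrow> 'c \<Rightarrow> 'c"
  assumes f_closed: "v < n \<Longrightarrow> f v \<in> carrier R"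
    and Q_module: "S \<subseteq> {..<n} \<Longrightarrow> module R (Q S)"
    and res_hom: "S \<subseteq> T \<Longrightarrow> T \<subseteq> {..<n} \<Longrightarrow> res T \<in> Hom_module R (Q S) (Q T)"
    and res_id: "S \<subseteq> {..<n} \<Longrightarrow> x \<in> carrier (Q S) \<Longrightarrow> res S x = x"
    and res_res: "S \<subseteq> T \<Longrightarrow> T \<subseteq> U \<Longrightarrow> U \<subseteq> {..<n} \<Longrightarrow> x \<in> carrier (Q S) \<Longrightarrow>
                    res U (res T x) = res U x"
    and res_ker: "v < n \<Longrightarrow> S \<subseteq> {..<n} \<Longrightarrow> x \<in> carrier (Q S) \<Longrightarrow>
                    res (insert v S) x = \<zero>\<^bsub>Q (insert v S)\<^esub> \<Longrightarrow> \<exists>k::nat. (f v [^] k) \<odot>\<^bsub>Q S\<^esub> x = \<zero>\<^bsub>Q S\<^esub>"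
    and res_coker: "v < n \<Longrightarrow> S \<subseteq> {..<n} \<Longrightarrow> y \<in> carrier (Q (insert v S)) \<Longrightarrow>
                    \<exists>k::nat. \<exists>x\<in>carrier (Q S). res (insert v S) x = (f v [^] k) \<odot>\<^bsub>Q (insert v S)\<^esub> y"
    and f_bij: "S \<subseteq> {..<n} \<Longrightarrow> v \<in> S \<Longrightarrow>
                    bij_betw (\<lambda>x. f v \<odot>\<^bsub>Q S\<^esub> x) (carrier (Q S)) (carrier (Q S))"
begin

lemma res_closed: "S \<subseteq> T \<Longrightarrow> T \<subseteq> {..<n} \<Longrightarrow> x \<in> carrier (Q S) \<Longrightarrow> res T x \<in> carrier (Q T)"
  using res_hom[of S T] by (auto simp: Hom_module_def)

lemma res_add: "S \<subseteq> T \<Longrightarrow> T \<subseteq> {..<n} \<Longrightarrow> x \<in> carrier (Q S) \<Longrightarrow> y \<in> carrier (Q S) \<Longrightarrow>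
    res T (x \<oplus>\<^bsub>Q S\<^esub> y) = res T x \<oplus>\<^bsub>Q T\<^esub> res T y"
  using res_hom by (auto simp: Hom_module_def)

lemma res_smult: "S \<subseteq> T \<Longrightarrow> T \<subseteq> {..<n} \<Longrightarrow> r \<in> carrier R \<Longrightarrow> x \<in> carrier (Q S) \<Longrightarrow>
    res T (r \<odot>\<^bsub>Q S\<^esub> x) = r \<odot>\<^bsub>Q T\<^esub> res T x"
  using res_hom by (auto simp: Hom_module_def)

lemma res_zero: "S \<subseteq> T \<Longrightarrow> T \<subseteq> {..<n} \<Longrightarrow> res T \<zero>\<^bsub>Q S\<^esub> = \<zero>\<^bsub>Q T\<^esub>"
proof -
  assume ST: "S \<subseteq> T" "T \<subseteq> {..<n}"
  interpret S: module R "Q S" using ST by (intro Q_module) auto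
  interpret T: module R "Q T" using ST by (intro Q_module) auto
  show ?thesis
    using res_smult[OF ST zero_closed S.M.zero_closed] res_closed[OF ST S.M.zero_closed] by simp
qed

lemma res_finsum:
  assumes ST: "S \<subseteq> T" "T \<subseteq> {..<n}" and "finite A" "\<And>i. i \<in> A \<Longrightarrow> g i \<in> carrier (Q S)"
  shows "res T (\<Oplus>\<^bsub>Q S\<^esub>i\<in>A. g i) = (\<Oplus>\<^bsub>Q T\<^esub>i\<in>A. res T (g i))"
proof -
  interpret S: module R "Q S" using ST by (intro Q_module) auto
  interpret T: module R "Q T" using ST by (intro Q_module) auto
  show ?thesis
    by (rule additive_finsum[OF S.M.abelian_group_axioms T.M.abelian_group_axioms])
       (use assms res_closed res_add in auto)
qed

text \<open>All degrees are treated together: a cochain has a component for every \<open>T \<subseteq> {..<n}\<close>. For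
  \<open>V = {}\<close> this is the Koszul complex of the \<open>f\<^sub>v\<close> with coefficients in \<open>Q {}\<close>, for \<open>V = {..<n}\<close> it is the Cech
  complex; in between, the directions in \<open>V\<close> are of Cech type and the others of Koszul type.\<close>

definition cochains :: "nat set \<Rightarrow> ('a, nat set \<Rightarrow> 'c) module" where
  "cochains V = product_module (Pow {..<n}) (\<lambda>T. Q (T \<inter> V))"

text \<open>In a Cech direction the differential is the canonical map into the localization, in a Koszul
  direction it is multiplication by \<open>f\<^sub>j\<close>.\<close>

definition cube_coeff :: "nat set \<Rightarrow> nat set \<Rightarrow> nat \<Rightarrow> 'a" where
  "cube_coeff V T j = shuffle_sign T j \<otimes> (if j \<in> V then \<one> else f j)"

definition cube_diff :: "nat set \<Rightarrow> (nat set \<Rightarrow> 'c) \<Rightarrow> nat set \<Rightarrow> 'c" where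
  "cube_diff V c =
     (\<lambda>T\<in>Pow {..<n}. \<Oplus>\<^bsub>Q (T \<inter> V)\<^esub>j\<in>T. cube_coeff V T j \<odot>\<^bsub>Q (T \<inter> V)\<^esub> res (T \<inter> V) (c (T - {j})))"

definition cube_cocycles :: "nat set \<Rightarrow> (nat set \<Rightarrow> 'c) set" where
  "cube_cocycles V = {c \<in> carrier (cochains V). cube_diff V c = \<zero>\<^bsub>cochains V\<^esub>}"

definition cube_coboundaries :: "nat set \<Rightarrow> (nat set \<Rightarrow> 'c) set" where
  "cube_coboundaries V = cube_diff V ` carrier (cochains V)"

lemma Q_face: "T \<subseteq> {..<n} \<Longrightarrow> module R (Q (T \<inter> V))"
  by (intro Q_module) auto

lemma cochain_closed: "c \<in> carrier (cochains V) \<Longrightarrow> T \<subseteq> {..<n} \<Longrightarrow> c T \<in> carrier (Q (T \<inter> V))"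
  unfolding cochains_def by (erule product_module_closed) simp

lemma cochainI:
  "(\<And>T. T \<subseteq> {..<n} \<Longrightarrow> g T \<in> carrier (Q (T \<inter> V))) \<Longrightarrow> (\<lambda>T\<in>Pow {..<n}. g T) \<in> carrier (cochains V)"
  unfolding cochains_def by (rule product_moduleI) simp

lemma cochain_eqI:
  assumes "c \<in> carrier (cochains V)" "c' \<in> carrier (cochains V)"
    and "\<And>T. T \<subseteq> {..<n} \<Longrightarrow> c T = c' T"
  shows "c = c'"
  using assms(1,2) unfolding cochains_def by (rule product_module_eqI) (use assms(3) in simp)

lemma cochain_simps:
  assumes "T \<subseteq> {..<n}"
  shows "\<zero>\<^bsub>cochains V\<^esub> T = \<zero>\<^bsub>Q (T \<inter> V)\<^esub>"
    and "(c \<oplus>\<^bsub>cochains V\<^esub> c') T = c T \<oplus>\<^bsub>Q (T \<inter> V)\<^esub> c' T"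
    and "(r \<odot>\<^bsub>cochains V\<^esub> c) T = r \<odot>\<^bsub>Q (T \<inter> V)\<^esub> c T"
  using assms by (auto simp: cochains_def product_module_simps)

lemma cochains_module: "module R (cochains V)"
  unfolding cochains_def by (rule product_module_is_module) (auto intro: Q_face)

lemma cochain_minus:
  assumes "c \<in> carrier (cochains V)" "c' \<in> carrier (cochains V)" "T \<subseteq> {..<n}"
  shows "(c \<ominus>\<^bsub>cochains V\<^esub> c') T = c T \<ominus>\<^bsub>Q (T \<inter> V)\<^esub> c' T"
proof -
  interpret C: module R "cochains V" by (rule cochains_module)
  interpret Q: module R "Q (T \<inter> V)" by (rule Q_face[OF assms(3)])
  have "(c \<ominus>\<^bsub>cochains V\<^esub> c') T \<oplus>\<^bsub>Q (T \<inter> V)\<^esub> c' T = ((c \<ominus>\<^bsub>cochains V\<^esub> c') \<oplus>\<^bsub>cochains V\<^esub> c') T"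
    using assms by (simp add: cochain_simps)
  also have "\<dots> = c T"
    using assms by (simp add: a_minus_def C.M.a_assoc C.M.l_neg)
  finally have "(c \<ominus>\<^bsub>cochains V\<^esub> c') T \<oplus>\<^bsub>Q (T \<inter> V)\<^esub> c' T = c T" .
  moreover have "(c \<ominus>\<^bsub>cochains V\<^esub> c') T \<in> carrier (Q (T \<inter> V))" "c' T \<in> carrier (Q (T \<inter> V))"
    using assms by (auto intro: cochain_closed)
  ultimately show ?thesis
    by (metis Q.M.add.inv_solve_right Q.M.a_closed a_minus_def)
qed

lemma cube_coeff_closed [simp]: "j < n \<Longrightarrow> cube_coeff V T j \<in> carrier R"
  by (simp add: cube_coeff_def f_closed)

lemma cube_coeff_swap:
  assumes "T \<subseteq> {..<n}" "i \<in> T" "j \<in> T" "i \<noteq> j"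
  shows "cube_coeff V T i \<otimes> cube_coeff V (T - {i}) j = \<ominus> (cube_coeff V T j \<otimes> cube_coeff V (T - {j}) i)"
proof -
  have fin: "finite T" using assms(1) finite_subset by blast
  define a b where "a = (if i \<in> V then \<one> else f i)" and "b = (if j \<in> V then \<one> else f j)"
  have ab: "a \<in> carrier R" "b \<in> carrier R"
    using assms f_closed by (auto simp: a_def b_def)
  have "cube_coeff V T i \<otimes> cube_coeff V (T - {i}) j
      = (shuffle_sign T i \<otimes> shuffle_sign (T - {i}) j) \<otimes> (a \<otimes> b)"
    using ab unfolding cube_coeff_def a_def[symmetric] b_def[symmetric] by (simp add: m_ac)
  also have "\<dots> = \<ominus> ((shuffle_sign T j \<otimes> shuffle_sign (T - {j}) i) \<otimes> (a \<otimes> b))"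
    using ab shuffle_sign_swap[OF fin assms(2-4)] by (simp add: l_minus)
  also have "\<dots> = \<ominus> (cube_coeff V T j \<otimes> cube_coeff V (T - {j}) i)"
    using ab unfolding cube_coeff_def a_def[symmetric] b_def[symmetric] by (simp add: m_ac)
  finally show ?thesis .
qed

lemma face_mono: "(T - {j}) \<inter> V \<subseteq> T \<inter> V"
  by auto

lemma res_face_closed:
  assumes "c \<in> carrier (cochains V)" "T \<subseteq> {..<n}"
  shows "res (T \<inter> V) (c (T - {j})) \<in> carrier (Q (T \<inter> V))"
  by (rule res_closed[OF face_mono]) (use assms in \<open>auto intro: cochain_closed\<close>)

lemma face_term_closed:
  assumes "c \<in> carrier (cochains V)" "T \<subseteq> {..<n}" "j \<in> T"
  shows "cube_coeff V T j \<odot>\<^bsub>Q (T \<inter> V)\<^esub> res (T \<inter> V) (c (T - {j})) \<in> carrier (Q (T \<inter> V))"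
  using assms by (intro module.smult_closed[OF Q_face] res_face_closed cube_coeff_closed) auto

lemma cube_diff_apply:
  "T \<subseteq> {..<n} \<Longrightarrow>
     cube_diff V c T = (\<Oplus>\<^bsub>Q (T \<inter> V)\<^esub>j\<in>T. cube_coeff V T j \<odot>\<^bsub>Q (T \<inter> V)\<^esub> res (T \<inter> V) (c (T - {j})))"
  by (simp add: cube_diff_def)

lemma cube_diff_closed:
  assumes "c \<in> carrier (cochains V)"
  shows "cube_diff V c \<in> carrier (cochains V)"
  unfolding cube_diff_def
proof (rule cochainI)
  fix T assume T: "T \<subseteq> {..<n}"
  interpret Q: module R "Q (T \<inter> V)" by (rule Q_face[OF T])
  show "(\<Oplus>\<^bsub>Q (T \<inter> V)\<^esub>j\<in>T. cube_coeff V T j \<odot>\<^bsub>Q (T \<inter> V)\<^esub> res (T \<inter> V) (c (T - {j}))) \<in> carrier (Q (T \<inter> V))"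
    using face_term_closed[OF assms T] by (intro Q.M.finsum_closed) auto
qed

lemma cube_diff_add:
  assumes "c \<in> carrier (cochains V)" "c' \<in> carrier (cochains V)"
  shows "cube_diff V (c \<oplus>\<^bsub>cochains V\<^esub> c') = cube_diff V c \<oplus>\<^bsub>cochains V\<^esub> cube_diff V c'"
proof (rule cochain_eqI[where V = V])
  interpret C: module R "cochains V" by (rule cochains_module)
  show "cube_diff V (c \<oplus>\<^bsub>cochains V\<^esub> c') \<in> carrier (cochains V)"
    "cube_diff V c \<oplus>\<^bsub>cochains V\<^esub> cube_diff V c' \<in> carrier (cochains V)"
    using assms by (auto intro: cube_diff_closed)
  fix T assume T: "T \<subseteq> {..<n}"
  interpret Q: module R "Q (T \<inter> V)" by (rule Q_face[OF T])
  have "cube_diff V (c \<oplus>\<^bsub>cochains V\<^esub> c') T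
      = (\<Oplus>\<^bsub>Q (T \<inter> V)\<^esub>j\<in>T. cube_coeff V T j \<odot>\<^bsub>Q (T \<inter> V)\<^esub> res (T \<inter> V) (c (T - {j}))
           \<oplus>\<^bsub>Q (T \<inter> V)\<^esub> cube_coeff V T j \<odot>\<^bsub>Q (T \<inter> V)\<^esub> res (T \<inter> V) (c' (T - {j})))"
    unfolding cube_diff_apply[OF T]
  proof (rule Q.M.finsum_cong'[OF refl])
    fix j assume j: "j \<in> T"
    have T': "T - {j} \<subseteq> {..<n}" "T \<inter> V \<subseteq> {..<n}" using T by auto
    show "cube_coeff V T j \<odot>\<^bsub>Q (T \<inter> V)\<^esub> res (T \<inter> V) ((c \<oplus>\<^bsub>cochains V\<^esub> c') (T - {j})) =
      cube_coeff V T j \<odot>\<^bsub>Q (T \<inter> V)\<^esub> res (T \<inter> V) (c (T - {j}))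
           \<oplus>\<^bsub>Q (T \<inter> V)\<^esub> cube_coeff V T j \<odot>\<^bsub>Q (T \<inter> V)\<^esub> res (T \<inter> V) (c' (T - {j}))"
      unfolding cochain_simps[OF T'(1)]
        res_add[OF face_mono T'(2) cochain_closed[OF assms(1) T'(1)] cochain_closed[OF assms(2) T'(1)]]
      by (rule Q.smult_r_distr) (use res_face_closed[OF assms(1) T] res_face_closed[OF assms(2) T] j T in auto)
  qed (use face_term_closed[OF assms(1) T] face_term_closed[OF assms(2) T] in auto)
  also have "\<dots> = cube_diff V c T \<oplus>\<^bsub>Q (T \<inter> V)\<^esub> cube_diff V c' T"
    unfolding cube_diff_apply[OF T]
    using face_term_closed[OF assms(1) T] face_term_closed[OF assms(2) T]
    by (intro Q.M.finsum_addf) auto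
  finally show "cube_diff V (c \<oplus>\<^bsub>cochains V\<^esub> c') T = (cube_diff V c \<oplus>\<^bsub>cochains V\<^esub> cube_diff V c') T"
    by (simp add: cochain_simps[OF T])
qed

lemma cube_diff_smult:
  assumes r: "r \<in> carrier R" and c: "c \<in> carrier (cochains V)"
  shows "cube_diff V (r \<odot>\<^bsub>cochains V\<^esub> c) = r \<odot>\<^bsub>cochains V\<^esub> cube_diff V c"
proof (rule cochain_eqI[where V = V])
  interpret C: module R "cochains V" by (rule cochains_module)
  show "cube_diff V (r \<odot>\<^bsub>cochains V\<^esub> c) \<in> carrier (cochains V)"
    "r \<odot>\<^bsub>cochains V\<^esub> cube_diff V c \<in> carrier (cochains V)"
    using assms by (auto intro: cube_diff_closed)
  fix T assume T: "T \<subseteq> {..<n}"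
  interpret Q: module R "Q (T \<inter> V)" by (rule Q_face[OF T])
  have fin: "finite T" using T finite_subset by blast
  have "cube_diff V (r \<odot>\<^bsub>cochains V\<^esub> c) T
      = (\<Oplus>\<^bsub>Q (T \<inter> V)\<^esub>j\<in>T. r \<odot>\<^bsub>Q (T \<inter> V)\<^esub> (cube_coeff V T j \<odot>\<^bsub>Q (T \<inter> V)\<^esub> res (T \<inter> V) (c (T - {j}))))"
    unfolding cube_diff_apply[OF T]
  proof (rule Q.M.finsum_cong'[OF refl])
    fix j assume j: "j \<in> T"
    have T': "T - {j} \<subseteq> {..<n}" "T \<inter> V \<subseteq> {..<n}" using T by auto
    have "cube_coeff V T j \<in> carrier R" using j T by auto
    then show "cube_coeff V T j \<odot>\<^bsub>Q (T \<inter> V)\<^esub> res (T \<inter> V) ((r \<odot>\<^bsub>cochains V\<^esub> c) (T - {j})) =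
      r \<odot>\<^bsub>Q (T \<inter> V)\<^esub> (cube_coeff V T j \<odot>\<^bsub>Q (T \<inter> V)\<^esub> res (T \<inter> V) (c (T - {j})))"
      using res_smult[OF face_mono T'(2) r cochain_closed[OF c T'(1)]] res_face_closed[OF c T] r
      by (simp add: cochain_simps[OF T'(1)] Q.smult_assoc1[symmetric] m_comm)
  qed (use face_term_closed[OF c T] r in auto)
  also have "\<dots> = r \<odot>\<^bsub>Q (T \<inter> V)\<^esub> cube_diff V c T"
    unfolding cube_diff_apply[OF T]
    using face_term_closed[OF c T] by (intro Q.finsum_smult_ldistr[symmetric] fin r) auto
  finally show "cube_diff V (r \<odot>\<^bsub>cochains V\<^esub> c) T = (r \<odot>\<^bsub>cochains V\<^esub> cube_diff V c) T"
    by (simp add: cochain_simps[OF T])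
qed

lemma cube_diff_diff:
  assumes c: "c \<in> carrier (cochains V)"
  shows "cube_diff V (cube_diff V c) = \<zero>\<^bsub>cochains V\<^esub>"
proof (rule cochain_eqI[where V = V])
  interpret C: module R "cochains V" by (rule cochains_module)
  show "cube_diff V (cube_diff V c) \<in> carrier (cochains V)" "\<zero>\<^bsub>cochains V\<^esub> \<in> carrier (cochains V)"
    using assms by (auto intro: cube_diff_closed)
  fix T assume T: "T \<subseteq> {..<n}"
  interpret Q: module R "Q (T \<inter> V)" by (rule Q_face[OF T])
  have fin: "finite T" using T finite_subset by blast
  define g where "g i j = (cube_coeff V T i \<otimes> cube_coeff V (T - {i}) j) \<odot>\<^bsub>Q (T \<inter> V)\<^esub>
      res (T \<inter> V) (c (T - {i} - {j}))" for i j
  have TV: "T \<inter> V \<subseteq> {..<n}" using T by auto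
  have cc: "c (T - {i} - {j}) \<in> carrier (Q ((T - {i} - {j}) \<inter> V))" for i j
    using T by (intro cochain_closed[OF c]) auto
  have rc: "res (T \<inter> V) (c (T - {i} - {j})) \<in> carrier (Q (T \<inter> V))" for i j
    by (rule res_closed[OF _ TV cc]) auto
  have coeff: "cube_coeff V S i \<in> carrier R" if "i \<in> T" for i S
    using that T by auto
  have gc: "g i j \<in> carrier (Q (T \<inter> V))" if "i \<in> T" "j \<in> T" for i j
    unfolding g_def using that rc coeff by simp
  have "cube_diff V (cube_diff V c) T = (\<Oplus>\<^bsub>Q (T \<inter> V)\<^esub>i\<in>T. \<Oplus>\<^bsub>Q (T \<inter> V)\<^esub>j\<in>T - {i}. g i j)"
    unfolding cube_diff_apply[OF T]
  proof (rule Q.M.finsum_cong'[OF refl])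
    show "(\<lambda>i. \<Oplus>\<^bsub>Q (T \<inter> V)\<^esub>j\<in>T - {i}. g i j) \<in> T \<rightarrow> carrier (Q (T \<inter> V))"
      using gc by (auto intro!: Q.M.finsum_closed)
    fix i assume i: "i \<in> T"
    have Ti: "T - {i} \<subseteq> {..<n}" using T by auto
    have *: "res (T \<inter> V) (cube_diff V c (T - {i}))
        = (\<Oplus>\<^bsub>Q (T \<inter> V)\<^esub>j\<in>T - {i}. res (T \<inter> V) (cube_coeff V (T - {i}) j \<odot>\<^bsub>Q ((T - {i}) \<inter> V)\<^esub>
              res ((T - {i}) \<inter> V) (c (T - {i} - {j}))))"
      unfolding cube_diff_apply[OF Ti]
      by (rule res_finsum[OF face_mono TV]) (use fin face_term_closed[OF c Ti] in auto)
    have "cube_coeff V T i \<odot>\<^bsub>Q (T \<inter> V)\<^esub> res (T \<inter> V) (cube_diff V c (T - {i})) =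
        (\<Oplus>\<^bsub>Q (T \<inter> V)\<^esub>j\<in>T - {i}. cube_coeff V T i \<odot>\<^bsub>Q (T \<inter> V)\<^esub> res (T \<inter> V)
            (cube_coeff V (T - {i}) j \<odot>\<^bsub>Q ((T - {i}) \<inter> V)\<^esub> res ((T - {i}) \<inter> V) (c (T - {i} - {j}))))"
      unfolding *
      by (rule Q.finsum_smult_ldistr)
         (use fin coeff[OF i] res_closed[OF face_mono TV face_term_closed[OF c Ti]] in auto)
    also have "\<dots> = (\<Oplus>\<^bsub>Q (T \<inter> V)\<^esub>j\<in>T - {i}. g i j)"
    proof (rule Q.M.finsum_cong'[OF refl])
      fix j assume j: "j \<in> T - {i}"
      have "res (T \<inter> V) (cube_coeff V (T - {i}) j \<odot>\<^bsub>Q ((T - {i}) \<inter> V)\<^esub> res ((T - {i}) \<inter> V) (c (T - {i} - {j})))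
         = cube_coeff V (T - {i}) j \<odot>\<^bsub>Q (T \<inter> V)\<^esub> res (T \<inter> V) (c (T - {i} - {j}))"
        using res_smult[OF face_mono TV coeff res_face_closed[OF c Ti]] j
          res_res[OF face_mono face_mono TV cc] by auto
      then show "cube_coeff V T i \<odot>\<^bsub>Q (T \<inter> V)\<^esub> res (T \<inter> V)
            (cube_coeff V (T - {i}) j \<odot>\<^bsub>Q ((T - {i}) \<inter> V)\<^esub> res ((T - {i}) \<inter> V) (c (T - {i} - {j}))) = g i j"
        unfolding g_def using coeff i j rc by (simp add: Q.smult_assoc1)
    qed (use gc i in auto)
    finally show "cube_coeff V T i \<odot>\<^bsub>Q (T \<inter> V)\<^esub> res (T \<inter> V) (cube_diff V c (T - {i})) =
        (\<Oplus>\<^bsub>Q (T \<inter> V)\<^esub>j\<in>T - {i}. g i j)" .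
  qed
  also have "\<dots> = \<zero>\<^bsub>Q (T \<inter> V)\<^esub>"
  proof (rule Q.M.finsum_antisymmetric[OF fin])
    fix i j assume ij: "i \<in> T" "j \<in> T" "i \<noteq> j"
    have "g i j = \<ominus>\<^bsub>Q (T \<inter> V)\<^esub> g j i"
      using cube_coeff_swap[OF T ij] rc[of j i] coeff ij
      by (simp add: g_def Q.smult_l_minus Diff_insert2[symmetric] insert_commute)
    then show "g i j \<oplus>\<^bsub>Q (T \<inter> V)\<^esub> g j i = \<zero>\<^bsub>Q (T \<inter> V)\<^esub>"
      using gc[OF ij(2,1)] by (simp add: Q.M.l_neg)
  qed (use gc in auto)
  finally show "cube_diff V (cube_diff V c) T = \<zero>\<^bsub>cochains V\<^esub> T"
    by (simp add: cochain_simps[OF T])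
qed

lemma cube_cocycles_submodule: "submodule (cube_cocycles V) R (cochains V)"
proof -
  interpret C: module R "cochains V" by (rule cochains_module)
  show ?thesis
  proof (rule C.submoduleI)
    show "\<zero>\<^bsub>cochains V\<^esub> \<in> cube_cocycles V"
      using cube_diff_smult[OF zero_closed C.M.zero_closed] cube_diff_closed[OF C.M.zero_closed]
      by (simp add: cube_cocycles_def)
    show "\<ominus>\<^bsub>cochains V\<^esub> c \<in> cube_cocycles V" if "c \<in> cube_cocycles V" for c
      using that cube_diff_smult[of "\<ominus> \<one>" c V]
      by (simp add: cube_cocycles_def C.smult_l_minus)
  qed (auto simp: cube_cocycles_def cube_diff_add cube_diff_smult)
qed

lemma cube_coboundaries_submodule: "submodule (cube_coboundaries V) R (cochains V)"
proof -
  interpret C: module R "cochains V" by (rule cochains_module)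
  show ?thesis
  proof (rule C.submoduleI)
    show "\<zero>\<^bsub>cochains V\<^esub> \<in> cube_coboundaries V"
      using cube_diff_smult[OF zero_closed C.M.zero_closed] cube_diff_closed[OF C.M.zero_closed]
      by (auto simp: cube_coboundaries_def image_iff intro!: bexI[of _ "\<zero>\<^bsub>cochains V\<^esub>"])
    fix c assume "c \<in> cube_coboundaries V"
    then obtain w where w: "w \<in> carrier (cochains V)" "c = cube_diff V w"
      by (auto simp: cube_coboundaries_def)
    show smult: "r \<odot>\<^bsub>cochains V\<^esub> c \<in> cube_coboundaries V" if "r \<in> carrier R" for r
      unfolding cube_coboundaries_def using w that cube_diff_smult[OF that w(1)]
      by (intro image_eqI[of _ _ "r \<odot>\<^bsub>cochains V\<^esub> w"]) auto
    show "\<ominus>\<^bsub>cochains V\<^esub> c \<in> cube_coboundaries V"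
      using smult[of "\<ominus> \<one>"] w by (simp add: C.smult_l_minus cube_diff_closed)
    fix c' assume "c' \<in> cube_coboundaries V"
    then obtain w' where w': "w' \<in> carrier (cochains V)" "c' = cube_diff V w'"
      by (auto simp: cube_coboundaries_def)
    show "c \<oplus>\<^bsub>cochains V\<^esub> c' \<in> cube_coboundaries V"
      unfolding cube_coboundaries_def using w w' cube_diff_add[of w V w']
      by (auto simp: image_iff intro!: bexI[of _ "w \<oplus>\<^bsub>cochains V\<^esub> w'"])
  qed (auto simp: cube_coboundaries_def intro: cube_diff_closed)
qed

lemma cube_coboundaries_subset: "cube_coboundaries V \<subseteq> cube_cocycles V"
  by (auto simp: cube_coboundaries_def cube_cocycles_def cube_diff_diff cube_diff_closed)

end

section \<open>Artinian cohomology\<close>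

lemma (in abelian_group) eq_if_minus_zero:
  assumes "x \<in> carrier G" "y \<in> carrier G" "x \<ominus> y = \<zero>"
  shows "x = y"
proof -
  have "x = (x \<ominus> y) \<oplus> y"
    using assms(1,2) by (simp add: a_minus_def a_assoc l_neg)
  then show ?thesis using assms by simp
qed

lemma uniform_threshold:
  assumes "finite A" "\<And>T. T \<in> A \<Longrightarrow> \<exists>k0. \<forall>k\<ge>k0. P T k"
  shows "\<exists>k::nat. \<forall>T\<in>A. P T k"
proof -
  obtain K where K: "\<And>T k. T \<in> A \<Longrightarrow> k \<ge> K T \<Longrightarrow> P T k"
    using assms(2) by metis
  have "P T (Max (insert 0 (K ` A)))" if "T \<in> A" for T
    using assms(1) that by (intro K) (auto intro: Max_ge)
  then show ?thesis by blast
qed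

context localization_cube
begin

text \<open>In either kind of direction \<open>v\<close>, the map from the component at \<open>T\<close> to the one at \<open>T \<union> {v}\<close> has a
  cokernel and a kernel (next lemma) that are killed elementwise by powers of \<open>f\<^sub>v\<close>. All large exponents are
  admitted, so that one exponent serves all faces.\<close>

lemma face_coker:
  assumes v: "v < n" "v \<notin> T" and T: "T \<subseteq> {..<n}" and y: "y \<in> carrier (Q (insert v T \<inter> V))"
  shows "\<exists>k0. \<forall>k\<ge>k0. \<exists>x\<in>carrier (Q (T \<inter> V)).
           (if v \<in> V then \<one> else f v) \<odot>\<^bsub>Q (insert v T \<inter> V)\<^esub> res (insert v T \<inter> V) x
             = (f v [^] (k::nat)) \<odot>\<^bsub>Q (insert v T \<inter> V)\<^esub> y"
proof -
  have TV: "T \<inter> V \<subseteq> {..<n}" and vT: "insert v T \<inter> V \<subseteq> {..<n}" using T v by auto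
  have sub: "T \<inter> V \<subseteq> insert v T \<inter> V" by auto
  interpret P: module R "Q (T \<inter> V)" by (rule Q_module[OF TV])
  interpret Q: module R "Q (insert v T \<inter> V)" by (rule Q_module[OF vT])
  note fv = f_closed[OF v(1)]
  show ?thesis
  proof (cases "v \<in> V")
    case True
    then have eq: "insert v T \<inter> V = insert v (T \<inter> V)" by auto
    obtain k0 :: nat and x where x: "x \<in> carrier (Q (T \<inter> V))"
      "res (insert v T \<inter> V) x = (f v [^] k0) \<odot>\<^bsub>Q (insert v T \<inter> V)\<^esub> y"
      using res_coker[OF v(1) TV, of y] y eq by auto
    have "\<exists>x\<in>carrier (Q (T \<inter> V)). \<one> \<odot>\<^bsub>Q (insert v T \<inter> V)\<^esub> res (insert v T \<inter> V) x
             = (f v [^] k) \<odot>\<^bsub>Q (insert v T \<inter> V)\<^esub> y" if "k \<ge> k0" for k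
    proof (rule bexI)
      have "res (insert v T \<inter> V) ((f v [^] (k - k0)) \<odot>\<^bsub>Q (T \<inter> V)\<^esub> x)
          = (f v [^] (k - k0)) \<odot>\<^bsub>Q (insert v T \<inter> V)\<^esub> ((f v [^] k0) \<odot>\<^bsub>Q (insert v T \<inter> V)\<^esub> y)"
        using res_smult[OF sub vT _ x(1), of "f v [^] (k - k0)"] fv x(2) by simp
      also have "\<dots> = (f v [^] k) \<odot>\<^bsub>Q (insert v T \<inter> V)\<^esub> y"
        using y fv that by (simp add: Q.smult_assoc1[symmetric] nat_pow_mult)
      finally show "\<one> \<odot>\<^bsub>Q (insert v T \<inter> V)\<^esub> res (insert v T \<inter> V) ((f v [^] (k - k0)) \<odot>\<^bsub>Q (T \<inter> V)\<^esub> x)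
          = (f v [^] k) \<odot>\<^bsub>Q (insert v T \<inter> V)\<^esub> y"
        using y fv by simp
    qed (use x fv in simp)
    then show ?thesis using True by auto
  next
    case False
    then have eq: "insert v T \<inter> V = T \<inter> V" by auto
    have "\<exists>x\<in>carrier (Q (T \<inter> V)). f v \<odot>\<^bsub>Q (insert v T \<inter> V)\<^esub> res (insert v T \<inter> V) x
             = (f v [^] k) \<odot>\<^bsub>Q (insert v T \<inter> V)\<^esub> y" if k: "k \<ge> 1" for k :: nat
    proof (rule bexI)
      have yc: "(f v [^] (k - 1)) \<odot>\<^bsub>Q (T \<inter> V)\<^esub> y \<in> carrier (Q (T \<inter> V))"
        using y fv eq by simp
      have "f v \<otimes> f v [^] (k - 1) = f v [^] k"
        using k fv nat_pow_mult[of "f v" 1 "k - 1"] by simp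
      then show "f v \<odot>\<^bsub>Q (insert v T \<inter> V)\<^esub> res (insert v T \<inter> V) ((f v [^] (k - 1)) \<odot>\<^bsub>Q (T \<inter> V)\<^esub> y)
          = (f v [^] k) \<odot>\<^bsub>Q (insert v T \<inter> V)\<^esub> y"
        using y fv res_id[OF TV yc] unfolding eq by (simp add: P.smult_assoc1[symmetric])
      show "(f v [^] (k - 1)) \<odot>\<^bsub>Q (T \<inter> V)\<^esub> y \<in> carrier (Q (T \<inter> V))" by (rule yc)
    qed
    then show ?thesis using False by auto
  qed
qed

lemma face_ker:
  assumes v: "v < n" "v \<notin> T" and T: "T \<subseteq> {..<n}" and x: "x \<in> carrier (Q (T \<inter> V))"
    and 0: "(if v \<in> V then \<one> else f v) \<odot>\<^bsub>Q (insert v T \<inter> V)\<^esub> res (insert v T \<inter> V) x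
              = \<zero>\<^bsub>Q (insert v T \<inter> V)\<^esub>"
  shows "\<exists>k0. \<forall>k\<ge>k0. (f v [^] (k::nat)) \<odot>\<^bsub>Q (T \<inter> V)\<^esub> x = \<zero>\<^bsub>Q (T \<inter> V)\<^esub>"
proof -
  have TV: "T \<inter> V \<subseteq> {..<n}" and vT: "insert v T \<inter> V \<subseteq> {..<n}" using T v by auto
  have sub: "T \<inter> V \<subseteq> insert v T \<inter> V" by auto
  interpret P: module R "Q (T \<inter> V)" by (rule Q_module[OF TV])
  interpret Q: module R "Q (insert v T \<inter> V)" by (rule Q_module[OF vT])
  note fv = f_closed[OF v(1)]
  have "\<exists>k0::nat. (f v [^] k0) \<odot>\<^bsub>Q (T \<inter> V)\<^esub> x = \<zero>\<^bsub>Q (T \<inter> V)\<^esub>"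
  proof (cases "v \<in> V")
    case True
    then have eq: "insert v T \<inter> V = insert v (T \<inter> V)" by auto
    have "res (insert v T \<inter> V) x = \<zero>\<^bsub>Q (insert v T \<inter> V)\<^esub>"
      using 0 True Q.smult_one[OF res_closed[OF sub vT x]] by simp
    then show ?thesis using res_ker[OF v(1) TV x] eq by simp
  next
    case False
    then have eq: "insert v T \<inter> V = T \<inter> V" by auto
    have "(f v [^] (1::nat)) \<odot>\<^bsub>Q (T \<inter> V)\<^esub> x = \<zero>\<^bsub>Q (T \<inter> V)\<^esub>"
      using 0 False res_id[OF TV x] fv unfolding eq by simp
    then show ?thesis by blast
  qed
  then obtain k0 :: nat where k0: "(f v [^] k0) \<odot>\<^bsub>Q (T \<inter> V)\<^esub> x = \<zero>\<^bsub>Q (T \<inter> V)\<^esub>" ..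
  have "(f v [^] k) \<odot>\<^bsub>Q (T \<inter> V)\<^esub> x = \<zero>\<^bsub>Q (T \<inter> V)\<^esub>" if "k \<ge> k0" for k
  proof -
    have "f v [^] k = f v [^] (k - k0) \<otimes> f v [^] k0"
      using that fv by (simp add: nat_pow_mult)
    then show ?thesis using k0 fv x by (simp add: P.smult_assoc1)
  qed
  then show ?thesis by blast
qed

lemma cube_diff_split:
  assumes c: "c \<in> carrier (cochains V)" and T: "T \<subseteq> {..<n}" and v: "v \<in> T"
  shows "cube_diff V c T = cube_coeff V T v \<odot>\<^bsub>Q (T \<inter> V)\<^esub> res (T \<inter> V) (c (T - {v})) \<oplus>\<^bsub>Q (T \<inter> V)\<^esub>
     (\<Oplus>\<^bsub>Q (T \<inter> V)\<^esub>j\<in>T - {v}. cube_coeff V T j \<odot>\<^bsub>Q (T \<inter> V)\<^esub> res (T \<inter> V) (c (T - {j})))"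
proof -
  interpret Q: module R "Q (T \<inter> V)" by (rule Q_face[OF T])
  have fin: "finite T" using T finite_subset by blast
  have "T = insert v (T - {v})" using v by auto
  then show ?thesis
    unfolding cube_diff_apply[OF T]
    using Q.M.finsum_insert[of "T - {v}" v
        "\<lambda>j. cube_coeff V T j \<odot>\<^bsub>Q (T \<inter> V)\<^esub> res (T \<inter> V) (c (T - {j}))"]
      fin face_term_closed[OF c T] v by auto
qed

lemma cube_diff_single:
  assumes c: "c \<in> carrier (cochains V)" and T: "T \<subseteq> {..<n}" and v: "v \<in> T"
    and 0: "\<And>j. j \<in> T \<Longrightarrow> j \<noteq> v \<Longrightarrow> c (T - {j}) = \<zero>\<^bsub>Q ((T - {j}) \<inter> V)\<^esub>"
  shows "cube_diff V c T = cube_coeff V T v \<odot>\<^bsub>Q (T \<inter> V)\<^esub> res (T \<inter> V) (c (T - {v}))"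
proof -
  interpret Q: module R "Q (T \<inter> V)" by (rule Q_face[OF T])
  have TV: "T \<inter> V \<subseteq> {..<n}" using T by auto
  have "(\<Oplus>\<^bsub>Q (T \<inter> V)\<^esub>j\<in>T - {v}. cube_coeff V T j \<odot>\<^bsub>Q (T \<inter> V)\<^esub> res (T \<inter> V) (c (T - {j})))
      = (\<Oplus>\<^bsub>Q (T \<inter> V)\<^esub>j\<in>T - {v}. \<zero>\<^bsub>Q (T \<inter> V)\<^esub>)"
    using 0 res_zero[OF face_mono TV] T
    by (intro Q.M.finsum_cong') auto
  then show ?thesis
    using cube_diff_split[OF c T v] face_term_closed[OF c T v] by simp
qed

lemma cube_diff_zero:
  assumes c: "c \<in> carrier (cochains V)" and T: "T \<subseteq> {..<n}"
    and 0: "\<And>j. j \<in> T \<Longrightarrow> c (T - {j}) = \<zero>\<^bsub>Q ((T - {j}) \<inter> V)\<^esub>"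
  shows "cube_diff V c T = \<zero>\<^bsub>Q (T \<inter> V)\<^esub>"
proof -
  interpret Q: module R "Q (T \<inter> V)" by (rule Q_face[OF T])
  have TV: "T \<inter> V \<subseteq> {..<n}" using T by auto
  have "cube_diff V c T = (\<Oplus>\<^bsub>Q (T \<inter> V)\<^esub>j\<in>T. \<zero>\<^bsub>Q (T \<inter> V)\<^esub>)"
    unfolding cube_diff_apply[OF T]
    using 0 res_zero[OF face_mono TV] T
    by (intro Q.M.finsum_cong') auto
  then show ?thesis by simp
qed

text \<open>Cohomology vanishes up to \<open>f\<^sub>v\<close>-torsion because the maps in direction \<open>v\<close> are invertible up to
  \<open>f\<^sub>v\<close>-torsion (\<open>face_coker\<close> and \<open>face_ker\<close>). The cochain \<open>w\<close> integrates \<open>f\<^sub>v\<^sup>k c\<close> in direction \<open>v\<close>, so \<open>u = d w - f\<^sub>v\<^sup>k c\<close> is a cocycle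
  without components at faces containing \<open>v\<close>. The cocycle condition at \<open>T \<union> {v}\<close> then has a
  single term, which says that \<open>u T\<close> is in the kernel of the map in direction \<open>v\<close>; hence a power of
  \<open>f\<^sub>v\<close> kills \<open>u\<close>.\<close>

lemma cocycle_torsion:
  assumes v: "v < n" and c: "c \<in> cube_cocycles V"
  shows "\<exists>k::nat. (f v [^] k) \<odot>\<^bsub>cochains V\<^esub> c \<in> cube_coboundaries V"
proof -
  interpret C: module R "cochains V" by (rule cochains_module)
  define e where "e = (if v \<in> V then \<one> else f v)"
  note fv = f_closed[OF v]
  have e: "e \<in> carrier R" by (simp add: e_def fv)
  have coeff: "cube_coeff V T v = shuffle_sign T v \<otimes> e" for T
    by (simp add: cube_coeff_def e_def)
  have cc: "c \<in> carrier (cochains V)" using c by (simp add: cube_cocycles_def)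
  have "\<exists>k::nat. \<forall>T\<in>{T \<in> Pow {..<n}. v \<notin> T}. \<exists>x\<in>carrier (Q (T \<inter> V)).
      e \<odot>\<^bsub>Q (insert v T \<inter> V)\<^esub> res (insert v T \<inter> V) x = (f v [^] k) \<odot>\<^bsub>Q (insert v T \<inter> V)\<^esub> c (insert v T)"
    unfolding e_def using v by (intro uniform_threshold face_coker cochain_closed[OF cc]) auto
  then obtain k :: nat and x where
    x: "\<And>T. T \<subseteq> {..<n} \<Longrightarrow> v \<notin> T \<Longrightarrow> x T \<in> carrier (Q (T \<inter> V))"
      "\<And>T. T \<subseteq> {..<n} \<Longrightarrow> v \<notin> T \<Longrightarrow>
        e \<odot>\<^bsub>Q (insert v T \<inter> V)\<^esub> res (insert v T \<inter> V) (x T) = (f v [^] k) \<odot>\<^bsub>Q (insert v T \<inter> V)\<^esub> c (insert v T)"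
    unfolding Ball_def Bex_def by simp metis
  define w where "w = (\<lambda>T\<in>Pow {..<n}. if v \<in> T then \<zero>\<^bsub>Q (T \<inter> V)\<^esub>
      else shuffle_sign (insert v T) v \<odot>\<^bsub>Q (T \<inter> V)\<^esub> x T)"
  have w: "w \<in> carrier (cochains V)"
    unfolding w_def
    by (rule cochainI) (auto intro!: module.smult_closed[OF Q_face] x(1)
        abelian_groupE(2)[OF module.axioms(2)[OF Q_face]])
  define u where "u = cube_diff V w \<ominus>\<^bsub>cochains V\<^esub> (f v [^] k) \<odot>\<^bsub>cochains V\<^esub> c"
  have dw: "cube_diff V w \<in> cube_cocycles V"
    using cube_coboundaries_subset[of V] w by (auto simp: cube_coboundaries_def)
  have fc: "(f v [^] k) \<odot>\<^bsub>cochains V\<^esub> c \<in> cube_cocycles V"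
    using C.submoduleE(4)[OF cube_cocycles_submodule _ c] fv by simp
  have u: "u \<in> cube_cocycles V"
    unfolding u_def by (rule C.submodule_minus[OF cube_cocycles_submodule dw fc])
  then have uc: "u \<in> carrier (cochains V)" by (simp add: cube_cocycles_def)
  have u1: "u T = \<zero>\<^bsub>Q (T \<inter> V)\<^esub>" if T: "T \<subseteq> {..<n}" and vT: "v \<in> T" for T
  proof -
    interpret Q: module R "Q (T \<inter> V)" by (rule Q_face[OF T])
    have T': "T - {v} \<subseteq> {..<n}" "insert v (T - {v}) = T" using T vT by auto
    have TV: "T \<inter> V \<subseteq> {..<n}" using T by auto
    note xT = x(1)[OF T'(1)] x(2)[OF T'(1)]
    have rx: "res (T \<inter> V) (x (T - {v})) \<in> carrier (Q (T \<inter> V))"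
      using xT(1) by (intro res_closed[OF face_mono TV]) auto
    have "cube_diff V w T = cube_coeff V T v \<odot>\<^bsub>Q (T \<inter> V)\<^esub> res (T \<inter> V) (w (T - {v}))"
      by (rule cube_diff_single[OF w T vT]) (use T vT in \<open>auto simp: w_def\<close>)
    also have "w (T - {v}) = shuffle_sign T v \<odot>\<^bsub>Q ((T - {v}) \<inter> V)\<^esub> x (T - {v})"
      using T' by (auto simp: w_def)
    also have "res (T \<inter> V) (shuffle_sign T v \<odot>\<^bsub>Q ((T - {v}) \<inter> V)\<^esub> x (T - {v}))
        = shuffle_sign T v \<odot>\<^bsub>Q (T \<inter> V)\<^esub> res (T \<inter> V) (x (T - {v}))"
      using xT(1) by (intro res_smult[OF face_mono TV]) auto
    also have "cube_coeff V T v \<odot>\<^bsub>Q (T \<inter> V)\<^esub> (shuffle_sign T v \<odot>\<^bsub>Q (T \<inter> V)\<^esub> res (T \<inter> V) (x (T - {v})))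
        = ((shuffle_sign T v \<otimes> shuffle_sign T v) \<otimes> e) \<odot>\<^bsub>Q (T \<inter> V)\<^esub> res (T \<inter> V) (x (T - {v}))"
      using rx e by (simp add: coeff Q.smult_assoc1[symmetric] m_ac)
    also have "\<dots> = (f v [^] k) \<odot>\<^bsub>Q (T \<inter> V)\<^esub> c T"
      using e xT(2) T'(2) by (simp add: shuffle_sign_square)
    finally have "cube_diff V w T = (f v [^] k) \<odot>\<^bsub>Q (T \<inter> V)\<^esub> c T" .
    then show ?thesis
      using fv cochain_closed[OF cc T]
        cochain_minus[OF cube_diff_closed[OF w] C.smult_closed[OF _ cc] T, of "f v [^] k"]
      by (simp add: u_def cochain_simps[OF T] Q.M.r_neg a_minus_def)
  qed
  have "\<exists>k0. \<forall>k\<ge>k0. (f v [^] (k::nat)) \<odot>\<^bsub>Q (T \<inter> V)\<^esub> u T = \<zero>\<^bsub>Q (T \<inter> V)\<^esub>" if T: "T \<subseteq> {..<n}" for T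
  proof (cases "v \<in> T")
    case True
    then show ?thesis using u1[OF T] module.smult_r_null[OF Q_face[OF T]] fv by simp
  next
    case False
    let ?T = "insert v T"
    have T': "?T \<subseteq> {..<n}" "?T - {v} = T" using T v False by auto
    have TV: "?T \<inter> V \<subseteq> {..<n}" using T' by auto
    interpret Q: module R "Q (?T \<inter> V)" by (rule Q_face[OF T'(1)])
    have ru: "res (?T \<inter> V) (u T) \<in> carrier (Q (?T \<inter> V))"
      using cochain_closed[OF uc T] by (intro res_closed[OF _ TV]) auto
    have "cube_diff V u ?T = cube_coeff V ?T v \<odot>\<^bsub>Q (?T \<inter> V)\<^esub> res (?T \<inter> V) (u (?T - {v}))"
      by (rule cube_diff_single[OF uc T'(1)]) (use T' v in \<open>auto intro!: u1\<close>)
    moreover have "cube_diff V u ?T = \<zero>\<^bsub>Q (?T \<inter> V)\<^esub>"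
      using u by (simp add: cube_cocycles_def cochain_simps[OF T'(1)])
    ultimately have "(shuffle_sign ?T v \<otimes> e) \<odot>\<^bsub>Q (?T \<inter> V)\<^esub> res (?T \<inter> V) (u T) = \<zero>\<^bsub>Q (?T \<inter> V)\<^esub>"
      using T'(2) by (simp add: coeff)
    then have "shuffle_sign ?T v \<odot>\<^bsub>Q (?T \<inter> V)\<^esub> ((shuffle_sign ?T v \<otimes> e) \<odot>\<^bsub>Q (?T \<inter> V)\<^esub> res (?T \<inter> V) (u T))
        = \<zero>\<^bsub>Q (?T \<inter> V)\<^esub>"
      by simp
    then have "e \<odot>\<^bsub>Q (?T \<inter> V)\<^esub> res (?T \<inter> V) (u T) = \<zero>\<^bsub>Q (?T \<inter> V)\<^esub>"
      using e ru by (simp add: Q.smult_assoc1[symmetric] m_assoc[symmetric] shuffle_sign_square)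
    then show ?thesis
      unfolding e_def by (rule face_ker[OF v False T cochain_closed[OF uc T]])
  qed
  then have "\<exists>k::nat. \<forall>T\<in>Pow {..<n}. (f v [^] k) \<odot>\<^bsub>Q (T \<inter> V)\<^esub> u T = \<zero>\<^bsub>Q (T \<inter> V)\<^esub>"
    by (intro uniform_threshold) auto
  then obtain l :: nat where l: "\<And>T. T \<subseteq> {..<n} \<Longrightarrow> (f v [^] l) \<odot>\<^bsub>Q (T \<inter> V)\<^esub> u T = \<zero>\<^bsub>Q (T \<inter> V)\<^esub>"
    by auto
  have "(f v [^] l) \<odot>\<^bsub>cochains V\<^esub> u = \<zero>\<^bsub>cochains V\<^esub>"
    by (rule cochain_eqI[where V = V]) (use uc fv l in \<open>auto simp: cochain_simps\<close>)
  then have "(f v [^] l) \<odot>\<^bsub>cochains V\<^esub> cube_diff V w \<ominus>\<^bsub>cochains V\<^esub> (f v [^] (l + k)) \<odot>\<^bsub>cochains V\<^esub> c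
      = \<zero>\<^bsub>cochains V\<^esub>"
    using fv cc cube_diff_closed[OF w] unfolding u_def a_minus_def
    by (simp add: C.smult_r_distr C.smult_r_minus nat_pow_mult[symmetric] C.smult_assoc1)
  moreover have "(f v [^] l) \<odot>\<^bsub>cochains V\<^esub> cube_diff V w \<in> carrier (cochains V)"
    "(f v [^] (l + k)) \<odot>\<^bsub>cochains V\<^esub> c \<in> carrier (cochains V)"
    using fv cc cube_diff_closed[OF w] by auto
  ultimately have "(f v [^] l) \<odot>\<^bsub>cochains V\<^esub> cube_diff V w = (f v [^] (l + k)) \<odot>\<^bsub>cochains V\<^esub> c"
    by (rule C.M.eq_if_minus_zero[rotated 2])
  then have "(f v [^] (l + k)) \<odot>\<^bsub>cochains V\<^esub> c \<in> cube_coboundaries V"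
    using C.submoduleE(4)[OF cube_coboundaries_submodule, of "f v [^] l" "cube_diff V w"] fv w
    by (auto simp: cube_coboundaries_def)
  then show ?thesis by blast
qed

definition divide_by :: "nat \<Rightarrow> nat set \<Rightarrow> 'c \<Rightarrow> 'c" where
  "divide_by v S = inv_into (carrier (Q S)) (\<lambda>x. f v \<odot>\<^bsub>Q S\<^esub> x)"

lemma divide_by:
  assumes "S \<subseteq> {..<n}" "v \<in> S" "y \<in> carrier (Q S)"
  shows "divide_by v S y \<in> carrier (Q S)" "f v \<odot>\<^bsub>Q S\<^esub> divide_by v S y = y"
proof -
  have y: "y \<in> (\<lambda>x. f v \<odot>\<^bsub>Q S\<^esub> x) ` carrier (Q S)"
    using f_bij[OF assms(1,2)] assms(3) by (simp add: bij_betw_def)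
  show "divide_by v S y \<in> carrier (Q S)" "f v \<odot>\<^bsub>Q S\<^esub> divide_by v S y = y"
    unfolding divide_by_def using inv_into_into[OF y] f_inv_into_f[OF y] by auto
qed

lemma f_cancel:
  assumes "S \<subseteq> {..<n}" "v \<in> S" "x \<in> carrier (Q S)" "y \<in> carrier (Q S)"
    "f v \<odot>\<^bsub>Q S\<^esub> x = f v \<odot>\<^bsub>Q S\<^esub> y"
  shows "x = y"
  using f_bij[OF assms(1,2)] assms(3-5) by (auto simp: bij_betw_def inj_on_def)

text \<open>The cochain map that turns direction \<open>v\<close> from Koszul type into Cech type. Dividing by \<open>f\<^sub>v\<close> on
  the faces that contain \<open>v\<close> compensates for the factor \<open>f\<^sub>v\<close> of the Koszul differential: on the
  cone of multiplication by \<open>f\<^sub>v\<close> this is \<open>(a, b) \<mapsto> (a, b / f\<^sub>v)\<close>.\<close>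

definition koszul_to_cech :: "nat \<Rightarrow> nat set \<Rightarrow> (nat set \<Rightarrow> 'c) \<Rightarrow> nat set \<Rightarrow> 'c" where
  "koszul_to_cech v V u =
     (\<lambda>T\<in>Pow {..<n}. if v \<in> T then divide_by v (T \<inter> insert v V) (res (T \<inter> insert v V) (u T)) else u T)"

context
  fixes v V assumes v: "v < n" "v \<notin> V"
begin

abbreviation (input) "W \<equiv> insert v V"

lemma res_W_closed:
  assumes "T \<subseteq> {..<n}" "x \<in> carrier (Q (T \<inter> V))"
  shows "res (T \<inter> W) x \<in> carrier (Q (T \<inter> W))"
  by (rule res_closed[OF _ _ assms(2)]) (use assms(1) in auto)

lemma koszul_to_cech_in:
  assumes u: "u \<in> carrier (cochains V)" and T: "T \<subseteq> {..<n}" and vT: "v \<in> T"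
  shows "koszul_to_cech v V u T \<in> carrier (Q (T \<inter> W))"
    and "f v \<odot>\<^bsub>Q (T \<inter> W)\<^esub> koszul_to_cech v V u T = res (T \<inter> W) (u T)"
  using divide_by[of "T \<inter> W" v "res (T \<inter> W) (u T)"] res_W_closed[OF T cochain_closed[OF u T]] T vT
  by (auto simp: koszul_to_cech_def)

lemma koszul_to_cech_notin:
  assumes "T \<subseteq> {..<n}" "v \<notin> T"
  shows "koszul_to_cech v V u T = u T"
  using assms by (auto simp: koszul_to_cech_def)

lemma face_notin: "v \<notin> T \<Longrightarrow> T \<inter> W = T \<inter> V"
  by auto

lemma koszul_to_cech_closed:
  assumes u: "u \<in> carrier (cochains V)"
  shows "koszul_to_cech v V u \<in> carrier (cochains W)"
proof -
  have "(\<lambda>T\<in>Pow {..<n}. koszul_to_cech v V u T) \<in> carrier (cochains W)"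
  proof (rule cochainI)
    fix T assume T: "T \<subseteq> {..<n}"
    show "koszul_to_cech v V u T \<in> carrier (Q (T \<inter> W))"
      using koszul_to_cech_in(1)[OF u T] koszul_to_cech_notin[OF T] cochain_closed[OF u T] face_notin[of T]
      by (cases "v \<in> T") auto
  qed
  moreover have "(\<lambda>T\<in>Pow {..<n}. koszul_to_cech v V u T) = koszul_to_cech v V u"
    by (auto simp: koszul_to_cech_def)
  ultimately show ?thesis by simp
qed

lemma koszul_to_cech_hom: "koszul_to_cech v V \<in> Hom_module R (cochains V) (cochains W)"
proof -
  interpret C: module R "cochains V" by (rule cochains_module)
  interpret C': module R "cochains W" by (rule cochains_module)
  note fv = f_closed[OF v(1)]
  have "koszul_to_cech v V (x \<oplus>\<^bsub>cochains V\<^esub> y) = koszul_to_cech v V x \<oplus>\<^bsub>cochains W\<^esub> koszul_to_cech v V y"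
    if xy: "x \<in> carrier (cochains V)" "y \<in> carrier (cochains V)" for x y
  proof (rule cochain_eqI[where V = W])
    fix T assume T: "T \<subseteq> {..<n}"
    have TV: "T \<inter> V \<subseteq> T \<inter> W" "T \<inter> W \<subseteq> {..<n}" using T by auto
    interpret Q: module R "Q (T \<inter> W)" by (rule Q_face[OF T])
    show "koszul_to_cech v V (x \<oplus>\<^bsub>cochains V\<^esub> y) T = (koszul_to_cech v V x \<oplus>\<^bsub>cochains W\<^esub> koszul_to_cech v V y) T"
    proof (cases "v \<in> T")
      case True
      note in1 = koszul_to_cech_in[OF _ T True]
      show ?thesis
      proof (rule f_cancel[of "T \<inter> W" v])
        show "(koszul_to_cech v V x \<oplus>\<^bsub>cochains W\<^esub> koszul_to_cech v V y) T \<in> carrier (Q (T \<inter> W))"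
          using in1(1) xy by (simp only: cochain_simps[OF T] Q.M.a_closed)
        show "f v \<odot>\<^bsub>Q (T \<inter> W)\<^esub> koszul_to_cech v V (x \<oplus>\<^bsub>cochains V\<^esub> y) T =
          f v \<odot>\<^bsub>Q (T \<inter> W)\<^esub> (koszul_to_cech v V x \<oplus>\<^bsub>cochains W\<^esub> koszul_to_cech v V y) T"
          using in1 xy fv res_add[OF TV cochain_closed[OF xy(1) T] cochain_closed[OF xy(2) T]]
          by (simp add: cochain_simps[OF T] Q.smult_r_distr)
      qed (use TV True in1 xy in \<open>auto simp: cochain_simps[OF T]\<close>)
    qed (use xy face_notin[of T] in \<open>simp add: koszul_to_cech_notin[OF T] cochain_simps[OF T]\<close>)
  qed (use xy in \<open>auto intro: koszul_to_cech_closed\<close>)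
  moreover have "koszul_to_cech v V (r \<odot>\<^bsub>cochains V\<^esub> x) = r \<odot>\<^bsub>cochains W\<^esub> koszul_to_cech v V x"
    if r: "r \<in> carrier R" and x: "x \<in> carrier (cochains V)" for r x
  proof (rule cochain_eqI[where V = W])
    fix T assume T: "T \<subseteq> {..<n}"
    have TV: "T \<inter> V \<subseteq> T \<inter> W" "T \<inter> W \<subseteq> {..<n}" using T by auto
    interpret Q: module R "Q (T \<inter> W)" by (rule Q_face[OF T])
    show "koszul_to_cech v V (r \<odot>\<^bsub>cochains V\<^esub> x) T = (r \<odot>\<^bsub>cochains W\<^esub> koszul_to_cech v V x) T"
    proof (cases "v \<in> T")
      case True
      note in1 = koszul_to_cech_in[OF _ T True]
      show ?thesis
      proof (rule f_cancel[of "T \<inter> W" v])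
        show "(r \<odot>\<^bsub>cochains W\<^esub> koszul_to_cech v V x) T \<in> carrier (Q (T \<inter> W))"
          using in1(1)[OF x] r by (simp only: cochain_simps[OF T] Q.smult_closed)
        have "f v \<odot>\<^bsub>Q (T \<inter> W)\<^esub> (r \<odot>\<^bsub>Q (T \<inter> W)\<^esub> koszul_to_cech v V x T)
           = r \<odot>\<^bsub>Q (T \<inter> W)\<^esub> (f v \<odot>\<^bsub>Q (T \<inter> W)\<^esub> koszul_to_cech v V x T)"
          using in1(1)[OF x] fv r by (simp add: Q.smult_assoc1[symmetric] m_comm)
        then show "f v \<odot>\<^bsub>Q (T \<inter> W)\<^esub> koszul_to_cech v V (r \<odot>\<^bsub>cochains V\<^esub> x) T =
          f v \<odot>\<^bsub>Q (T \<inter> W)\<^esub> (r \<odot>\<^bsub>cochains W\<^esub> koszul_to_cech v V x) T"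
          using in1 x r res_smult[OF TV r cochain_closed[OF x T]]
          by (simp add: cochain_simps[OF T])
      qed (use TV True in1 x r in \<open>auto simp: cochain_simps[OF T]\<close>)
    qed (use x r face_notin[of T] in \<open>simp add: koszul_to_cech_notin[OF T] cochain_simps[OF T]\<close>)
  qed (use r x in \<open>auto intro: koszul_to_cech_closed\<close>)
  ultimately show ?thesis
    by (auto simp: Hom_module_def koszul_to_cech_closed)
qed

lemma cube_coeff_W: "j \<noteq> v \<Longrightarrow> cube_coeff W T j = cube_coeff V T j"
  by (simp add: cube_coeff_def)

lemma cube_coeff_v: "cube_coeff W T v = shuffle_sign T v" "cube_coeff V T v = shuffle_sign T v \<otimes> f v"
  using v by (auto simp: cube_coeff_def)

lemma cube_diff_notin:
  assumes c: "c \<in> carrier (cochains V)" and T: "T \<subseteq> {..<n}" and vT: "v \<notin> T"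
    and eq: "\<And>S. S \<subseteq> T \<Longrightarrow> c' S = c S"
  shows "cube_diff W c' T = cube_diff V c T"
  unfolding cube_diff_apply[OF T] face_notin[OF vT]
proof (rule abelian_monoid.finsum_cong'[OF abelian_group.axioms(1)[OF module.axioms(2)[OF Q_face[OF T]]] refl])
  fix j assume "j \<in> T"
  then show "cube_coeff W T j \<odot>\<^bsub>Q (T \<inter> V)\<^esub> res (T \<inter> V) (c' (T - {j})) =
    cube_coeff V T j \<odot>\<^bsub>Q (T \<inter> V)\<^esub> res (T \<inter> V) (c (T - {j}))"
    using vT eq[of "T - {j}"] cube_coeff_W[of j T] by (cases "j = v") auto
qed (use face_term_closed[OF c T] in auto)

lemma koszul_to_cech_diff:
  assumes u: "u \<in> carrier (cochains V)"
  shows "cube_diff W (koszul_to_cech v V u) = koszul_to_cech v V (cube_diff V u)"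
proof (rule cochain_eqI[where V = W])
  let ?h = "koszul_to_cech v V"
  note du = cube_diff_closed[OF u] and hu = koszul_to_cech_closed[OF u] and fv = f_closed[OF v(1)]
  show cl: "cube_diff W (?h u) \<in> carrier (cochains W)" "?h (cube_diff V u) \<in> carrier (cochains W)"
    using hu du by (auto intro: cube_diff_closed koszul_to_cech_closed)
  fix T assume T: "T \<subseteq> {..<n}"
  show "cube_diff W (?h u) T = ?h (cube_diff V u) T"
  proof (cases "v \<in> T")
    case False
    have "cube_diff W (?h u) T = cube_diff V u T"
      by (rule cube_diff_notin[OF u T False]) (use T False in \<open>auto intro!: koszul_to_cech_notin\<close>)
    then show ?thesis using koszul_to_cech_notin[OF T False] by simp
  next
    case vT: True
    have TV: "T \<inter> V \<subseteq> T \<inter> W" "T \<inter> W \<subseteq> {..<n}" "T \<inter> V \<subseteq> {..<n}" using T by auto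
    have fin: "finite T" using T finite_subset by blast
    interpret Q: module R "Q (T \<inter> W)" by (rule Q_face[OF T])
    show ?thesis
    proof (rule f_cancel[OF TV(2), of v])
      have uj: "u (T - {j}) \<in> carrier (Q ((T - {j}) \<inter> V))" for j
        using T by (intro cochain_closed[OF u]) auto
      have ruj: "res (T \<inter> W) (u (T - {j})) \<in> carrier (Q (T \<inter> W))" for j
        by (rule res_closed[OF _ TV(2) uj]) auto
      have coeff: "cube_coeff X T j \<in> carrier R" if "j \<in> T" for j X using that T by auto
      have "f v \<odot>\<^bsub>Q (T \<inter> W)\<^esub> cube_diff W (?h u) T
        = (\<Oplus>\<^bsub>Q (T \<inter> W)\<^esub>j\<in>T. f v \<odot>\<^bsub>Q (T \<inter> W)\<^esub>
             (cube_coeff W T j \<odot>\<^bsub>Q (T \<inter> W)\<^esub> res (T \<inter> W) (?h u (T - {j}))))"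
        unfolding cube_diff_apply[OF T]
        using face_term_closed[OF hu T] fv fin by (intro Q.finsum_smult_ldistr) auto
      also have "\<dots> = (\<Oplus>\<^bsub>Q (T \<inter> W)\<^esub>j\<in>T. cube_coeff V T j \<odot>\<^bsub>Q (T \<inter> W)\<^esub> res (T \<inter> W) (u (T - {j})))"
      proof (rule Q.M.finsum_cong'[OF refl])
        fix j assume j: "j \<in> T"
        have Tj: "T - {j} \<subseteq> {..<n}" using T by auto
        have hc: "?h u (T - {j}) \<in> carrier (Q ((T - {j}) \<inter> W))" by (rule cochain_closed[OF hu Tj])
        have rhc: "res (T \<inter> W) (?h u (T - {j})) \<in> carrier (Q (T \<inter> W))"
          by (rule res_closed[OF face_mono TV(2) hc])
        show "f v \<odot>\<^bsub>Q (T \<inter> W)\<^esub> (cube_coeff W T j \<odot>\<^bsub>Q (T \<inter> W)\<^esub> res (T \<inter> W) (?h u (T - {j}))) =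
          cube_coeff V T j \<odot>\<^bsub>Q (T \<inter> W)\<^esub> res (T \<inter> W) (u (T - {j}))"
        proof (cases "j = v")
          case True
          then have "?h u (T - {j}) = u (T - {j})" using koszul_to_cech_notin[OF Tj] by simp
          then show ?thesis
            using True ruj[of v] fv by (simp add: cube_coeff_v Q.smult_assoc1[symmetric] m_comm)
        next
          case False
          then have vTj: "v \<in> T - {j}" using vT by auto
          have "f v \<odot>\<^bsub>Q (T \<inter> W)\<^esub> (cube_coeff W T j \<odot>\<^bsub>Q (T \<inter> W)\<^esub> res (T \<inter> W) (?h u (T - {j})))
            = cube_coeff V T j \<odot>\<^bsub>Q (T \<inter> W)\<^esub> (f v \<odot>\<^bsub>Q (T \<inter> W)\<^esub> res (T \<inter> W) (?h u (T - {j})))"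
            using coeff[OF j] fv rhc by (simp add: cube_coeff_W[OF False] Q.smult_assoc1[symmetric] m_comm)
          also have "f v \<odot>\<^bsub>Q (T \<inter> W)\<^esub> res (T \<inter> W) (?h u (T - {j}))
            = res (T \<inter> W) (f v \<odot>\<^bsub>Q ((T - {j}) \<inter> W)\<^esub> ?h u (T - {j}))"
            by (rule res_smult[OF face_mono TV(2) fv hc, symmetric])
          also have "\<dots> = res (T \<inter> W) (u (T - {j}))"
            unfolding koszul_to_cech_in(2)[OF u Tj vTj]
            by (rule res_res[OF _ face_mono TV(2) uj]) auto
          finally show ?thesis .
        qed
      qed (use coeff ruj in auto)
      also have "\<dots> = (\<Oplus>\<^bsub>Q (T \<inter> W)\<^esub>j\<in>T. res (T \<inter> W)
           (cube_coeff V T j \<odot>\<^bsub>Q (T \<inter> V)\<^esub> res (T \<inter> V) (u (T - {j}))))"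
      proof (rule Q.M.finsum_cong'[OF refl])
        fix j assume j: "j \<in> T"
        show "cube_coeff V T j \<odot>\<^bsub>Q (T \<inter> W)\<^esub> res (T \<inter> W) (u (T - {j})) =
           res (T \<inter> W) (cube_coeff V T j \<odot>\<^bsub>Q (T \<inter> V)\<^esub> res (T \<inter> V) (u (T - {j})))"
          using res_smult[OF TV(1,2) coeff[OF j] res_face_closed[OF u T]]
            res_res[OF face_mono TV(1,2) uj] by simp
      qed (use res_closed[OF TV(1,2)] face_term_closed[OF u T] in auto)
      also have "\<dots> = res (T \<inter> W) (cube_diff V u T)"
        unfolding cube_diff_apply[OF T]
        by (rule res_finsum[OF TV(1,2) fin, symmetric]) (use face_term_closed[OF u T] in auto)
      also have "\<dots> = f v \<odot>\<^bsub>Q (T \<inter> W)\<^esub> ?h (cube_diff V u) T"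
        using koszul_to_cech_in(2)[OF du T vT] by simp
      finally show "f v \<odot>\<^bsub>Q (T \<inter> W)\<^esub> cube_diff W (?h u) T = f v \<odot>\<^bsub>Q (T \<inter> W)\<^esub> ?h (cube_diff V u) T" .
    qed (use vT cochain_closed[OF cl(1) T] cochain_closed[OF cl(2) T] in auto)
  qed
qed

text \<open>Cohomology classes killed by \<open>f\<^sub>v\<close> come from the complex in which \<open>v\<close> is of Koszul type. If
  \<open>f\<^sub>v z = d b\<close>, then the components of \<open>z\<close> away from \<open>v\<close> and those of \<open>b\<close>, shifted in direction \<open>v\<close>,
  form a Koszul cocycle \<open>u\<close>. Its image differs from \<open>z\<close> by the coboundary of \<open>b / f\<^sub>v\<close>, restricted to the faces
  containing \<open>v\<close>.\<close>

lemma colon_in_image: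
  assumes z: "z \<in> cube_cocycles W" and fz: "f v \<odot>\<^bsub>cochains W\<^esub> z \<in> cube_coboundaries W"
  shows "\<exists>u\<in>cube_cocycles V. z \<ominus>\<^bsub>cochains W\<^esub> koszul_to_cech v V u \<in> cube_coboundaries W"
proof -
  interpret C: module R "cochains V" by (rule cochains_module)
  interpret C': module R "cochains W" by (rule cochains_module)
  note fv = f_closed[OF v(1)]
  obtain b where b: "b \<in> carrier (cochains W)" "f v \<odot>\<^bsub>cochains W\<^esub> z = cube_diff W b"
    using fz by (auto simp: cube_coboundaries_def)
  have zc: "z \<in> carrier (cochains W)" and dz: "cube_diff W z = \<zero>\<^bsub>cochains W\<^esub>"
    using z by (auto simp: cube_cocycles_def)
  define u where "u = (\<lambda>T\<in>Pow {..<n}. if v \<in> T then shuffle_sign T v \<odot>\<^bsub>Q (T \<inter> V)\<^esub> b (T - {v}) else z T)"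
  have bc: "b (T - {v}) \<in> carrier (Q (T \<inter> V))" if "T \<subseteq> {..<n}" for T
  proof -
    have "(T - {v}) \<inter> W = T \<inter> V" using v by auto
    then show ?thesis using cochain_closed[OF b(1), of "T - {v}"] that by auto
  qed
  have uc: "u \<in> carrier (cochains V)"
    unfolding u_def
  proof (rule cochainI)
    fix T assume T: "T \<subseteq> {..<n}"
    then show "(if v \<in> T then shuffle_sign T v \<odot>\<^bsub>Q (T \<inter> V)\<^esub> b (T - {v}) else z T) \<in> carrier (Q (T \<inter> V))"
      using module.smult_closed[OF Q_face[OF T] _ bc[OF T]] cochain_closed[OF zc T] by auto
  qed
  have du: "cube_diff V u = \<zero>\<^bsub>cochains V\<^esub>"
  proof (rule cochain_eqI[where V = V])
    fix T assume T: "T \<subseteq> {..<n}"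
    interpret Q: module R "Q (T \<inter> V)" by (rule Q_face[OF T])
    have TV: "T \<inter> V \<subseteq> {..<n}" using T by auto
    have fin: "finite T" using T finite_subset by blast
    show "cube_diff V u T = \<zero>\<^bsub>cochains V\<^esub> T"
    proof (cases "v \<in> T")
      case False
      have "cube_diff W z T = cube_diff V u T"
        by (rule cube_diff_notin[OF uc T False]) (use T False in \<open>auto simp: u_def\<close>)
      then show ?thesis
        using dz face_notin[OF False] by (simp add: cochain_simps[OF T])
    next
      case vT: True
      have coeff: "cube_coeff X S j \<in> carrier R" if "j \<in> T" for j X S using that T by auto
      have Tv: "T - {v} \<subseteq> {..<n}" and TvW: "(T - {v}) \<inter> W = T \<inter> V" using T v by auto
      have bj: "b (T - {v} - {j}) \<in> carrier (Q ((T - {v} - {j}) \<inter> W))" for j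
        using T by (intro cochain_closed[OF b(1)]) auto
      have rb: "res (T \<inter> V) (b (T - {v} - {j})) \<in> carrier (Q (T \<inter> V))" for j
        by (rule res_closed[OF _ TV bj]) (use v in auto)
      \<comment> \<open>The term of \<open>d b\<close> at \<open>T - {v}\<close> that belongs to \<open>j\<close>. It occurs twice in \<open>d u\<close> at \<open>T\<close>: through
          \<open>f\<^sub>v z = d b\<close> in direction \<open>v\<close>, and with the opposite sign in direction \<open>j\<close>.\<close>
      define t where "t j = (shuffle_sign T v \<otimes> cube_coeff V (T - {v}) j) \<odot>\<^bsub>Q (T \<inter> V)\<^esub>
          res (T \<inter> V) (b (T - {v} - {j}))" for j
      have tc: "t j \<in> carrier (Q (T \<inter> V))" if "j \<in> T" for j
        unfolding t_def using rb coeff that by simp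
      have uTv: "u (T - {v}) = z (T - {v})" using Tv by (auto simp: u_def)
      have zTv: "z (T - {v}) \<in> carrier (Q (T \<inter> V))"
        using cochain_closed[OF zc Tv] TvW by simp
      have "cube_coeff V T v \<odot>\<^bsub>Q (T \<inter> V)\<^esub> res (T \<inter> V) (u (T - {v}))
        = shuffle_sign T v \<odot>\<^bsub>Q (T \<inter> V)\<^esub> (f v \<odot>\<^bsub>Q (T \<inter> V)\<^esub> z (T - {v}))"
        unfolding uTv cube_coeff_v res_id[OF TV zTv] using zTv fv by (intro Q.smult_assoc1) auto
      also have "f v \<odot>\<^bsub>Q (T \<inter> V)\<^esub> z (T - {v}) = cube_diff W b (T - {v})"
        using cochain_simps(3)[OF Tv, of W "f v" z] b(2) TvW by simp
      also have "shuffle_sign T v \<odot>\<^bsub>Q (T \<inter> V)\<^esub> cube_diff W b (T - {v})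
         = (\<Oplus>\<^bsub>Q (T \<inter> V)\<^esub>j\<in>T - {v}. shuffle_sign T v \<odot>\<^bsub>Q (T \<inter> V)\<^esub>
             (cube_coeff W (T - {v}) j \<odot>\<^bsub>Q (T \<inter> V)\<^esub> res (T \<inter> V) (b (T - {v} - {j}))))"
        unfolding cube_diff_apply[OF Tv] TvW
        by (rule Q.finsum_smult_ldistr) (use fin face_term_closed[OF b(1) Tv] TvW in auto)
      also have "\<dots> = (\<Oplus>\<^bsub>Q (T \<inter> V)\<^esub>j\<in>T - {v}. t j)"
        using coeff rb tc by (intro Q.M.finsum_cong') (auto simp: t_def cube_coeff_W Q.smult_assoc1)
      finally have 1: "cube_coeff V T v \<odot>\<^bsub>Q (T \<inter> V)\<^esub> res (T \<inter> V) (u (T - {v}))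
        = (\<Oplus>\<^bsub>Q (T \<inter> V)\<^esub>j\<in>T - {v}. t j)" .
      have 2: "(\<Oplus>\<^bsub>Q (T \<inter> V)\<^esub>j\<in>T - {v}. cube_coeff V T j \<odot>\<^bsub>Q (T \<inter> V)\<^esub> res (T \<inter> V) (u (T - {j})))
        = (\<Oplus>\<^bsub>Q (T \<inter> V)\<^esub>j\<in>T - {v}. \<ominus>\<^bsub>Q (T \<inter> V)\<^esub> t j)"
      proof (rule Q.M.finsum_cong'[OF refl])
        fix j assume j: "j \<in> T - {v}"
        have Tj: "T - {j} \<subseteq> {..<n}" using T by auto
        have comm: "T - {j} - {v} = T - {v} - {j}" by auto
        have bj': "b (T - {v} - {j}) \<in> carrier (Q ((T - {j}) \<inter> V))"
          using bc[OF Tj] comm by simp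
        have "u (T - {j}) = shuffle_sign (T - {j}) v \<odot>\<^bsub>Q ((T - {j}) \<inter> V)\<^esub> b (T - {v} - {j})"
          using j vT Tj comm by (auto simp: u_def)
        then have "res (T \<inter> V) (u (T - {j})) = shuffle_sign (T - {j}) v \<odot>\<^bsub>Q (T \<inter> V)\<^esub> res (T \<inter> V) (b (T - {v} - {j}))"
          using res_smult[OF face_mono TV shuffle_sign_closed bj'] by simp
        then have eq: "cube_coeff V T j \<odot>\<^bsub>Q (T \<inter> V)\<^esub> res (T \<inter> V) (u (T - {j}))
          = (cube_coeff V T j \<otimes> shuffle_sign (T - {j}) v) \<odot>\<^bsub>Q (T \<inter> V)\<^esub> res (T \<inter> V) (b (T - {v} - {j}))"
          using coeff j rb by (simp add: Q.smult_assoc1)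
        have "cube_coeff V T j \<otimes> shuffle_sign (T - {j}) v = \<ominus> (shuffle_sign T v \<otimes> cube_coeff V (T - {v}) j)"
        proof -
          define e where "e = (if j \<in> V then \<one> else f j)"
          have e: "e \<in> carrier R" using j T f_closed by (auto simp: e_def)
          have "(shuffle_sign T j \<otimes> e) \<otimes> shuffle_sign (T - {j}) v
              = (shuffle_sign T j \<otimes> shuffle_sign (T - {j}) v) \<otimes> e"
            using e by (simp add: m_ac)
          also have "\<dots> = \<ominus> (shuffle_sign T v \<otimes> (shuffle_sign (T - {v}) j \<otimes> e))"
            using shuffle_sign_swap[OF fin, of j v] j vT e by (simp add: l_minus m_assoc)
          finally show ?thesis by (simp add: cube_coeff_def e_def)
        qed
        then show "cube_coeff V T j \<odot>\<^bsub>Q (T \<inter> V)\<^esub> res (T \<inter> V) (u (T - {j})) = \<ominus>\<^bsub>Q (T \<inter> V)\<^esub> t j"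
          unfolding eq t_def using coeff j rb by (simp add: Q.smult_l_minus)
      qed (use tc in auto)
      have "cube_diff V u T = (\<Oplus>\<^bsub>Q (T \<inter> V)\<^esub>j\<in>T - {v}. t j) \<oplus>\<^bsub>Q (T \<inter> V)\<^esub>
          (\<Oplus>\<^bsub>Q (T \<inter> V)\<^esub>j\<in>T - {v}. \<ominus>\<^bsub>Q (T \<inter> V)\<^esub> t j)"
        unfolding cube_diff_split[OF uc T vT] 1 2 ..
      also have "\<dots> = (\<Oplus>\<^bsub>Q (T \<inter> V)\<^esub>j\<in>T - {v}. t j \<oplus>\<^bsub>Q (T \<inter> V)\<^esub> \<ominus>\<^bsub>Q (T \<inter> V)\<^esub> t j)"
        using tc by (intro Q.M.finsum_addf[symmetric]) auto
      also have "\<dots> = (\<Oplus>\<^bsub>Q (T \<inter> V)\<^esub>j\<in>T - {v}. \<zero>\<^bsub>Q (T \<inter> V)\<^esub>)"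
        using tc by (intro Q.M.finsum_cong') (auto simp: Q.M.r_neg)
      finally show ?thesis by (simp add: cochain_simps[OF T])
    qed
  qed (use uc in \<open>auto intro: cube_diff_closed\<close>)
  define w where "w = (\<lambda>T\<in>Pow {..<n}. if v \<in> T then divide_by v (T \<inter> W) (b T) else \<zero>\<^bsub>Q (T \<inter> W)\<^esub>)"
  have w_in: "w T \<in> carrier (Q (T \<inter> W))" "f v \<odot>\<^bsub>Q (T \<inter> W)\<^esub> w T = b T" if "T \<subseteq> {..<n}" "v \<in> T" for T
    using divide_by[of "T \<inter> W" v "b T"] cochain_closed[OF b(1), of T] that by (auto simp: w_def)
  have w_notin: "w T = \<zero>\<^bsub>Q (T \<inter> W)\<^esub>" if "T \<subseteq> {..<n}" "v \<notin> T" for T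
    using that by (auto simp: w_def)
  have "(\<lambda>T\<in>Pow {..<n}. w T) \<in> carrier (cochains W)"
  proof (rule cochainI)
    fix T assume T: "T \<subseteq> {..<n}"
    show "w T \<in> carrier (Q (T \<inter> W))"
      using w_in(1)[OF T] w_notin[OF T] abelian_groupE(2)[OF module.axioms(2)[OF Q_face[OF T, of W]]]
      by (cases "v \<in> T") auto
  qed
  moreover have "(\<lambda>T\<in>Pow {..<n}. w T) = w" by (auto simp: w_def)
  ultimately have wc: "w \<in> carrier (cochains W)" by simp
  let ?hu = "koszul_to_cech v V u"
  have hu: "?hu \<in> carrier (cochains W)" by (rule koszul_to_cech_closed[OF uc])
  have "z \<ominus>\<^bsub>cochains W\<^esub> ?hu = cube_diff W w"
  proof (rule cochain_eqI[where V = W])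
    show "cube_diff W w \<in> carrier (cochains W)" by (rule cube_diff_closed[OF wc])
    fix T assume T: "T \<subseteq> {..<n}"
    interpret Q: module R "Q (T \<inter> W)" by (rule Q_face[OF T])
    have TW: "T \<inter> W \<subseteq> {..<n}" using T by auto
    have fin: "finite T" using T finite_subset by blast
    note zT = cochain_closed[OF zc T] and huT = cochain_closed[OF hu T]
    show "(z \<ominus>\<^bsub>cochains W\<^esub> ?hu) T = cube_diff W w T"
    proof (cases "v \<in> T")
      case False
      have "?hu T = z T" using koszul_to_cech_notin[OF T False] False T by (simp add: u_def)
      moreover have "cube_diff W w T = \<zero>\<^bsub>Q (T \<inter> W)\<^esub>"
        by (rule cube_diff_zero[OF wc T], rule w_notin) (use T False in auto)
      ultimately show ?thesis
        using zT unfolding cochain_minus[OF zc hu T] by (simp add: a_minus_def Q.M.r_neg)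
    next
      case vT: True
      have coeff: "cube_coeff X S j \<in> carrier R" if "j \<in> T" for j X S using that T by auto
      have bT: "res (T \<inter> W) (b (T - {v})) \<in> carrier (Q (T \<inter> W))"
        by (rule res_face_closed[OF b(1) T])
      let ?s = "shuffle_sign T v \<odot>\<^bsub>Q (T \<inter> W)\<^esub> res (T \<inter> W) (b (T - {v}))"
      let ?S = "\<Oplus>\<^bsub>Q (T \<inter> W)\<^esub>j\<in>T - {v}. cube_coeff W T j \<odot>\<^bsub>Q (T \<inter> W)\<^esub> res (T \<inter> W) (b (T - {j}))"
      have Sc: "?S \<in> carrier (Q (T \<inter> W))" and sc: "?s \<in> carrier (Q (T \<inter> W))"
        using face_term_closed[OF b(1) T] bT by (auto intro!: Q.M.finsum_closed)
      have fz: "f v \<odot>\<^bsub>Q (T \<inter> W)\<^esub> z T = ?s \<oplus>\<^bsub>Q (T \<inter> W)\<^esub> ?S"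
        using cochain_simps(3)[OF T, of W "f v" z] b(2) cube_diff_split[OF b(1) T vT]
        by (simp add: cube_coeff_v)
      have uT: "u T = shuffle_sign T v \<odot>\<^bsub>Q (T \<inter> V)\<^esub> b (T - {v})" using vT T by (simp add: u_def)
      have fh: "f v \<odot>\<^bsub>Q (T \<inter> W)\<^esub> ?hu T = ?s"
        unfolding koszul_to_cech_in(2)[OF uc T vT] uT
        by (rule res_smult[OF _ TW shuffle_sign_closed bc[OF T]]) auto
      have "w (T - {v}) = \<zero>\<^bsub>Q ((T - {v}) \<inter> W)\<^esub>" using T by (intro w_notin) auto
      then have "res (T \<inter> W) (w (T - {v})) = \<zero>\<^bsub>Q (T \<inter> W)\<^esub>"
        using res_zero[OF face_mono[of T v W] TW] by (simp only:)
      then have "cube_diff W w T = \<zero>\<^bsub>Q (T \<inter> W)\<^esub> \<oplus>\<^bsub>Q (T \<inter> W)\<^esub>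
         (\<Oplus>\<^bsub>Q (T \<inter> W)\<^esub>j\<in>T - {v}. cube_coeff W T j \<odot>\<^bsub>Q (T \<inter> W)\<^esub> res (T \<inter> W) (w (T - {j})))"
        unfolding cube_diff_split[OF wc T vT] using coeff[OF vT] by simp
      also have "\<dots> = (\<Oplus>\<^bsub>Q (T \<inter> W)\<^esub>j\<in>T - {v}. cube_coeff W T j \<odot>\<^bsub>Q (T \<inter> W)\<^esub> res (T \<inter> W) (w (T - {j})))"
        using face_term_closed[OF wc T] by (auto intro!: Q.M.l_zero Q.M.finsum_closed)
      finally have "f v \<odot>\<^bsub>Q (T \<inter> W)\<^esub> cube_diff W w T = (\<Oplus>\<^bsub>Q (T \<inter> W)\<^esub>j\<in>T - {v}.
          f v \<odot>\<^bsub>Q (T \<inter> W)\<^esub> (cube_coeff W T j \<odot>\<^bsub>Q (T \<inter> W)\<^esub> res (T \<inter> W) (w (T - {j}))))"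
        using face_term_closed[OF wc T] fin fv by (auto intro!: Q.finsum_smult_ldistr)
      also have "\<dots> = ?S"
      proof (rule Q.M.finsum_cong'[OF refl])
        fix j assume j: "j \<in> T - {v}"
        have Tj: "T - {j} \<subseteq> {..<n}" "v \<in> T - {j}" using T j vT by auto
        have rw: "res (T \<inter> W) (w (T - {j})) \<in> carrier (Q (T \<inter> W))"
          by (rule res_face_closed[OF wc T])
        have "f v \<odot>\<^bsub>Q (T \<inter> W)\<^esub> (cube_coeff W T j \<odot>\<^bsub>Q (T \<inter> W)\<^esub> res (T \<inter> W) (w (T - {j})))
          = cube_coeff W T j \<odot>\<^bsub>Q (T \<inter> W)\<^esub> (f v \<odot>\<^bsub>Q (T \<inter> W)\<^esub> res (T \<inter> W) (w (T - {j})))"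
          using fv coeff j rw by (simp add: Q.smult_assoc1[symmetric] m_comm)
        also have "f v \<odot>\<^bsub>Q (T \<inter> W)\<^esub> res (T \<inter> W) (w (T - {j})) = res (T \<inter> W) (b (T - {j}))"
          using res_smult[OF face_mono TW fv w_in(1)[OF Tj]] w_in(2)[OF Tj] by simp
        finally show "f v \<odot>\<^bsub>Q (T \<inter> W)\<^esub> (cube_coeff W T j \<odot>\<^bsub>Q (T \<inter> W)\<^esub> res (T \<inter> W) (w (T - {j}))) =
          cube_coeff W T j \<odot>\<^bsub>Q (T \<inter> W)\<^esub> res (T \<inter> W) (b (T - {j}))" .
      qed (use face_term_closed[OF b(1) T] in auto)
      finally have fw: "f v \<odot>\<^bsub>Q (T \<inter> W)\<^esub> cube_diff W w T = ?S" .
      show ?thesis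
        unfolding cochain_minus[OF zc hu T]
      proof (rule f_cancel[OF TW, of v])
        show "z T \<ominus>\<^bsub>Q (T \<inter> W)\<^esub> ?hu T \<in> carrier (Q (T \<inter> W))"
          by (rule Q.M.minus_closed[OF zT huT])
        have "f v \<odot>\<^bsub>Q (T \<inter> W)\<^esub> (z T \<ominus>\<^bsub>Q (T \<inter> W)\<^esub> ?hu T) = (?s \<oplus>\<^bsub>Q (T \<inter> W)\<^esub> ?S) \<ominus>\<^bsub>Q (T \<inter> W)\<^esub> ?s"
          using fv zT huT fz fh unfolding a_minus_def by (simp only: Q.smult_r_distr Q.smult_r_minus Q.M.a_inv_closed)
        also have "\<dots> = ?S" by (rule Q.add_minus_cancel[OF sc Sc])
        finally show "f v \<odot>\<^bsub>Q (T \<inter> W)\<^esub> (z T \<ominus>\<^bsub>Q (T \<inter> W)\<^esub> ?hu T) = f v \<odot>\<^bsub>Q (T \<inter> W)\<^esub> cube_diff W w T"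
          using fw by simp
      qed (use vT zT huT cochain_closed[OF cube_diff_closed[OF wc] T] in auto)
    qed
  qed (use zc hu in auto)
  then have "z \<ominus>\<^bsub>cochains W\<^esub> ?hu \<in> cube_coboundaries W"
    using wc by (auto simp: cube_coboundaries_def)
  then show ?thesis using uc du by (auto simp: cube_cocycles_def)
qed

text \<open>The torsion criterion for \<open>f\<^sub>v\<close> reduces the claim to classes killed by \<open>f\<^sub>v\<close>, and these are
  images of classes for \<open>V\<close>.\<close>

lemma artinian_cohomology_step:
  assumes art: "artinian_between R (cochains V) (cube_cocycles V) (cube_coboundaries V)"
  shows "artinian_between R (cochains W) (cube_cocycles W) (cube_coboundaries W)"
proof -
  interpret C': module R "cochains W" by (rule cochains_module)
  note fv = f_closed[OF v(1)]
  have "artinian_between R (cochains W)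
      {z \<in> cube_cocycles W. f v \<odot>\<^bsub>cochains W\<^esub> z \<in> cube_coboundaries W} (cube_coboundaries W)"
  proof (rule artinian_between_hom[OF cochains_module cochains_module koszul_to_cech_hom
        cube_cocycles_submodule cube_coboundaries_submodule cube_coboundaries_subset
        cube_coboundaries_submodule])
    fix c assume "c \<in> cube_coboundaries V"
    then obtain w where w: "w \<in> carrier (cochains V)" "c = cube_diff V w"
      by (auto simp: cube_coboundaries_def)
    then show "koszul_to_cech v V c \<in> cube_coboundaries W"
      using koszul_to_cech_diff[OF w(1)] koszul_to_cech_closed[OF w(1)]
      by (auto simp: cube_coboundaries_def image_iff intro!: bexI[of _ "koszul_to_cech v V w"])
  qed (use colon_in_image art in \<open>auto simp: cube_cocycles_def\<close>)
  then show ?thesis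
    using cocycle_torsion[OF v(1)] fv
    by (intro C'.artinian_between_torsion[OF cube_cocycles_submodule cube_coboundaries_submodule
        cube_coboundaries_subset]) auto
qed

end

text \<open>A finite power of a noetherian module is noetherian: split off one component \<open>T\<close> at a time,
  lifting generators of the module of values at \<open>T\<close>. Being finitely generated is
  phrased as a property of all submodules \<open>P'\<close> that contain the generators.\<close>

lemma cochain_submodule_fin_gen:
  assumes noeth: "\<And>P. submodule P R (Q {}) \<Longrightarrow>
      \<exists>A\<subseteq>P. finite A \<and> (\<forall>P'. submodule P' R (Q {}) \<longrightarrow> A \<subseteq> P' \<longrightarrow> P \<subseteq> P')"
    and "submodule P R (cochains {})"
  shows "\<exists>A\<subseteq>P. finite A \<and> (\<forall>P'. submodule P' R (cochains {}) \<longrightarrow> A \<subseteq> P' \<longrightarrow> P \<subseteq> P')"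
proof -
  interpret C: module R "cochains {}" by (rule cochains_module)
  interpret Q: module R "Q {}" by (rule Q_module) auto
  have *: "\<exists>A\<subseteq>P. finite A \<and> (\<forall>P'. submodule P' R (cochains {}) \<longrightarrow> A \<subseteq> P' \<longrightarrow> P \<subseteq> P')"
    if "finite X" "submodule P R (cochains {})" "X \<subseteq> Pow {..<n}"
      "\<And>c T. c \<in> P \<Longrightarrow> T \<subseteq> {..<n} \<Longrightarrow> T \<notin> X \<Longrightarrow> c T = \<zero>\<^bsub>Q {}\<^esub>" for X P
    using that
  proof (induction X arbitrary: P rule: finite_induct)
    case empty
    have "c = \<zero>\<^bsub>cochains {}\<^esub>" if c: "c \<in> P" for c
      by (rule cochain_eqI[where V = "{}"])
         (use c empty(3)[OF c] C.submodule_carrier[OF empty(1)] in \<open>auto simp: cochain_simps\<close>)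
    then have "P \<subseteq> P'" if "submodule P' R (cochains {})" for P'
      using C.submodule_zero[OF that] by auto
    then show ?case by (intro exI[of _ "{}"]) auto
  next
    case (insert T X)
    note P = insert.prems(1)
    have T: "T \<subseteq> {..<n}" using insert.prems(2) by auto
    have eval: "submodule ((\<lambda>c. c T) ` N) R (Q {})" if N: "submodule N R (cochains {})" for N
    proof (rule Q.submoduleI)
      note Nc = C.submodule_carrier[OF N]
      show "(\<lambda>c. c T) ` N \<subseteq> carrier (Q {})" using Nc cochain_closed[OF _ T, of _ "{}"] by auto
      show "\<zero>\<^bsub>Q {}\<^esub> \<in> (\<lambda>c. c T) ` N"
        using C.submodule_zero[OF N] cochain_simps(1)[OF T, of "{}"]
        by (intro image_eqI[of _ _ "\<zero>\<^bsub>cochains {}\<^esub>"]) auto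
      fix x assume "x \<in> (\<lambda>c. c T) ` N"
      then obtain c where c: "c \<in> N" "x = c T" by auto
      show sm: "r \<odot>\<^bsub>Q {}\<^esub> x \<in> (\<lambda>c. c T) ` N" if "r \<in> carrier R" for r
        using C.submoduleE(4)[OF N that c(1)] cochain_simps(3)[OF T, of "{}" r c] c
        by (intro image_eqI[of _ _ "r \<odot>\<^bsub>cochains {}\<^esub> c"]) auto
      have "x \<in> carrier (Q {})" using c Nc cochain_closed[OF _ T, of _ "{}"] by auto
      then show "\<ominus>\<^bsub>Q {}\<^esub> x \<in> (\<lambda>c. c T) ` N" using sm[of "\<ominus> \<one>"] by (simp add: Q.smult_l_minus)
      fix y assume "y \<in> (\<lambda>c. c T) ` N"
      then obtain c' where c': "c' \<in> N" "y = c' T" by auto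
      show "x \<oplus>\<^bsub>Q {}\<^esub> y \<in> (\<lambda>c. c T) ` N"
        using C.submoduleE(5)[OF N c(1) c'(1)] cochain_simps(2)[OF T, of "{}" c c'] c c'
        by (intro image_eqI[of _ _ "c \<oplus>\<^bsub>cochains {}\<^esub> c'"]) auto
    qed
    obtain Y where Y: "Y \<subseteq> (\<lambda>c. c T) ` P" "finite Y"
      "\<And>P'. submodule P' R (Q {}) \<Longrightarrow> Y \<subseteq> P' \<Longrightarrow> (\<lambda>c. c T) ` P \<subseteq> P'"
      using noeth[OF eval[OF P]] by blast
    obtain A1 where A1: "A1 \<subseteq> P" "finite A1" "Y = (\<lambda>c. c T) ` A1"
      using finite_subset_image[OF Y(2,1)] by blast
    let ?P = "{c \<in> P. c T = \<zero>\<^bsub>Q {}\<^esub>}"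
    have sP: "submodule ?P R (cochains {})"
    proof (rule C.submoduleI)
      fix x assume x: "x \<in> ?P"
      show sm: "r \<odot>\<^bsub>cochains {}\<^esub> x \<in> ?P" if "r \<in> carrier R" for r
        using x that C.submoduleE(4)[OF P that] by (auto simp: cochain_simps[OF T])
      show "\<ominus>\<^bsub>cochains {}\<^esub> x \<in> ?P"
        using sm[of "\<ominus> \<one>"] x C.submodule_carrier[OF P] by (simp add: C.smult_l_minus)
      show "x \<oplus>\<^bsub>cochains {}\<^esub> y \<in> ?P" if "y \<in> ?P" for y
        using x that C.submoduleE(5)[OF P] by (auto simp: cochain_simps[OF T])
    qed (use C.submoduleE(1)[OF P] C.submodule_zero[OF P] in \<open>auto simp: cochain_simps[OF T]\<close>)
    have "\<exists>A\<subseteq>?P. finite A \<and> (\<forall>P'. submodule P' R (cochains {}) \<longrightarrow> A \<subseteq> P' \<longrightarrow> ?P \<subseteq> P')"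
    proof (rule insert.IH[OF sP])
      show "X \<subseteq> Pow {..<n}" using insert.prems(2) by auto
      show "c S = \<zero>\<^bsub>Q {}\<^esub>" if "c \<in> ?P" "S \<subseteq> {..<n}" "S \<notin> X" for c S
        using that insert.prems(3)[of c S] by (cases "S = T") auto
    qed
    then obtain A2 where A2: "A2 \<subseteq> ?P" "finite A2"
      "\<And>P'. submodule P' R (cochains {}) \<Longrightarrow> A2 \<subseteq> P' \<Longrightarrow> ?P \<subseteq> P'" by blast
    have "P \<subseteq> P'" if P': "submodule P' R (cochains {})" "A1 \<union> A2 \<subseteq> P'" for P'
    proof
      fix c assume c: "c \<in> P"
      have sub: "submodule (P \<inter> P') R (cochains {})" by (rule C.submodule_Int[OF P P'(1)])
      have "(\<lambda>c. c T) ` P \<subseteq> (\<lambda>c. c T) ` (P \<inter> P')"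
        by (rule Y(3)[OF eval[OF sub]]) (use A1 P'(2) in auto)
      then obtain c1 where c1: "c1 \<in> P" "c1 \<in> P'" "c T = c1 T" using c by blast
      have cc: "c \<in> carrier (cochains {})" "c1 \<in> carrier (cochains {})"
        using c c1 C.submodule_carrier[OF P] by auto
      have "c1 T \<in> carrier (Q {})" using cochain_closed[OF cc(2) T] by simp
      then have "(c \<ominus>\<^bsub>cochains {}\<^esub> c1) T = \<zero>\<^bsub>Q {}\<^esub>"
        using cochain_minus[OF cc T] c1(3) by (simp add: a_minus_def Q.M.r_neg)
      then have "c \<ominus>\<^bsub>cochains {}\<^esub> c1 \<in> ?P" using C.submodule_minus[OF P c c1(1)] by simp
      then have "c \<ominus>\<^bsub>cochains {}\<^esub> c1 \<in> P'" using A2(3)[OF P'(1)] P'(2) by blast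
      then show "c \<in> P'" using C.submodule_diff_cancel[OF P'(1) cc(1) c1(2)] by blast
    qed
    then show ?case using A1 A2 by (intro exI[of _ "A1 \<union> A2"]) auto
  qed
  show ?thesis
    by (rule *[of "Pow {..<n}"]) (use assms(2) in auto)
qed

text \<open>By the torsion criterion only the classes killed by all \<open>f\<^sub>v\<close>, that is by \<open>\<mm>\<close>, matter; they form a
  finitely generated module, because the module of
  Koszul cochains is noetherian.\<close>

lemma artinian_koszul:
  assumes noeth: "\<And>P. submodule P R (Q {}) \<Longrightarrow>
      \<exists>A\<subseteq>P. finite A \<and> (\<forall>P'. submodule P' R (Q {}) \<longrightarrow> A \<subseteq> P' \<longrightarrow> P \<subseteq> P')"
    and mx: "maximalideal \<mm> R" and gen: "\<mm> = genideal R (f ` {..<n})"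
  shows "artinian_between R (cochains {}) (cube_cocycles {}) (cube_coboundaries {})"
proof -
  interpret C: module R "cochains {}" by (rule cochains_module)
  let ?Z = "cube_cocycles {}" and ?B = "cube_coboundaries {}"
  let ?W = "{z \<in> ?Z. \<forall>a\<in>f ` {..<n}. a \<odot>\<^bsub>cochains {}\<^esub> z \<in> ?B}"
  have fR: "f ` {..<n} \<subseteq> carrier R" using f_closed by auto
  note Z = cube_cocycles_submodule[of "{}"] and B = cube_coboundaries_submodule[of "{}"]
  have W: "submodule ?W R (cochains {})" by (rule C.submodule_colon[OF Z B fR])
  have BW: "?B \<subseteq> ?W"
    using cube_coboundaries_subset C.submoduleE(4)[OF B] fR by blast
  obtain A where A: "A \<subseteq> ?W" "finite A"
    "\<And>P'. submodule P' R (cochains {}) \<Longrightarrow> A \<subseteq> P' \<Longrightarrow> ?W \<subseteq> P'"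
    using cochain_submodule_fin_gen[OF noeth W] by blast
  have "artinian_between R (cochains {}) ?W ?B"
  proof (rule C.artinian_between_fin_gen[OF mx A(2) B W BW A(1)])
    show "?W \<subseteq> P" if "submodule P R (cochains {})" "?B \<union> A \<subseteq> P" for P
      by (rule A(3)[OF that(1)]) (use that(2) in blast)
    fix r a assume r: "r \<in> \<mm>" and a: "a \<in> A"
    have aW: "a \<in> ?W" using A(1) a by blast
    have ac: "a \<in> carrier (cochains {})" using C.submodule_carrier[OF W aW] .
    have "ideal {r \<in> carrier R. r \<odot>\<^bsub>cochains {}\<^esub> a \<in> ?B} R"
    proof (rule idealI[OF ring_axioms])
      show "subgroup {r \<in> carrier R. r \<odot>\<^bsub>cochains {}\<^esub> a \<in> ?B} (add_monoid R)"
        using C.submodule_zero[OF B] C.submoduleE(3,5)[OF B] ac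
        by (intro add.subgroupI) (auto simp: a_inv_def[symmetric] C.smult_l_minus C.smult_l_distr)
      fix s x assume s: "s \<in> {r \<in> carrier R. r \<odot>\<^bsub>cochains {}\<^esub> a \<in> ?B}" and x: "x \<in> carrier R"
      have "(x \<otimes> s) \<odot>\<^bsub>cochains {}\<^esub> a \<in> ?B"
        using C.submoduleE(4)[OF B x, of "s \<odot>\<^bsub>cochains {}\<^esub> a"] s x ac by (simp add: C.smult_assoc1)
      then show "x \<otimes> s \<in> {r \<in> carrier R. r \<odot>\<^bsub>cochains {}\<^esub> a \<in> ?B}"
        "s \<otimes> x \<in> {r \<in> carrier R. r \<odot>\<^bsub>cochains {}\<^esub> a \<in> ?B}"
        using s x by (auto simp: m_comm)
    qed
    then have "genideal R (f ` {..<n}) \<subseteq> {r \<in> carrier R. r \<odot>\<^bsub>cochains {}\<^esub> a \<in> ?B}"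
      by (rule genideal_minimal) (use fR aW in auto)
    then show "r \<odot>\<^bsub>cochains {}\<^esub> a \<in> ?B" using r gen by blast
  qed
  then show ?thesis
    by (rule C.artinian_between_torsion_finite[OF _ Z B cube_coboundaries_subset fR, rotated 2])
       (use cocycle_torsion in auto)
qed

theorem artinian_cohomology:
  assumes noeth: "\<And>P. submodule P R (Q {}) \<Longrightarrow>
      \<exists>A\<subseteq>P. finite A \<and> (\<forall>P'. submodule P' R (Q {}) \<longrightarrow> A \<subseteq> P' \<longrightarrow> P \<subseteq> P')"
    and mx: "maximalideal \<mm> R" and gen: "\<mm> = genideal R (f ` {..<n})"
  shows "artinian_between R (cochains {..<n}) (cube_cocycles {..<n}) (cube_coboundaries {..<n})"
proof -
  have "artinian_between R (cochains V) (cube_cocycles V) (cube_coboundaries V)"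
    if "finite V" "V \<subseteq> {..<n}" for V
    using that
  proof (induction V rule: finite_induct)
    case empty
    show ?case by (rule artinian_koszul[OF noeth mx gen])
  next
    case (insert v V)
    then show ?case by (intro artinian_cohomology_step) auto
  qed
  then show ?thesis by auto
qed

end

section \<open>Localizations and the Cech rings\<close>

text \<open>Multiplicative sets, for which the operations on fractions are well defined.\<close>

locale denominators = cring R for R :: "('a, 'b) ring_scheme" (structure) +
  fixes S :: "'a set"
  assumes denom_carrier: "S \<subseteq> carrier R"
    and one_denom: "\<one> \<in> S"
    and mult_denom: "s \<in> S \<Longrightarrow> t \<in> S \<Longrightarrow> s \<otimes> t \<in> S"
begin

lemma denom_closed [simp]: "s \<in> S \<Longrightarrow> s \<in> carrier R"
  using denom_carrier by auto

lemma fraction_self: "a \<in> carrier R \<Longrightarrow> s \<in> S \<Longrightarrow> (a, s) \<in> fraction R S a s"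
  unfolding fraction_def using one_denom by auto

lemma fraction_eqI:
  assumes a: "a \<in> carrier R" "s \<in> S" and b: "b \<in> carrier R" "t \<in> S"
    and u: "u \<in> S" "u \<otimes> (t \<otimes> a) = u \<otimes> (s \<otimes> b)"
  shows "fraction R S a s = fraction R S b t"
proof -
  have *: "fraction R S a s \<subseteq> fraction R S b t"
    if a: "a \<in> carrier R" "s \<in> S" and b: "b \<in> carrier R" "t \<in> S"
      and u: "u \<in> S" "u \<otimes> (t \<otimes> a) = u \<otimes> (s \<otimes> b)" for a s b t u
  proof (rule subrelI)
    fix c r assume "(c, r) \<in> fraction R S a s"
    then obtain w where c: "c \<in> carrier R" "r \<in> S" and w: "w \<in> S" "w \<otimes> (r \<otimes> a) = w \<otimes> (s \<otimes> c)"
      by (auto simp: fraction_def)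
    have "(u \<otimes> w \<otimes> s) \<otimes> (r \<otimes> b) = (w \<otimes> r) \<otimes> (u \<otimes> (s \<otimes> b))"
      using a b c u(1) w(1) by (simp add: m_ac)
    also have "\<dots> = (w \<otimes> r) \<otimes> (u \<otimes> (t \<otimes> a))" using u(2) by simp
    also have "\<dots> = (u \<otimes> t) \<otimes> (w \<otimes> (r \<otimes> a))"
      using a b c u(1) w(1) by (simp add: m_ac)
    also have "\<dots> = (u \<otimes> t) \<otimes> (w \<otimes> (s \<otimes> c))" using w(2) by simp
    also have "\<dots> = (u \<otimes> w \<otimes> s) \<otimes> (t \<otimes> c)"
      using a b c u(1) w(1) by (simp add: m_ac)
    finally have "\<exists>u\<in>S. u \<otimes> (r \<otimes> b) = u \<otimes> (t \<otimes> c)"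
      using u w a mult_denom by (intro bexI[of _ "u \<otimes> w \<otimes> s"]) auto
    then show "(c, r) \<in> fraction R S b t"
      using c by (auto simp: fraction_def)
  qed
  show ?thesis
    using *[OF a b u] *[OF b a u(1) u(2)[symmetric]] by blast
qed

lemma fraction_eq_iff:
  assumes "a \<in> carrier R" "s \<in> S" "b \<in> carrier R" "t \<in> S"
  shows "fraction R S a s = fraction R S b t \<longleftrightarrow> (\<exists>u\<in>S. u \<otimes> (t \<otimes> a) = u \<otimes> (s \<otimes> b))"
proof
  assume "fraction R S a s = fraction R S b t"
  then have "(b, t) \<in> fraction R S a s" using fraction_self assms by auto
  then show "\<exists>u\<in>S. u \<otimes> (t \<otimes> a) = u \<otimes> (s \<otimes> b)" by (auto simp: fraction_def)
qed (use assms fraction_eqI in blast)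

text \<open>The operations on fractions are unions over all representatives; they collapse to a single class
  when the summands do not depend on the representative.\<close>

lemma fraction_Union:
  assumes "a \<in> carrier R" "s \<in> S"
    and "\<And>b t u. b \<in> carrier R \<Longrightarrow> t \<in> S \<Longrightarrow> u \<in> S \<Longrightarrow> u \<otimes> (t \<otimes> a) = u \<otimes> (s \<otimes> b) \<Longrightarrow> g b t = g a s"
  shows "(\<Union>(b, t)\<in>fraction R S a s. g b t) = g a s"
proof -
  have *: "(case x of (b, t) \<Rightarrow> g b t) = g a s" if "x \<in> fraction R S a s" for x
    using that assms(3) by (auto simp: fraction_def)
  have "(\<Union>x\<in>fraction R S a s. case x of (b, t) \<Rightarrow> g b t) = (\<Union>x\<in>fraction R S a s. g a s)"
    by (intro SUP_cong refl *)
  also have "\<dots> = g a s"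
    using fraction_self[OF assms(1,2)] by auto
  finally show ?thesis .
qed

lemma fraction_closed [intro]: "a \<in> carrier R \<Longrightarrow> s \<in> S \<Longrightarrow> fraction R S a s \<in> carrier (localization R S)"
  by (auto simp: localization_def)

lemma localization_cases:
  assumes "x \<in> carrier (localization R S)"
  obtains a s where "a \<in> carrier R" "s \<in> S" "x = fraction R S a s"
  using assms by (auto simp: localization_def)

lemma localization_zero: "\<zero>\<^bsub>localization R S\<^esub> = fraction R S \<zero> \<one>"
  by (simp add: localization_def)

lemma fraction_zero: "s \<in> S \<Longrightarrow> fraction R S \<zero> s = \<zero>\<^bsub>localization R S\<^esub>"
  unfolding localization_zero using one_denom by (intro fraction_eqI[where u = \<one>]) auto

lemma fraction_eq_zero_iff:
  assumes "a \<in> carrier R" "s \<in> S"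
  shows "fraction R S a s = \<zero>\<^bsub>localization R S\<^esub> \<longleftrightarrow> (\<exists>u\<in>S. u \<otimes> a = \<zero>)"
  unfolding localization_zero using assms one_denom by (subst fraction_eq_iff) auto

lemma fraction_smult:
  assumes "r \<in> carrier R" "a \<in> carrier R" "s \<in> S"
  shows "r \<odot>\<^bsub>localization R S\<^esub> fraction R S a s = fraction R S (r \<otimes> a) s"
proof -
  have "(\<Union>(b, t)\<in>fraction R S a s. fraction R S (r \<otimes> b) t) = fraction R S (r \<otimes> a) s"
  proof (rule fraction_Union[OF assms(2,3)])
    fix b t u assume bt: "b \<in> carrier R" "t \<in> S" "u \<in> S" "u \<otimes> (t \<otimes> a) = u \<otimes> (s \<otimes> b)"
    have "u \<otimes> (s \<otimes> (r \<otimes> b)) = r \<otimes> (u \<otimes> (s \<otimes> b))"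
      using assms bt(1-3) by (simp add: m_ac)
    also have "\<dots> = r \<otimes> (u \<otimes> (t \<otimes> a))" using bt(4) by simp
    also have "\<dots> = u \<otimes> (t \<otimes> (r \<otimes> a))" using assms bt(1-3) by (simp add: m_ac)
    finally show "fraction R S (r \<otimes> b) t = fraction R S (r \<otimes> a) s"
      using assms bt(1-3) by (intro fraction_eqI[where u = u]) auto
  qed
  then show ?thesis by (simp add: localization_def)
qed

lemma fraction_add:
  assumes a: "a \<in> carrier R" "s \<in> S" and b: "b \<in> carrier R" "t \<in> S"
  shows "fraction R S a s \<oplus>\<^bsub>localization R S\<^esub> fraction R S b t = fraction R S (t \<otimes> a \<oplus> s \<otimes> b) (s \<otimes> t)"
proof -
  have wd: "fraction R S (t' \<otimes> a' \<oplus> s' \<otimes> b') (s' \<otimes> t') = fraction R S (t \<otimes> a \<oplus> s \<otimes> b) (s \<otimes> t)"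
    if a': "a' \<in> carrier R" "s' \<in> S" and u: "u \<in> S" "u \<otimes> (s' \<otimes> a) = u \<otimes> (s \<otimes> a')"
      and b': "b' \<in> carrier R" "t' \<in> S" and w: "w \<in> S" "w \<otimes> (t' \<otimes> b) = w \<otimes> (t \<otimes> b')" for a' s' u b' t' w
  proof (rule fraction_eqI[where u = "u \<otimes> w"])
    have "(u \<otimes> w) \<otimes> ((s \<otimes> t) \<otimes> (t' \<otimes> a' \<oplus> s' \<otimes> b'))
        = (w \<otimes> t \<otimes> t') \<otimes> (u \<otimes> (s \<otimes> a')) \<oplus> (u \<otimes> s \<otimes> s') \<otimes> (w \<otimes> (t \<otimes> b'))"
      using a b a' b' u(1) w(1) by (simp add: r_distr m_ac)
    also have "\<dots> = (w \<otimes> t \<otimes> t') \<otimes> (u \<otimes> (s' \<otimes> a)) \<oplus> (u \<otimes> s \<otimes> s') \<otimes> (w \<otimes> (t' \<otimes> b))"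
      using u(2) w(2) by simp
    also have "\<dots> = (u \<otimes> w) \<otimes> ((s' \<otimes> t') \<otimes> (t \<otimes> a \<oplus> s \<otimes> b))"
      using a b a' b' u(1) w(1) by (simp add: r_distr m_ac)
    finally show "(u \<otimes> w) \<otimes> ((s \<otimes> t) \<otimes> (t' \<otimes> a' \<oplus> s' \<otimes> b')) = (u \<otimes> w) \<otimes> ((s' \<otimes> t') \<otimes> (t \<otimes> a \<oplus> s \<otimes> b))" .
  qed (use a b a' b' u w mult_denom in auto)
  have "(\<Union>(a', s')\<in>fraction R S a s. \<Union>(b', t')\<in>fraction R S b t.
           fraction R S (t' \<otimes> a' \<oplus> s' \<otimes> b') (s' \<otimes> t')) = fraction R S (t \<otimes> a \<oplus> s \<otimes> b) (s \<otimes> t)"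
  proof -
    have inner: "(\<Union>(b', t')\<in>fraction R S b t. fraction R S (t' \<otimes> a' \<oplus> s' \<otimes> b') (s' \<otimes> t'))
        = fraction R S (t \<otimes> a \<oplus> s \<otimes> b) (s \<otimes> t)"
      if a': "a' \<in> carrier R" "s' \<in> S" and u: "u \<in> S" "u \<otimes> (s' \<otimes> a) = u \<otimes> (s \<otimes> a')" for a' s' u
    proof -
      have "(\<Union>(b', t')\<in>fraction R S b t. fraction R S (t' \<otimes> a' \<oplus> s' \<otimes> b') (s' \<otimes> t'))
          = fraction R S (t \<otimes> a' \<oplus> s' \<otimes> b) (s' \<otimes> t)"
      proof (rule fraction_Union[OF b])
        fix b' t' w assume b': "b' \<in> carrier R" "t' \<in> S" "w \<in> S" "w \<otimes> (t' \<otimes> b) = w \<otimes> (t \<otimes> b')"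
        show "fraction R S (t' \<otimes> a' \<oplus> s' \<otimes> b') (s' \<otimes> t') = fraction R S (t \<otimes> a' \<oplus> s' \<otimes> b) (s' \<otimes> t)"
          using wd[OF a' u b'] wd[OF a' u b one_denom refl] by simp
      qed
      then show ?thesis using wd[OF a' u b one_denom refl] by simp
    qed
    show ?thesis
      using inner[OF a one_denom refl] inner by (subst fraction_Union[OF a]) auto
  qed
  then show ?thesis by (simp add: localization_def)
qed

lemma fraction_add_same:
  assumes "a \<in> carrier R" "b \<in> carrier R" "s \<in> S"
  shows "fraction R S a s \<oplus>\<^bsub>localization R S\<^esub> fraction R S b s = fraction R S (a \<oplus> b) s"
proof -
  have "fraction R S (s \<otimes> a \<oplus> s \<otimes> b) (s \<otimes> s) = fraction R S (a \<oplus> b) s"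
    using assms one_denom mult_denom
    by (intro fraction_eqI[where u = \<one>]) (auto simp: r_distr m_ac)
  then show ?thesis using fraction_add[of a s b s] assms by simp
qed

lemma fraction_mult:
  assumes a: "a \<in> carrier R" "s \<in> S" and b: "b \<in> carrier R" "t \<in> S"
  shows "fraction R S a s \<otimes>\<^bsub>localization R S\<^esub> fraction R S b t = fraction R S (a \<otimes> b) (s \<otimes> t)"
proof -
  have wd: "fraction R S (a' \<otimes> b') (s' \<otimes> t') = fraction R S (a \<otimes> b) (s \<otimes> t)"
    if a': "a' \<in> carrier R" "s' \<in> S" and u: "u \<in> S" "u \<otimes> (s' \<otimes> a) = u \<otimes> (s \<otimes> a')"
      and b': "b' \<in> carrier R" "t' \<in> S" and w: "w \<in> S" "w \<otimes> (t' \<otimes> b) = w \<otimes> (t \<otimes> b')" for a' s' u b' t' w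
  proof (rule fraction_eqI[where u = "u \<otimes> w"])
    have "(u \<otimes> w) \<otimes> ((s \<otimes> t) \<otimes> (a' \<otimes> b')) = (u \<otimes> (s \<otimes> a')) \<otimes> (w \<otimes> (t \<otimes> b'))"
      using a b a' b' u(1) w(1) by (simp add: m_ac)
    also have "\<dots> = (u \<otimes> (s' \<otimes> a)) \<otimes> (w \<otimes> (t' \<otimes> b))"
      using u(2) w(2) by simp
    also have "\<dots> = (u \<otimes> w) \<otimes> ((s' \<otimes> t') \<otimes> (a \<otimes> b))"
      using a b a' b' u(1) w(1) by (simp add: m_ac)
    finally show "(u \<otimes> w) \<otimes> ((s \<otimes> t) \<otimes> (a' \<otimes> b')) = (u \<otimes> w) \<otimes> ((s' \<otimes> t') \<otimes> (a \<otimes> b))" .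
  qed (use a b a' b' u w mult_denom in auto)
  have inner: "(\<Union>(b', t')\<in>fraction R S b t. fraction R S (a' \<otimes> b') (s' \<otimes> t'))
      = fraction R S (a \<otimes> b) (s \<otimes> t)"
    if a': "a' \<in> carrier R" "s' \<in> S" and u: "u \<in> S" "u \<otimes> (s' \<otimes> a) = u \<otimes> (s \<otimes> a')" for a' s' u
  proof -
    have "(\<Union>(b', t')\<in>fraction R S b t. fraction R S (a' \<otimes> b') (s' \<otimes> t'))
        = fraction R S (a' \<otimes> b) (s' \<otimes> t)"
    proof (rule fraction_Union[OF b])
      fix b' t' w assume b': "b' \<in> carrier R" "t' \<in> S" "w \<in> S" "w \<otimes> (t' \<otimes> b) = w \<otimes> (t \<otimes> b')"
      show "fraction R S (a' \<otimes> b') (s' \<otimes> t') = fraction R S (a' \<otimes> b) (s' \<otimes> t)"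
        using wd[OF a' u b'] wd[OF a' u b one_denom refl] by simp
    qed
    then show ?thesis using wd[OF a' u b one_denom refl] by simp
  qed
  have "(\<Union>(a', s')\<in>fraction R S a s. \<Union>(b', t')\<in>fraction R S b t. fraction R S (a' \<otimes> b') (s' \<otimes> t'))
      = fraction R S (a \<otimes> b) (s \<otimes> t)"
    using inner[OF a one_denom refl] inner by (subst fraction_Union[OF a]) auto
  then show ?thesis by (simp add: localization_def)
qed

lemma pow_denom: "s \<in> S \<Longrightarrow> s [^] (n::nat) \<in> S"
  by (induction n) (auto simp: one_denom mult_denom)

lemma fraction_pow:
  assumes "a \<in> carrier R" "s \<in> S"
  shows "fraction R S a s [^]\<^bsub>localization R S\<^esub> (n::nat) = fraction R S (a [^] n) (s [^] n)"
proof (induction n)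
  case 0
  show ?case by (simp add: localization_def)
next
  case (Suc n)
  then show ?case
    using assms fraction_mult[of "a [^] n" "s [^] n" a s] pow_denom by simp
qed

lemma localization_module: "module R (localization R S)"
proof (rule moduleI)
  show "cring R" by (rule is_cring)
  let ?L = "localization R S"
  show "abelian_group ?L"
  proof (rule abelian_groupI)
    fix x y assume x: "x \<in> carrier ?L" and y: "y \<in> carrier ?L"
    from x obtain a s where a: "a \<in> carrier R" "s \<in> S" "x = fraction R S a s" by (rule localization_cases)
    from y obtain b t where b: "b \<in> carrier R" "t \<in> S" "y = fraction R S b t" by (rule localization_cases)
    show "x \<oplus>\<^bsub>?L\<^esub> y \<in> carrier ?L"
      using a b mult_denom by (auto simp: fraction_add)
    show "x \<oplus>\<^bsub>?L\<^esub> y = y \<oplus>\<^bsub>?L\<^esub> x"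
      using a b by (simp add: fraction_add a_comm m_comm)
    fix z assume "z \<in> carrier ?L"
    then obtain c r where c: "c \<in> carrier R" "r \<in> S" "z = fraction R S c r" by (rule localization_cases)
    show "x \<oplus>\<^bsub>?L\<^esub> y \<oplus>\<^bsub>?L\<^esub> z = x \<oplus>\<^bsub>?L\<^esub> (y \<oplus>\<^bsub>?L\<^esub> z)"
      using a b c mult_denom by (simp add: fraction_add r_distr l_distr m_ac a_ac)
  next
    show "\<zero>\<^bsub>?L\<^esub> \<in> carrier ?L" using one_denom by (auto simp: localization_zero)
  next
    fix x assume "x \<in> carrier ?L"
    then obtain a s where a: "a \<in> carrier R" "s \<in> S" "x = fraction R S a s" by (rule localization_cases)
    show "\<zero>\<^bsub>?L\<^esub> \<oplus>\<^bsub>?L\<^esub> x = x"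
      using a one_denom by (simp add: localization_zero fraction_add)
    have "fraction R S (\<ominus> a) s \<oplus>\<^bsub>?L\<^esub> x = \<zero>\<^bsub>?L\<^esub>"
      using a by (simp add: fraction_add_same l_neg fraction_zero)
    then show "\<exists>y\<in>carrier ?L. y \<oplus>\<^bsub>?L\<^esub> x = \<zero>\<^bsub>?L\<^esub>"
      using a by (intro bexI[of _ "fraction R S (\<ominus> a) s"]) auto
  qed
  fix x assume x: "x \<in> carrier ?L"
  then obtain a s where a: "a \<in> carrier R" "s \<in> S" "x = fraction R S a s" by (rule localization_cases)
  show "\<one> \<odot>\<^bsub>?L\<^esub> x = x" using a by (simp add: fraction_smult)
  fix r assume r: "r \<in> carrier R"
  show "r \<odot>\<^bsub>?L\<^esub> x \<in> carrier ?L" using a r by (auto simp: fraction_smult)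
  show "r \<odot>\<^bsub>?L\<^esub> (x \<oplus>\<^bsub>?L\<^esub> y) = r \<odot>\<^bsub>?L\<^esub> x \<oplus>\<^bsub>?L\<^esub> r \<odot>\<^bsub>?L\<^esub> y" if y: "y \<in> carrier ?L" for y
  proof -
    from y obtain b t where b: "b \<in> carrier R" "t \<in> S" "y = fraction R S b t" by (rule localization_cases)
    show ?thesis using a b r mult_denom by (simp add: fraction_add fraction_smult r_distr m_ac)
  qed
  fix r' assume r': "r' \<in> carrier R"
  show "(r \<oplus> r') \<odot>\<^bsub>?L\<^esub> x = r \<odot>\<^bsub>?L\<^esub> x \<oplus>\<^bsub>?L\<^esub> r' \<odot>\<^bsub>?L\<^esub> x"
    using a r r' by (simp add: fraction_smult fraction_add_same l_distr)
  show "(r \<otimes> r') \<odot>\<^bsub>?L\<^esub> x = r \<odot>\<^bsub>?L\<^esub> (r' \<odot>\<^bsub>?L\<^esub> x)"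
    using a r r' by (simp add: fraction_smult m_assoc)
qed

end

lemma (in cring) mult_closure_denominators:
  assumes "A \<subseteq> carrier R"
  shows "denominators R (mult_closure R A)"
proof (unfold_locales)
  have carr: "s \<in> carrier R" if "s \<in> mult_closure R A" for s
    using that by induction (use assms in auto)
  then show "mult_closure R A \<subseteq> carrier R" by auto
  show "\<one> \<in> mult_closure R A" by (rule mult_closure.one)
  fix s t assume s: "s \<in> mult_closure R A" and t: "t \<in> mult_closure R A"
  from s show "s \<otimes> t \<in> mult_closure R A"
  proof induction
    case one
    then show ?case using t carr by simp
  next
    case (step a s)
    then have "a \<in> carrier R" "s \<in> carrier R" "t \<in> carrier R" using assms carr t by auto
    then show ?case using mult_closure.step[OF step(1,3)] by (simp add: m_assoc)
  qed
qed

lemma mult_closure_mono: "A \<subseteq> B \<Longrightarrow> s \<in> mult_closure R A \<Longrightarrow> s \<in> mult_closure R B"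
  by (rotate_tac, induction rule: mult_closure.induct) (auto intro: mult_closure.intros)

text \<open>Monomials in \<open>x\<close> and the elements of \<open>A\<close> can be sorted by powers of \<open>x\<close>. This is what makes
  the kernel and the cokernel of a further localization torsion with respect to \<open>x\<close>.\<close>

lemma (in cring) mult_closure_insert:
  assumes "A \<subseteq> carrier R" "x \<in> carrier R" "s \<in> mult_closure R (insert x A)"
  shows "\<exists>k::nat. \<exists>t\<in>mult_closure R A. s = x [^] k \<otimes> t"
proof -
  interpret A: denominators R "mult_closure R A" by (rule mult_closure_denominators[OF assms(1)])
  from assms(3) show ?thesis
  proof induction
    case one
    show ?case using A.one_denom by (intro exI[of _ 0] bexI[of _ \<one>]) auto
  next
    case (step a s)
    then obtain k :: nat and t where t: "t \<in> mult_closure R A" "s = x [^] k \<otimes> t" by blast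
    show ?case
    proof (cases "a = x")
      case True
      then have "a \<otimes> s = x [^] Suc k \<otimes> t" using t assms(2) by (simp add: m_ac)
      then show ?thesis using t by blast
    next
      case False
      then have a: "a \<in> A" using step by auto
      then have "a \<otimes> s = x [^] k \<otimes> (a \<otimes> t)" using t assms(1,2) by (auto simp: m_ac)
      then show ?thesis using mult_closure.step[OF a t(1)] by blast
    qed
  qed
qed

locale cech_complex = cring R for R :: "('a, 'b) ring_scheme" (structure) +
  fixes fs :: "'a list"
  assumes fs_closed: "set fs \<subseteq> carrier R"
begin

lemma denoms_image: "S \<subseteq> {..<length fs} \<Longrightarrow> (!) fs ` S \<subseteq> carrier R"
  using fs_closed nth_mem by fastforce

lemma cech_denominators: "S \<subseteq> {..<length fs} \<Longrightarrow> denominators R (cech_denoms R fs S)"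
  unfolding cech_denoms_def by (intro mult_closure_denominators denoms_image)

lemma cech_denoms_mono: "S \<subseteq> T \<Longrightarrow> s \<in> cech_denoms R fs S \<Longrightarrow> s \<in> cech_denoms R fs T"
  unfolding cech_denoms_def using mult_closure_mono[of "(!) fs ` S" "(!) fs ` T" s R] by auto

lemma cech_denoms_generator:
  assumes "S \<subseteq> {..<length fs}" "v \<in> S"
  shows "fs ! v \<in> cech_denoms R fs S"
proof -
  have "fs ! v \<otimes> \<one> \<in> cech_denoms R fs S"
    unfolding cech_denoms_def using assms by (intro mult_closure.intros) auto
  then show ?thesis using denoms_image[OF assms(1)] assms(2) by auto
qed

lemma cech_restriction_fraction:
  assumes ST: "S \<subseteq> T" "T \<subseteq> {..<length fs}" and a: "a \<in> carrier R" "s \<in> cech_denoms R fs S"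
  shows "cech_restriction R fs T (fraction R (cech_denoms R fs S) a s) = fraction R (cech_denoms R fs T) a s"
proof -
  interpret S: denominators R "cech_denoms R fs S" using ST by (intro cech_denominators) auto
  interpret T: denominators R "cech_denoms R fs T" using ST by (intro cech_denominators) auto
  show ?thesis
    unfolding cech_restriction_def
  proof (rule S.fraction_Union[OF a])
    fix b t u assume "b \<in> carrier R" "t \<in> cech_denoms R fs S" "u \<in> cech_denoms R fs S"
      "u \<otimes> (t \<otimes> a) = u \<otimes> (s \<otimes> b)"
    then show "fraction R (cech_denoms R fs T) b t = fraction R (cech_denoms R fs T) a s"
      using a cech_denoms_mono[OF ST(1)] by (intro T.fraction_eqI[where u = u]) auto
  qed
qed

lemma cech_ring_cases:
  assumes "S \<subseteq> {..<length fs}" "x \<in> carrier (cech_ring R fs S)"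
  obtains a s where "a \<in> carrier R" "s \<in> cech_denoms R fs S" "x = fraction R (cech_denoms R fs S) a s"
  using denominators.localization_cases[OF cech_denominators[OF assms(1)]] assms(2)
  unfolding cech_ring_def by blast

sublocale cube: localization_cube R "length fs" "(!) fs" "cech_ring R fs" "cech_restriction R fs"
proof (rule localization_cube.intro[OF is_cring], rule localization_cube_axioms.intro)
  show "fs ! v \<in> carrier R" if "v < length fs" for v
    using that fs_closed by auto
  show "module R (cech_ring R fs S)" if "S \<subseteq> {..<length fs}" for S
    unfolding cech_ring_def by (rule denominators.localization_module[OF cech_denominators[OF that]])
  show "cech_restriction R fs T \<in> Hom_module R (cech_ring R fs S) (cech_ring R fs T)"
    if ST: "S \<subseteq> T" "T \<subseteq> {..<length fs}" for S T
  proof -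
    have S': "S \<subseteq> {..<length fs}" using ST by auto
    interpret S: denominators R "cech_denoms R fs S" by (rule cech_denominators[OF S'])
    interpret T: denominators R "cech_denoms R fs T" by (rule cech_denominators[OF ST(2)])
    note res = cech_restriction_fraction[OF ST] and mono = cech_denoms_mono[OF ST(1)]
    show ?thesis
      unfolding Hom_module_def
    proof (intro CollectI conjI ballI Pi_I)
      fix x assume "x \<in> carrier (cech_ring R fs S)"
      then obtain a s where a: "a \<in> carrier R" "s \<in> cech_denoms R fs S"
        "x = fraction R (cech_denoms R fs S) a s" by (rule cech_ring_cases[OF S'])
      show "cech_restriction R fs T x \<in> carrier (cech_ring R fs T)"
        unfolding cech_ring_def using a res mono by auto
      fix y assume "y \<in> carrier (cech_ring R fs S)"
      then obtain b t where b: "b \<in> carrier R" "t \<in> cech_denoms R fs S"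
        "y = fraction R (cech_denoms R fs S) b t" by (rule cech_ring_cases[OF S'])
      show "cech_restriction R fs T (x \<oplus>\<^bsub>cech_ring R fs S\<^esub> y) =
        cech_restriction R fs T x \<oplus>\<^bsub>cech_ring R fs T\<^esub> cech_restriction R fs T y"
        unfolding cech_ring_def using a b mono by (simp add: res S.fraction_add T.fraction_add S.mult_denom)
    next
      fix r x assume r: "r \<in> carrier R" and "x \<in> carrier (cech_ring R fs S)"
      then obtain a s where a: "a \<in> carrier R" "s \<in> cech_denoms R fs S"
        "x = fraction R (cech_denoms R fs S) a s" by (auto elim: cech_ring_cases[OF S'])
      show "cech_restriction R fs T (r \<odot>\<^bsub>cech_ring R fs S\<^esub> x) = r \<odot>\<^bsub>cech_ring R fs T\<^esub> cech_restriction R fs T x"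
        unfolding cech_ring_def using a r mono by (simp add: res S.fraction_smult T.fraction_smult)
    qed
  qed
  show "cech_restriction R fs S x = x"
    if S: "S \<subseteq> {..<length fs}" and x: "x \<in> carrier (cech_ring R fs S)" for S x
    using x cech_restriction_fraction[OF subset_refl S] by (auto elim: cech_ring_cases[OF S])
  show "cech_restriction R fs U (cech_restriction R fs T x) = cech_restriction R fs U x"
    if ST: "S \<subseteq> T" "T \<subseteq> U" "U \<subseteq> {..<length fs}" and x: "x \<in> carrier (cech_ring R fs S)" for S T U x
  proof -
    have S: "S \<subseteq> {..<length fs}" "S \<subseteq> U" "T \<subseteq> {..<length fs}" using ST by auto
    from x obtain a s where a: "a \<in> carrier R" "s \<in> cech_denoms R fs S"
      "x = fraction R (cech_denoms R fs S) a s" by (rule cech_ring_cases[OF S(1)])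
    show ?thesis
      using a cech_denoms_mono[OF ST(1)]
      by (simp add: cech_restriction_fraction[OF S(2) ST(3)] cech_restriction_fraction[OF ST(1) S(3)]
          cech_restriction_fraction[OF ST(2,3)])
  qed
  show "\<exists>k::nat. (fs ! v [^] k) \<odot>\<^bsub>cech_ring R fs S\<^esub> x = \<zero>\<^bsub>cech_ring R fs S\<^esub>"
    if v: "v < length fs" and S: "S \<subseteq> {..<length fs}" and x: "x \<in> carrier (cech_ring R fs S)"
      and 0: "cech_restriction R fs (insert v S) x = \<zero>\<^bsub>cech_ring R fs (insert v S)\<^esub>" for v S x
  proof -
    have T: "insert v S \<subseteq> {..<length fs}" "S \<subseteq> insert v S" using v S by auto
    interpret S: denominators R "cech_denoms R fs S" by (rule cech_denominators[OF S])
    interpret T: denominators R "cech_denoms R fs (insert v S)" by (rule cech_denominators[OF T(1)])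
    have fv: "fs ! v \<in> carrier R" using v fs_closed by auto
    from x obtain a s where a: "a \<in> carrier R" "s \<in> cech_denoms R fs S"
      "x = fraction R (cech_denoms R fs S) a s" by (rule cech_ring_cases[OF S])
    have "\<exists>u\<in>cech_denoms R fs (insert v S). u \<otimes> a = \<zero>"
      using 0 a cech_restriction_fraction[OF T(2,1)] T.fraction_eq_zero_iff cech_denoms_mono[OF T(2)]
      by (simp add: cech_ring_def)
    then obtain u where u: "u \<in> cech_denoms R fs (insert v S)" "u \<otimes> a = \<zero>" by blast
    obtain k :: nat and t where kt: "t \<in> cech_denoms R fs S" "u = fs ! v [^] k \<otimes> t"
      using mult_closure_insert[OF denoms_image[OF S] fv, of u] u(1) unfolding cech_denoms_def by auto
    have "t \<otimes> (fs ! v [^] k \<otimes> a) = \<zero>"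
      using u(2) kt a fv by (simp add: m_ac)
    then have "(fs ! v [^] k) \<odot>\<^bsub>cech_ring R fs S\<^esub> x = \<zero>\<^bsub>cech_ring R fs S\<^esub>"
      unfolding cech_ring_def using a fv kt(1) by (auto simp: S.fraction_smult S.fraction_eq_zero_iff)
    then show ?thesis ..
  qed
  show "\<exists>k::nat. \<exists>x\<in>carrier (cech_ring R fs S).
       cech_restriction R fs (insert v S) x = (fs ! v [^] k) \<odot>\<^bsub>cech_ring R fs (insert v S)\<^esub> y"
    if v: "v < length fs" and S: "S \<subseteq> {..<length fs}" and y: "y \<in> carrier (cech_ring R fs (insert v S))" for v S y
  proof -
    have T: "insert v S \<subseteq> {..<length fs}" "S \<subseteq> insert v S" using v S by auto
    interpret S: denominators R "cech_denoms R fs S" by (rule cech_denominators[OF S])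
    interpret T: denominators R "cech_denoms R fs (insert v S)" by (rule cech_denominators[OF T(1)])
    have fv: "fs ! v \<in> carrier R" using v fs_closed by auto
    from y obtain a s where a: "a \<in> carrier R" "s \<in> cech_denoms R fs (insert v S)"
      "y = fraction R (cech_denoms R fs (insert v S)) a s" by (rule cech_ring_cases[OF T(1)])
    obtain k :: nat and t where kt: "t \<in> cech_denoms R fs S" "s = fs ! v [^] k \<otimes> t"
      using mult_closure_insert[OF denoms_image[OF S] fv, of s] a(2) unfolding cech_denoms_def by auto
    have "fraction R (cech_denoms R fs (insert v S)) (fs ! v [^] k \<otimes> a) s
        = fraction R (cech_denoms R fs (insert v S)) a t"
      using a kt fv cech_denoms_mono[OF T(2)] T.one_denom
      by (intro T.fraction_eqI[where u = \<one>]) (auto simp: m_ac)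
    then have "cech_restriction R fs (insert v S) (fraction R (cech_denoms R fs S) a t)
        = (fs ! v [^] k) \<odot>\<^bsub>cech_ring R fs (insert v S)\<^esub> y"
      using a kt fv cech_restriction_fraction[OF T(2,1)] by (simp add: cech_ring_def T.fraction_smult)
    moreover have "fraction R (cech_denoms R fs S) a t \<in> carrier (cech_ring R fs S)"
      unfolding cech_ring_def using a kt by auto
    ultimately show ?thesis by blast
  qed
  show "bij_betw (\<lambda>x. fs ! v \<odot>\<^bsub>cech_ring R fs S\<^esub> x) (carrier (cech_ring R fs S)) (carrier (cech_ring R fs S))"
    if S: "S \<subseteq> {..<length fs}" and v: "v \<in> S" for S v
  proof -
    interpret S: denominators R "cech_denoms R fs S" by (rule cech_denominators[OF S])
    have fv: "fs ! v \<in> cech_denoms R fs S" by (rule cech_denoms_generator[OF S v])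
    show ?thesis
      unfolding bij_betw_def
    proof (intro conjI)
      show "inj_on (\<lambda>x. fs ! v \<odot>\<^bsub>cech_ring R fs S\<^esub> x) (carrier (cech_ring R fs S))"
      proof (rule inj_onI)
        fix x y assume x: "x \<in> carrier (cech_ring R fs S)" and y: "y \<in> carrier (cech_ring R fs S)"
          and eq: "fs ! v \<odot>\<^bsub>cech_ring R fs S\<^esub> x = fs ! v \<odot>\<^bsub>cech_ring R fs S\<^esub> y"
        from x obtain a s where a: "a \<in> carrier R" "s \<in> cech_denoms R fs S"
          "x = fraction R (cech_denoms R fs S) a s" by (rule cech_ring_cases[OF S])
        from y obtain b t where b: "b \<in> carrier R" "t \<in> cech_denoms R fs S"
          "y = fraction R (cech_denoms R fs S) b t" by (rule cech_ring_cases[OF S])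
        have "fraction R (cech_denoms R fs S) (fs ! v \<otimes> a) s = fraction R (cech_denoms R fs S) (fs ! v \<otimes> b) t"
          using eq a b fv by (simp add: cech_ring_def S.fraction_smult)
        then obtain u where u: "u \<in> cech_denoms R fs S"
          "u \<otimes> (t \<otimes> (fs ! v \<otimes> a)) = u \<otimes> (s \<otimes> (fs ! v \<otimes> b))"
          using a b fv S.fraction_eq_iff by auto
        show "x = y"
          unfolding a(3) b(3)
          by (rule S.fraction_eqI[where u = "u \<otimes> fs ! v"])
             (use a b fv u S.mult_denom in \<open>auto simp: m_ac\<close>)
      qed
      show "(\<lambda>x. fs ! v \<odot>\<^bsub>cech_ring R fs S\<^esub> x) ` carrier (cech_ring R fs S) = carrier (cech_ring R fs S)"
      proof (rule equalityI; rule subsetI)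
        fix y assume "y \<in> carrier (cech_ring R fs S)"
        then obtain b t where b: "b \<in> carrier R" "t \<in> cech_denoms R fs S"
          "y = fraction R (cech_denoms R fs S) b t" by (rule cech_ring_cases[OF S])
        have "fraction R (cech_denoms R fs S) (fs ! v \<otimes> b) (fs ! v \<otimes> t) = y"
          unfolding b(3) using b fv S.mult_denom S.one_denom
          by (intro S.fraction_eqI[where u = \<one>]) (auto simp: m_ac)
        then have "y = fs ! v \<odot>\<^bsub>cech_ring R fs S\<^esub> fraction R (cech_denoms R fs S) b (fs ! v \<otimes> t)"
          using b fv S.mult_denom by (simp add: cech_ring_def S.fraction_smult)
        moreover have "fraction R (cech_denoms R fs S) b (fs ! v \<otimes> t) \<in> carrier (cech_ring R fs S)"
          unfolding cech_ring_def using b fv S.mult_denom by auto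
        ultimately show "y \<in> (\<lambda>x. fs ! v \<odot>\<^bsub>cech_ring R fs S\<^esub> x) ` carrier (cech_ring R fs S)"
          by blast
      next
        fix y assume "y \<in> (\<lambda>x. fs ! v \<odot>\<^bsub>cech_ring R fs S\<^esub> x) ` carrier (cech_ring R fs S)"
        then show "y \<in> carrier (cech_ring R fs S)"
          unfolding cech_ring_def using module.smult_closed[OF S.localization_module] fv by auto
      qed
    qed
  qed
qed

text \<open>Over the empty face the only denominator is \<open>1\<close>, so that \<open>cech_ring R fs {}\<close> is a copy of \<open>R\<close> and its
  submodules correspond to ideals.\<close>

lemma cech_ring_empty_noetherian:
  assumes "noetherian_ring R" and P: "submodule P R (cech_ring R fs {})"
  shows "\<exists>A\<subseteq>P. finite A \<and> (\<forall>P'. submodule P' R (cech_ring R fs {}) \<longrightarrow> A \<subseteq> P' \<longrightarrow> P \<subseteq> P')"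
proof -
  interpret N: noetherian_ring R by fact
  let ?D = "cech_denoms R fs {}"
  interpret D: denominators R ?D by (rule cech_denominators) auto
  interpret Q: module R "cech_ring R fs {}"
    unfolding cech_ring_def by (rule D.localization_module)
  have D1: "s = \<one>" if "s \<in> ?D" for s
    using that unfolding cech_denoms_def by (auto elim: mult_closure.cases)
  define I where "I P = {a \<in> carrier R. fraction R ?D a \<one> \<in> P}" for P
  have I: "ideal (I P) R" if P: "submodule P R (cech_ring R fs {})" for P
  proof (rule idealI[OF ring_axioms])
    have neg: "fraction R ?D (\<ominus> a) \<one> = \<ominus>\<^bsub>cech_ring R fs {}\<^esub> fraction R ?D a \<one>" if "a \<in> carrier R" for a
    proof -
      have "fraction R ?D a \<one> \<in> carrier (cech_ring R fs {})"
        using that D.one_denom by (auto simp: cech_ring_def)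
      then show ?thesis
        using that D.one_denom Q.smult_l_minus[of \<one> "fraction R ?D a \<one>"] D.fraction_smult[of "\<ominus> \<one>" a \<one>]
          Q.smult_one[of "fraction R ?D a \<one>"]
        by (simp add: cech_ring_def l_minus)
    qed
    show "subgroup (I P) (add_monoid R)"
    proof (rule add.subgroupI)
      show "I P \<noteq> {}"
        using Q.submodule_zero[OF P] unfolding I_def cech_ring_def D.localization_zero by auto
      show "\<ominus> a \<in> I P" if "a \<in> I P" for a
        using that Q.submoduleE(3)[OF P] neg by (auto simp: I_def)
      show "a \<oplus> b \<in> I P" if "a \<in> I P" "b \<in> I P" for a b
        using that Q.submoduleE(5)[OF P, of "fraction R ?D a \<one>" "fraction R ?D b \<one>"] D.one_denom
        by (auto simp: I_def cech_ring_def D.fraction_add_same)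
    qed (auto simp: I_def)
    fix a x assume a: "a \<in> I P" and x: "x \<in> carrier R"
    then have "fraction R ?D (x \<otimes> a) \<one> \<in> P"
      using Q.submoduleE(4)[OF P x, of "fraction R ?D a \<one>"] D.one_denom
      by (auto simp: I_def cech_ring_def D.fraction_smult)
    then show "x \<otimes> a \<in> I P" "a \<otimes> x \<in> I P"
      using a x by (auto simp: I_def m_comm)
  qed
  obtain A where A: "A \<subseteq> carrier R" "finite A" "I P = Idl A"
    using N.finetely_gen[OF I[OF P]] by blast
  have "P \<subseteq> P'" if P': "submodule P' R (cech_ring R fs {})" and AP: "(\<lambda>a. fraction R ?D a \<one>) ` A \<subseteq> P'" for P'
  proof
    fix x assume x: "x \<in> P"
    then obtain a s where a: "a \<in> carrier R" "s \<in> ?D" "x = fraction R ?D a s"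
      using cech_ring_cases[of "{}" x] Q.submodule_carrier[OF P x] by auto
    have "A \<subseteq> I P'" using AP A(1) by (auto simp: I_def)
    then have "I P \<subseteq> I P'" unfolding A(3) by (rule genideal_minimal[OF I[OF P']])
    then show "x \<in> P'" using x a D1 by (auto simp: I_def)
  qed
  moreover have "(\<lambda>a. fraction R ?D a \<one>) ` A \<subseteq> P"
    using genideal_self[OF A(1)] A(3) by (auto simp: I_def)
  ultimately show ?thesis using A(2) by blast
qed

end

section \<open>Additivity of the Frobenius\<close>

lemma (in abelian_group) a_inv_zero: "\<ominus> \<zero> = \<zero>"
  by (rule minus_equality) auto

context cring
begin

lemma binomial_expansion:
  assumes a: "a \<in> carrier R" and b: "b \<in> carrier R"
  shows "(a \<oplus> b) [^] (m::nat) = (\<Oplus>k\<in>{..m}. add_pow R (m choose k) (a [^] k \<otimes> b [^] (m - k)))"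
proof (induction m)
  case 0
  show ?case using a b by simp
next
  case (Suc m)
  define t where "t k = a [^] k \<otimes> b [^] (Suc m - k)" for k
  have t: "t k \<in> carrier R" for k using a b by (simp add: t_def)
  have tc: "add_pow R (j::nat) (t k) \<in> carrier R" for j k
    using t add.nat_pow_closed by blast
  have "(a \<oplus> b) [^] Suc m = (\<Oplus>k\<in>{..m}. add_pow R (m choose k) (a [^] k \<otimes> b [^] (m - k))) \<otimes> (a \<oplus> b)"
    using Suc by simp
  also have "\<dots> = (\<Oplus>k\<in>{..m}. add_pow R (m choose k) (a [^] k \<otimes> b [^] (m - k))) \<otimes> a
      \<oplus> (\<Oplus>k\<in>{..m}. add_pow R (m choose k) (a [^] k \<otimes> b [^] (m - k))) \<otimes> b"
    using a b by (intro r_distr finsum_closed) (auto simp: add.nat_pow_closed)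
  also have "(\<Oplus>k\<in>{..m}. add_pow R (m choose k) (a [^] k \<otimes> b [^] (m - k))) \<otimes> a
      = (\<Oplus>k\<in>{..m}. add_pow R (m choose k) (t (Suc k)))"
  proof -
    have "add_pow R (m choose k) (a [^] k \<otimes> b [^] (m - k)) \<otimes> a = add_pow R (m choose k) (t (Suc k))" for k
    proof -
      have "(a [^] k \<otimes> b [^] (m - k)) \<otimes> a = t (Suc k)" using a b by (simp add: t_def m_ac)
      then show ?thesis using add_pow_ldistr[of "a [^] k \<otimes> b [^] (m - k)" a] a b by simp
    qed
    then show ?thesis
      using a b by (subst finsum_ldistr) (auto simp: add.nat_pow_closed)
  qed
  also have "(\<Oplus>k\<in>{..m}. add_pow R (m choose k) (a [^] k \<otimes> b [^] (m - k))) \<otimes> b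
      = (\<Oplus>k\<in>{..m}. add_pow R (m choose k) (t k))"
    using a b by (subst finsum_ldistr)
      (auto simp: t_def add.nat_pow_closed add_pow_ldistr m_assoc Suc_diff_le intro!: finsum_cong')
  also have "\<dots> = (\<Oplus>k\<in>{..Suc m}. add_pow R (m choose k) (t k))"
    using finsum_Suc[of "\<lambda>k. add_pow R (m choose k) (t k)" m]
    by (simp add: binomial_eq_0 finsum_closed tc)
  also have "\<dots> = (\<Oplus>k\<in>{..m}. add_pow R (m choose Suc k) (t (Suc k))) \<oplus> t 0"
    using finsum_Suc2[of "\<lambda>k. add_pow R (m choose k) (t k)" m] t[of 0] tc by simp
  also have "(\<Oplus>k\<in>{..m}. add_pow R (m choose k) (t (Suc k)))
      \<oplus> ((\<Oplus>k\<in>{..m}. add_pow R (m choose Suc k) (t (Suc k))) \<oplus> t 0)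
      = (\<Oplus>k\<in>{..m}. add_pow R (m choose k) (t (Suc k)) \<oplus> add_pow R (m choose Suc k) (t (Suc k))) \<oplus> t 0"
    using t[of 0] tc by (subst finsum_addf) (auto simp: a_assoc finsum_closed)
  also have "(\<Oplus>k\<in>{..m}. add_pow R (m choose k) (t (Suc k)) \<oplus> add_pow R (m choose Suc k) (t (Suc k)))
      = (\<Oplus>k\<in>{..m}. add_pow R (Suc m choose Suc k) (t (Suc k)))"
    using t tc by (intro finsum_cong') (auto simp: add.nat_pow_mult)
  also have "\<dots> \<oplus> t 0 = (\<Oplus>k\<in>{..Suc m}. add_pow R (Suc m choose k) (t k))"
    using finsum_Suc2[of "\<lambda>k. add_pow R (Suc m choose k) (t k)" m] t[of 0] tc by simp
  finally show ?case by (simp add: t_def)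
qed

text \<open>The inner binomial coefficients are divisible by \<open>p\<close>, which is zero in the ring.\<close>

lemma frobenius_add:
  fixes p :: nat
  assumes p: "Factorial_Ring.prime p" "add_pow R p \<one> = \<zero>"
    and a: "a \<in> carrier R" and b: "b \<in> carrier R"
  shows "(a \<oplus> b) [^] p = a [^] p \<oplus> b [^] p"
proof -
  have p0: "p > 0" using p(1) prime_gt_0_nat by blast
  then obtain m where m: "p = Suc m" by (cases p) auto
  have kill: "add_pow R p x = \<zero>" if "x \<in> carrier R" for x
    using add_pow_ldistr[OF one_closed that, of p] p(2) that by simp
  have killm: "add_pow R (p * j) x = \<zero>" if "x \<in> carrier R" for x and j :: nat
    using add.nat_pow_pow[OF that, of p j] kill[OF add.nat_pow_closed[OF that], of j] by (simp add: mult.commute)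
  let ?g = "\<lambda>k. add_pow R (p choose k) (a [^] k \<otimes> b [^] (p - k))"
  have g: "?g k \<in> carrier R" for k using a b by (simp add: add.nat_pow_closed)
  have mid: "?g k = \<zero>" if "0 < k" "k < p" for k
  proof -
    have "p dvd (p choose k)"
      using that p(1) by (intro dvd_choose_prime) auto
    then obtain j where "p choose k = p * j" by (auto elim: dvdE)
    then show ?thesis using killm a b by simp
  qed
  have "(a \<oplus> b) [^] p = (\<Oplus>k\<in>{..p}. ?g k)"
    by (rule binomial_expansion[OF a b])
  also have "\<dots> = ?g p \<oplus> (\<Oplus>k\<in>{..m}. ?g k)"
    unfolding m by (rule finsum_Suc) (use g m in auto)
  also have "(\<Oplus>k\<in>{..m}. ?g k) = (\<Oplus>k\<in>{..m}. if 0 = k then b [^] p else \<zero>)"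
    using mid g b by (intro finsum_cong') (auto simp: m)
  also have "\<dots> = b [^] p"
    using b finsum_singleton[of 0 "{..m}" "\<lambda>_. b [^] p"] by simp
  finally show ?thesis using a b by simp
qed

lemma frobenius_iter_add:
  fixes p e :: nat
  assumes p: "Factorial_Ring.prime p" "add_pow R p \<one> = \<zero>"
    and a: "a \<in> carrier R" and b: "b \<in> carrier R"
  shows "(a \<oplus> b) [^] (p ^ e) = a [^] (p ^ e) \<oplus> b [^] (p ^ e)"
proof (induction e)
  case 0
  then show ?case using a b nat_pow_eone by simp
next
  case (Suc e)
  have *: "x [^] (p ^ Suc e) = (x [^] (p ^ e)) [^] p" if "x \<in> carrier R" for x
    using that by (simp add: nat_pow_pow mult.commute)
  show ?case
    using a b * Suc frobenius_add[OF p, of "a [^] (p ^ e)" "b [^] (p ^ e)"] by simp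
qed

end

section \<open>Submodules and quotient modules\<close>

lemma (in module) submodule_image:
  assumes M': "module R M'" and h: "h \<in> Hom_module R M M'" and N: "submodule N R M"
  shows "submodule (h ` N) R M'"
proof -
  interpret M': module R M' by fact
  note Nc = submodule_carrier[OF N]
  have hc: "h x \<in> carrier M'" if "x \<in> carrier M" for x
    using h that by (auto simp: Hom_module_def)
  have ha: "h (x \<oplus>\<^bsub>M\<^esub> y) = h x \<oplus>\<^bsub>M'\<^esub> h y" if "x \<in> carrier M" "y \<in> carrier M" for x y
    using h that by (auto simp: Hom_module_def)
  have hs: "h (r \<odot>\<^bsub>M\<^esub> y) = r \<odot>\<^bsub>M'\<^esub> h y" if "r \<in> carrier R" "y \<in> carrier M" for r y
    using h that by (auto simp: Hom_module_def)
  have smult: "r \<odot>\<^bsub>M'\<^esub> x \<in> h ` N" if "r \<in> carrier R" "x \<in> h ` N" for r x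
    using that hs Nc submoduleE(4)[OF N] by (auto simp: image_iff) metis
  show ?thesis
  proof (rule M'.submoduleI)
    show "h ` N \<subseteq> carrier M'" using hc Nc by auto
    then show "\<zero>\<^bsub>M'\<^esub> \<in> h ` N"
      using smult[of \<zero> "h \<zero>\<^bsub>M\<^esub>"] submodule_zero[OF N] hc[OF M.zero_closed] by simp
    show "\<ominus>\<^bsub>M'\<^esub> x \<in> h ` N" if "x \<in> h ` N" for x
      using smult[of "\<ominus> \<one>" x] that hc Nc by (auto simp: M'.smult_l_minus)
    show "x \<oplus>\<^bsub>M'\<^esub> y \<in> h ` N" if "x \<in> h ` N" "y \<in> h ` N" for x y
      using that ha Nc submoduleE(5)[OF N] by (auto simp: image_iff) metis
  qed (rule smult)
qed

text \<open>Cocycles are made into a module by shrinking the carrier; these lemmas relate its submodules to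
  those of the cochain module.\<close>

lemma (in module) submodule_restrict:
  assumes Z: "submodule Z R M" and N: "submodule N R (M\<lparr>carrier := Z\<rparr>)"
  shows "submodule N R M"
proof -
  interpret Z: module R "M\<lparr>carrier := Z\<rparr>"
    by (rule submodule.submodule_is_module[OF Z module_axioms])
  have NZ: "x \<in> Z" if "x \<in> N" for x
    using Z.submodule_carrier[OF N that] by simp
  show ?thesis
  proof (rule submoduleI)
    show "N \<subseteq> carrier M" using NZ submodule_carrier[OF Z] by auto
    show "\<zero>\<^bsub>M\<^esub> \<in> N" using Z.submodule_zero[OF N] by simp
    show smult: "r \<odot>\<^bsub>M\<^esub> x \<in> N" if "r \<in> carrier R" "x \<in> N" for r x
      using Z.submoduleE(4)[OF N that] by simp
    show "\<ominus>\<^bsub>M\<^esub> x \<in> N" if "x \<in> N" for x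
      using smult[of "\<ominus> \<one>" x] that submodule_carrier[OF Z NZ[OF that]] by (simp add: smult_l_minus)
    show "x \<oplus>\<^bsub>M\<^esub> y \<in> N" if "x \<in> N" "y \<in> N" for x y
      using Z.submoduleE(5)[OF N that] by simp
  qed
qed

lemma (in module) submodule_of_submodule:
  assumes Z: "submodule Z R M" and N: "submodule N R M" "N \<subseteq> Z"
  shows "submodule N R (M\<lparr>carrier := Z\<rparr>)"
proof -
  interpret Z: module R "M\<lparr>carrier := Z\<rparr>"
    by (rule submodule.submodule_is_module[OF Z module_axioms])
  show ?thesis
  proof (rule Z.submoduleI)
    show "N \<subseteq> carrier (M\<lparr>carrier := Z\<rparr>)" using N by auto
    show "\<zero>\<^bsub>M\<lparr>carrier := Z\<rparr>\<^esub> \<in> N" using submodule_zero[OF N(1)] by simp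
    show smult: "r \<odot>\<^bsub>M\<lparr>carrier := Z\<rparr>\<^esub> x \<in> N" if "r \<in> carrier R" "x \<in> N" for r x
      using submoduleE(4)[OF N(1) that] by simp
    show "\<ominus>\<^bsub>M\<lparr>carrier := Z\<rparr>\<^esub> x \<in> N" if "x \<in> N" for x
      using smult[of "\<ominus> \<one>" x] that N(2) Z.smult_l_minus[of \<one> x] Z.smult_one[of x] by auto
    show "x \<oplus>\<^bsub>M\<lparr>carrier := Z\<rparr>\<^esub> y \<in> N" if "x \<in> N" "y \<in> N" for x y
      using submoduleE(5)[OF N(1) that] by simp
  qed
qed

lemma (in module) artinian_between_restrict:
  assumes Z: "submodule Z R M" and art: "artinian_between R M Z B"
  shows "artinian_between R (M\<lparr>carrier := Z\<rparr>) Z B"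
proof (rule artinian_betweenI)
  fix N :: "nat \<Rightarrow> _ set"
  assume N: "\<And>k. submodule (N k) R (M\<lparr>carrier := Z\<rparr>)" "\<And>k. B \<subseteq> N k" "\<And>k. N k \<subseteq> Z"
    "\<And>j k. j \<le> k \<Longrightarrow> N k \<subseteq> N j"
  have "\<exists>K. \<forall>k\<ge>K. N k = N K"
  proof (rule artinian_betweenD[OF art])
    show "submodule (N k) R M" for k by (rule submodule_restrict[OF Z N(1)])
    show "N (Suc k) \<subseteq> N k" for k by (rule N(4)) simp
  qed (fact N)+
  then show "\<exists>K. \<forall>k\<ge>K. N K \<subseteq> N k" by auto
qed

context module
begin

lemma submodule_abelian_subgroup: "submodule B R M \<Longrightarrow> abelian_subgroup B M"
  using submodule.axioms(1) M.abelian_group_axioms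
  by (intro abelian_subgroupI3) (auto simp: additive_subgroup_def)

lemma coset_eq_iff:
  assumes B: "submodule B R M" and x: "x \<in> carrier M" and y: "y \<in> carrier M"
  shows "B +>\<^bsub>M\<^esub> x = B +>\<^bsub>M\<^esub> y \<longleftrightarrow> x \<ominus>\<^bsub>M\<^esub> y \<in> B"
proof -
  interpret S: abelian_subgroup B M by (rule submodule_abelian_subgroup[OF B])
  show ?thesis
  proof
    assume "B +>\<^bsub>M\<^esub> x = B +>\<^bsub>M\<^esub> y"
    then have "x \<in> B +>\<^bsub>M\<^esub> y" using S.a_rcos_self[OF x] by simp
    then obtain b where b: "b \<in> B" "x = b \<oplus>\<^bsub>M\<^esub> y" by (auto simp: a_r_coset_def')
    then have "x \<ominus>\<^bsub>M\<^esub> y = b"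
      using submodule_carrier[OF B b(1)] y by (simp add: a_minus_def M.a_assoc M.r_neg)
    then show "x \<ominus>\<^bsub>M\<^esub> y \<in> B" using b by simp
  next
    assume xy: "x \<ominus>\<^bsub>M\<^esub> y \<in> B"
    have "x = (x \<ominus>\<^bsub>M\<^esub> y) \<oplus>\<^bsub>M\<^esub> y"
      using x y by (simp add: a_minus_def M.a_assoc M.l_neg)
    then have "x \<in> B +>\<^bsub>M\<^esub> y" using xy by (auto simp: a_r_coset_def')
    then show "B +>\<^bsub>M\<^esub> x = B +>\<^bsub>M\<^esub> y"
      using M.a_repr_independence[OF _ y submodule.axioms(1)[OF B]] by simp
  qed
qed

lemma coset_eq_self_iff:
  assumes B: "submodule B R M" and x: "x \<in> carrier M"
  shows "B +>\<^bsub>M\<^esub> x = B \<longleftrightarrow> x \<in> B"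
proof -
  have "B +>\<^bsub>M\<^esub> \<zero>\<^bsub>M\<^esub> = B" using submoduleE(1)[OF B] by (rule M.a_coset_add_zero)
  then show ?thesis
    using coset_eq_iff[OF B x, of "\<zero>\<^bsub>M\<^esub>"] x M.a_inv_zero by (simp add: a_minus_def)
qed

lemma coset_elem:
  assumes "submodule B R M" "x \<in> carrier M" "y \<in> B +>\<^bsub>M\<^esub> x"
  shows "y \<in> carrier M" "B +>\<^bsub>M\<^esub> y = B +>\<^bsub>M\<^esub> x" "\<exists>b\<in>B. y = b \<oplus>\<^bsub>M\<^esub> x"
proof -
  interpret S: abelian_subgroup B M by (rule submodule_abelian_subgroup[OF assms(1)])
  show b: "\<exists>b\<in>B. y = b \<oplus>\<^bsub>M\<^esub> x" using assms(3) by (auto simp: a_r_coset_def')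
  then show "y \<in> carrier M" using submodule_carrier[OF assms(1)] assms(2) by auto
  show "B +>\<^bsub>M\<^esub> y = B +>\<^bsub>M\<^esub> x" using M.a_repr_independence[OF assms(3,2) submodule.axioms(1)[OF assms(1)]] by simp
qed

lemma quotient_module_carrier: "carrier (quotient_module M B) = {B +>\<^bsub>M\<^esub> x | x. x \<in> carrier M}"
  by (auto simp: quotient_module_def A_RCOSETS_def' )

text \<open>An additive map induces a map on cosets even if it is only semilinear: the Frobenius, the trace
  maps and the scalar multiplications are all instances. It only needs to be additive on a subset \<open>Z\<close>
  containing \<open>B\<close>, such as the cocycles.\<close>

lemma quotient_map_coset:
  assumes B: "submodule B R M"
    and h: "\<And>x. x \<in> Z \<Longrightarrow> h x \<in> carrier M" "\<And>b. b \<in> B \<Longrightarrow> h b \<in> B"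
      "\<And>x y. x \<in> Z \<Longrightarrow> y \<in> Z \<Longrightarrow> h (x \<oplus>\<^bsub>M\<^esub> y) = h x \<oplus>\<^bsub>M\<^esub> h y"
    and Z: "Z \<subseteq> carrier M" "B \<subseteq> Z" and x: "x \<in> Z"
  shows "quotient_map M B h (B +>\<^bsub>M\<^esub> x) = B +>\<^bsub>M\<^esub> h x"
proof -
  interpret S: abelian_subgroup B M by (rule submodule_abelian_subgroup[OF B])
  have xc: "x \<in> carrier M" using x Z by auto
  have "B +>\<^bsub>M\<^esub> h y = B +>\<^bsub>M\<^esub> h x" if y: "y \<in> B +>\<^bsub>M\<^esub> x" for y
  proof -
    obtain b where b: "b \<in> B" "y = b \<oplus>\<^bsub>M\<^esub> x" using coset_elem(3)[OF B xc y] by blast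
    then have "h y = h b \<oplus>\<^bsub>M\<^esub> h x" using h(3) Z x by auto
    then have "h y \<in> B +>\<^bsub>M\<^esub> h x" using h(2)[OF b(1)] by (auto simp: a_r_coset_def')
    then show ?thesis using coset_elem(2)[OF B h(1)[OF x]] by simp
  qed
  then have "(\<Union>y\<in>B +>\<^bsub>M\<^esub> x. B +>\<^bsub>M\<^esub> h y) = (\<Union>y\<in>B +>\<^bsub>M\<^esub> x. B +>\<^bsub>M\<^esub> h x)"
    by (intro SUP_cong refl)
  also have "\<dots> = B +>\<^bsub>M\<^esub> h x" using S.a_rcos_self[OF xc] by auto
  finally show ?thesis unfolding quotient_map_def .
qed

lemma quotient_smult_coset:
  assumes B: "submodule B R M" and r: "r \<in> carrier R" and x: "x \<in> carrier M"
  shows "r \<odot>\<^bsub>quotient_module M B\<^esub> (B +>\<^bsub>M\<^esub> x) = B +>\<^bsub>M\<^esub> (r \<odot>\<^bsub>M\<^esub> x)"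
  using quotient_map_coset[OF B, of "carrier M" "\<lambda>x. r \<odot>\<^bsub>M\<^esub> x" x] submoduleE(1,4)[OF B] r x
  by (simp add: quotient_module_def quotient_map_def smult_r_distr)

lemma quotient_add_coset:
  assumes B: "submodule B R M" and x: "x \<in> carrier M" "y \<in> carrier M"
  shows "(B +>\<^bsub>M\<^esub> x) \<oplus>\<^bsub>quotient_module M B\<^esub> (B +>\<^bsub>M\<^esub> y) = B +>\<^bsub>M\<^esub> (x \<oplus>\<^bsub>M\<^esub> y)"
proof -
  interpret S: abelian_subgroup B M by (rule submodule_abelian_subgroup[OF B])
  show ?thesis using S.a_rcos_sum[OF x] by (simp add: quotient_module_def)
qed

lemma quotient_module_zero: "\<zero>\<^bsub>quotient_module M B\<^esub> = B"
  by (simp add: quotient_module_def)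

lemma quotient_module_is_module:
  assumes B: "submodule B R M"
  shows "module R (quotient_module M B)"
proof (rule moduleI)
  let ?Q = "quotient_module M B"
  note simps = quotient_smult_coset[OF B] quotient_add_coset[OF B] quotient_module_carrier
  have B0: "B +>\<^bsub>M\<^esub> \<zero>\<^bsub>M\<^esub> = B" using submoduleE(1)[OF B] by (rule M.a_coset_add_zero)
  have zero: "\<zero>\<^bsub>?Q\<^esub> = B +>\<^bsub>M\<^esub> \<zero>\<^bsub>M\<^esub>" using B0 by (simp add: quotient_module_zero)
  show "cring R" by (rule is_cring)
  show "abelian_group ?Q"
  proof (rule abelian_groupI)
    fix x y assume "x \<in> carrier ?Q" "y \<in> carrier ?Q"
    then obtain a b where ab: "x = B +>\<^bsub>M\<^esub> a" "a \<in> carrier M" "y = B +>\<^bsub>M\<^esub> b" "b \<in> carrier M"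
      by (auto simp: quotient_module_carrier)
    show "x \<oplus>\<^bsub>?Q\<^esub> y \<in> carrier ?Q" "x \<oplus>\<^bsub>?Q\<^esub> y = y \<oplus>\<^bsub>?Q\<^esub> x"
      using ab by (auto simp: simps M.a_comm)
    fix z assume "z \<in> carrier ?Q"
    then obtain c where c: "z = B +>\<^bsub>M\<^esub> c" "c \<in> carrier M"
      by (auto simp: quotient_module_carrier)
    show "x \<oplus>\<^bsub>?Q\<^esub> y \<oplus>\<^bsub>?Q\<^esub> z = x \<oplus>\<^bsub>?Q\<^esub> (y \<oplus>\<^bsub>?Q\<^esub> z)"
      using ab c by (simp add: simps M.a_assoc)
  next
    show "\<zero>\<^bsub>?Q\<^esub> \<in> carrier ?Q" unfolding zero quotient_module_carrier by blast
  next
    fix x assume "x \<in> carrier ?Q"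
    then obtain a where a: "x = B +>\<^bsub>M\<^esub> a" "a \<in> carrier M"
      by (auto simp: quotient_module_carrier)
    show "\<zero>\<^bsub>?Q\<^esub> \<oplus>\<^bsub>?Q\<^esub> x = x" unfolding zero using a by (simp add: simps)
    have "(B +>\<^bsub>M\<^esub> (\<ominus>\<^bsub>M\<^esub> a)) \<oplus>\<^bsub>?Q\<^esub> x = \<zero>\<^bsub>?Q\<^esub>"
      unfolding zero using a by (simp add: simps M.l_neg)
    moreover have "B +>\<^bsub>M\<^esub> (\<ominus>\<^bsub>M\<^esub> a) \<in> carrier ?Q"
      using a unfolding quotient_module_carrier by blast
    ultimately show "\<exists>y\<in>carrier ?Q. y \<oplus>\<^bsub>?Q\<^esub> x = \<zero>\<^bsub>?Q\<^esub>" by blast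
  qed
  fix x assume "x \<in> carrier ?Q"
  then obtain a where a: "x = B +>\<^bsub>M\<^esub> a" "a \<in> carrier M"
    by (auto simp: quotient_module_carrier)
  show "\<one> \<odot>\<^bsub>?Q\<^esub> x = x" using a by (simp add: simps)
  fix r assume r: "r \<in> carrier R"
  show "r \<odot>\<^bsub>?Q\<^esub> x \<in> carrier ?Q" using a r by (auto simp: simps)
  show "r \<odot>\<^bsub>?Q\<^esub> (x \<oplus>\<^bsub>?Q\<^esub> y) = r \<odot>\<^bsub>?Q\<^esub> x \<oplus>\<^bsub>?Q\<^esub> r \<odot>\<^bsub>?Q\<^esub> y" if y: "y \<in> carrier ?Q" for y
  proof -
    from y obtain b where b: "y = B +>\<^bsub>M\<^esub> b" "b \<in> carrier M"
      by (auto simp: quotient_module_carrier)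
    show ?thesis using a b r by (simp add: simps smult_r_distr)
  qed
  fix s assume s: "s \<in> carrier R"
  show "(r \<oplus> s) \<odot>\<^bsub>?Q\<^esub> x = r \<odot>\<^bsub>?Q\<^esub> x \<oplus>\<^bsub>?Q\<^esub> s \<odot>\<^bsub>?Q\<^esub> x"
    using a r s by (simp add: simps smult_l_distr)
  show "(r \<otimes> s) \<odot>\<^bsub>?Q\<^esub> x = r \<odot>\<^bsub>?Q\<^esub> (s \<odot>\<^bsub>?Q\<^esub> x)"
    using a r s by (simp add: simps smult_assoc1)
qed

lemma quotient_artinian:
  assumes B: "submodule B R M" and art: "artinian_between R M (carrier M) B"
  shows "artinian_between R (quotient_module M B) (carrier (quotient_module M B)) {B}"
proof -
  let ?Q = "quotient_module M B"
  interpret Q: module R ?Q by (rule quotient_module_is_module[OF B])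
  have sB: "submodule {B} R ?Q"
    using Q.smult_r_null Q.M.zero_closed Q.M.l_zero[OF Q.M.zero_closed] Q.M.a_inv_zero
    unfolding quotient_module_zero by (intro Q.submoduleI) auto
  show ?thesis
  proof (rule artinian_between_hom[OF module_axioms Q.module_axioms _ carrier_is_submodule B
        submoduleE(1)[OF B] sB _ _ subset_refl art])
    show "(\<lambda>x. B +>\<^bsub>M\<^esub> x) \<in> Hom_module R M ?Q"
      unfolding Hom_module_def
      using quotient_smult_coset[OF B] quotient_add_coset[OF B] by (auto simp: quotient_module_carrier)
    show "B +>\<^bsub>M\<^esub> b \<in> {B}" if "b \<in> B" for b
      using coset_eq_self_iff[OF B submodule_carrier[OF B that]] that by simp
    fix z assume z: "z \<in> carrier ?Q"
    then obtain x where x: "x \<in> carrier M" "z = B +>\<^bsub>M\<^esub> x" by (auto simp: quotient_module_carrier)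
    have "z \<ominus>\<^bsub>?Q\<^esub> (B +>\<^bsub>M\<^esub> x) = B"
      using z x Q.M.r_neg[OF z] by (simp add: a_minus_def quotient_module_zero)
    then show "\<exists>u\<in>carrier M. z \<ominus>\<^bsub>?Q\<^esub> (B +>\<^bsub>M\<^esub> u) \<in> {B}" using x by blast
  qed
qed

section \<open>Annihilators of stable subquotients\<close>

lemma annihilator_subquotient:
  assumes N: "submodule N R M" and L: "submodule L R M" and NL: "N \<subseteq> L"
  shows "annihilator R (subquotient M L N) = {r \<in> carrier R. \<forall>x\<in>L. r \<odot>\<^bsub>M\<^esub> x \<in> N}"
proof -
  interpret L: module R "M\<lparr>carrier := L\<rparr>"
    by (rule submodule.submodule_is_module[OF L module_axioms])
  have N': "submodule N R (M\<lparr>carrier := L\<rparr>)" by (rule submodule_of_submodule[OF L N NL])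
  have "(r \<odot>\<^bsub>subquotient M L N\<^esub> (N +>\<^bsub>M\<lparr>carrier := L\<rparr>\<^esub> x) = \<zero>\<^bsub>subquotient M L N\<^esub>) \<longleftrightarrow> r \<odot>\<^bsub>M\<^esub> x \<in> N"
    if "r \<in> carrier R" "x \<in> L" for r x
    unfolding subquotient_def L.quotient_module_zero
    using L.quotient_smult_coset[OF N' that(1), of x] L.coset_eq_self_iff[OF N', of "r \<odot>\<^bsub>M\<^esub> x"] that
      submoduleE(4)[OF L that] by simp
  then show ?thesis
    unfolding annihilator_def by (auto simp: subquotient_def L.quotient_module_carrier)
qed

lemma annihilator_subquotient_ideal:
  assumes N: "submodule N R M" and L: "submodule L R M"
  shows "ideal {r \<in> carrier R. \<forall>x\<in>L. r \<odot>\<^bsub>M\<^esub> x \<in> N} R"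
proof (rule idealI[OF ring_axioms])
  note Lc = submodule_carrier[OF L]
  show "subgroup {r \<in> carrier R. \<forall>x\<in>L. r \<odot>\<^bsub>M\<^esub> x \<in> N} (add_monoid R)"
    using submodule_zero[OF N] submoduleE(3,5)[OF N] Lc
    by (intro R.add.subgroupI) (auto simp: smult_l_minus smult_l_distr intro!: exI[of _ \<zero>])
  fix s x assume s: "s \<in> {r \<in> carrier R. \<forall>x\<in>L. r \<odot>\<^bsub>M\<^esub> x \<in> N}" and x: "x \<in> carrier R"
  have "(x \<otimes> s) \<odot>\<^bsub>M\<^esub> y \<in> N" if "y \<in> L" for y
    using submoduleE(4)[OF N x, of "s \<odot>\<^bsub>M\<^esub> y"] s x that Lc[OF that] by (simp add: smult_assoc1)
  then show "x \<otimes> s \<in> {r \<in> carrier R. \<forall>x\<in>L. r \<odot>\<^bsub>M\<^esub> x \<in> N}"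
    "s \<otimes> x \<in> {r \<in> carrier R. \<forall>x\<in>L. r \<odot>\<^bsub>M\<^esub> x \<in> N}"
    using s x by (auto simp: m_comm)
qed

text \<open>The heart of the argument. Here \<open>F\<close> plays the role of the \<open>e\<close>-th iterate of the Frobenius action, \<open>q = p\<^sup>e\<close>, and
  \<open>\<psi>\<close> is the map induced by \<open>\<phi>\<close>. Put \<open>c = \<phi>(r)\<close>, \<open>G = r F\<close> and \<open>T = \<psi> \<circ> c\<^sup>q\<^sup>-\<^sup>2\<close>. Then \<open>G\<close> maps \<open>L\<close> into
  \<open>N\<close>, \<open>T\<close> maps multiples of \<open>G(x)\<close> to multiples of \<open>x\<close>, and
  \<open>T(c\<^sup>2 G(x)) = \<psi>(c\<^sup>q r F(x)) = \<phi>(c\<^sup>q r) x = c\<^sup>2 x\<close>.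

  The submodules generated by \<open>G\<^sup>k(\<eta>), G\<^sup>k\<^sup>+\<^sup>1(\<eta>), \<dots>\<close> form a descending chain. Where it becomes stationary,
  \<open>G\<^sup>K(\<eta>)\<close> is a combination of the \<open>G\<^sup>j(\<eta>)\<close> with \<open>j > K\<close>. Multiplying by \<open>c\<^sup>2\<close> and applying \<open>T\<close> \<open>K\<close> times
  turns this into an expression for \<open>c\<^sup>2 \<eta>\<close> by elements \<open>G\<^sup>j(\<eta>)\<close> with \<open>j > 0\<close>, which lie in \<open>N\<close>. While \<open>K\<close>
  depends on \<open>\<eta>\<close>, the exponent of \<open>c\<close> does not: this is what the factor \<open>c\<^sup>q\<^sup>-\<^sup>2\<close> in \<open>T\<close> is for, and it
  makes \<open>c\<^sup>2\<close> an element of the annihilator of \<open>L / N\<close>.\<close>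

lemma trace_square_annihilates:
  fixes F \<psi> :: "'c \<Rightarrow> 'c" and \<phi> :: "'a \<Rightarrow> 'a" and q :: nat
  assumes art: "artinian_between R M (carrier M) {\<zero>\<^bsub>M\<^esub>}"
    and q: "q \<ge> 2"
    and F: "\<And>x. x \<in> carrier M \<Longrightarrow> F x \<in> carrier M"
    and \<phi>: "\<And>x. x \<in> carrier R \<Longrightarrow> \<phi> x \<in> carrier R"
      "\<And>r x. r \<in> carrier R \<Longrightarrow> x \<in> carrier R \<Longrightarrow> \<phi> (r [^] q \<otimes> x) = r \<otimes> \<phi> x"
    and \<psi>: "\<And>x. x \<in> carrier M \<Longrightarrow> \<psi> x \<in> carrier M"
      "\<And>x y. x \<in> carrier M \<Longrightarrow> y \<in> carrier M \<Longrightarrow> \<psi> (x \<oplus>\<^bsub>M\<^esub> y) = \<psi> x \<oplus>\<^bsub>M\<^esub> \<psi> y"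
      "\<And>r x. r \<in> carrier R \<Longrightarrow> x \<in> carrier M \<Longrightarrow> \<psi> (r \<odot>\<^bsub>M\<^esub> F x) = \<phi> r \<odot>\<^bsub>M\<^esub> x"
    and N: "submodule N R M" and L: "submodule L R M" "N \<subseteq> L"
    and FN: "\<And>x. x \<in> L \<Longrightarrow> F x \<in> L"
    and r: "r \<in> carrier R" "\<And>x. x \<in> L \<Longrightarrow> r \<odot>\<^bsub>M\<^esub> x \<in> N"
    and \<eta>: "\<eta> \<in> L"
  shows "(\<phi> r \<otimes> \<phi> r) \<odot>\<^bsub>M\<^esub> \<eta> \<in> N"
proof -
  define c where "c = \<phi> r"
  have c: "c \<in> carrier R" using \<phi>(1) r(1) by (simp add: c_def)
  define G where "G x = r \<odot>\<^bsub>M\<^esub> F x" for x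
  define T where "T x = \<psi> (c [^] (q - 2) \<odot>\<^bsub>M\<^esub> x)" for x
  have Gc: "G x \<in> carrier M" if "x \<in> carrier M" for x
    using that F r(1) by (simp add: G_def)
  have GL: "G x \<in> N" if "x \<in> L" for x
    unfolding G_def by (intro r(2) FN that)
  have Tc: "T x \<in> carrier M" if "x \<in> carrier M" for x
    using that \<psi>(1) c by (simp add: T_def)
  have Tadd: "T (x \<oplus>\<^bsub>M\<^esub> y) = T x \<oplus>\<^bsub>M\<^esub> T y" if "x \<in> carrier M" "y \<in> carrier M" for x y
    using that \<psi>(2) c by (simp add: T_def smult_r_distr)
  have TG: "\<exists>s'\<in>carrier R. T (s \<odot>\<^bsub>M\<^esub> G x) = s' \<odot>\<^bsub>M\<^esub> x" if "s \<in> carrier R" "x \<in> carrier M" for s x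
  proof -
    have "T (s \<odot>\<^bsub>M\<^esub> G x) = \<psi> ((c [^] (q - 2) \<otimes> s \<otimes> r) \<odot>\<^bsub>M\<^esub> F x)"
      using that c r(1) F by (simp add: T_def G_def smult_assoc1)
    also have "\<dots> = \<phi> (c [^] (q - 2) \<otimes> s \<otimes> r) \<odot>\<^bsub>M\<^esub> x"
      using that c r(1) by (intro \<psi>(3)) auto
    finally show ?thesis using that c r(1) \<phi>(1) by (metis R.m_closed R.nat_pow_closed)
  qed
  have TGc: "T ((c \<otimes> c) \<odot>\<^bsub>M\<^esub> G x) = (c \<otimes> c) \<odot>\<^bsub>M\<^esub> x" if "x \<in> carrier M" for x
  proof -
    have "c [^] (q - 2) \<otimes> (c \<otimes> c) = c [^] q"
    proof -
      have "c [^] (2::nat) = c \<otimes> c" using c by (simp add: numeral_2_eq_2)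
      moreover have "c [^] (q - 2) \<otimes> c [^] (2::nat) = c [^] q"
        unfolding nat_pow_mult[OF c] le_add_diff_inverse2[OF q] ..
      ultimately show ?thesis by metis
    qed
    then have "c [^] (q - 2) \<otimes> ((c \<otimes> c) \<otimes> r) = c [^] q \<otimes> r"
      using c r(1) by (simp add: m_assoc[symmetric])
    then have "T ((c \<otimes> c) \<odot>\<^bsub>M\<^esub> G x) = \<psi> ((c [^] q \<otimes> r) \<odot>\<^bsub>M\<^esub> F x)"
      using that c r(1) F by (simp add: T_def G_def smult_assoc1[symmetric])
    also have "\<dots> = (c \<otimes> c) \<odot>\<^bsub>M\<^esub> x"
      using that c r(1) \<psi>(3) \<phi>(2) by (simp add: c_def)
    finally show ?thesis .
  qed
  define g where "g j = (G ^^ j) \<eta>" for j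
  have \<eta>c: "\<eta> \<in> carrier M" using submodule_carrier[OF L(1) \<eta>] .
  have gc: "g j \<in> carrier M" for j
    unfolding g_def by (induction j) (auto simp: \<eta>c Gc)
  have gL: "g j \<in> L" for j
    unfolding g_def by (induction j) (use \<eta> GL L(2) in auto)
  have gN: "g (Suc j) \<in> N" for j
    using GL[OF gL[of j]] by (simp add: g_def)
  define P where "P k = \<Inter>{P. submodule P R M \<and> (\<forall>j\<ge>k. g j \<in> P)}" for k
  have Pleast: "P k \<subseteq> P'" if "submodule P' R M" "\<And>j. j \<ge> k \<Longrightarrow> g j \<in> P'" for k P'
    unfolding P_def using that by blast
  have gP: "g j \<in> P k" if "j \<ge> k" for j k
    unfolding P_def using that by blast
  have PC: "P k \<subseteq> carrier M" for k
    by (rule Pleast[OF carrier_is_submodule gc])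
  have Psub: "submodule (P k) R M" for k
  proof (rule submoduleI[OF PC])
    show "\<zero>\<^bsub>M\<^esub> \<in> P k" unfolding P_def using submodule_zero by blast
    show "\<ominus>\<^bsub>M\<^esub> a \<in> P k" if "a \<in> P k" for a
      using that submoduleE(3) unfolding P_def by blast
    show "a \<oplus>\<^bsub>M\<^esub> b \<in> P k" if "a \<in> P k" "b \<in> P k" for a b
      using that submoduleE(5) unfolding P_def by blast
    show "a \<odot>\<^bsub>M\<^esub> b \<in> P k" if "a \<in> carrier R" "b \<in> P k" for a b
      using that submoduleE(4) unfolding P_def by blast
  qed
  have "\<exists>K. \<forall>k\<ge>K. P k = P K"
  proof (rule artinian_betweenD[OF art Psub _ PC])
    show "{\<zero>\<^bsub>M\<^esub>} \<subseteq> P k" for k using submodule_zero[OF Psub] by simp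
    show "P (Suc k) \<subseteq> P k" for k by (rule Pleast[OF Psub]) (auto intro: gP)
  qed
  then obtain K where K: "P (Suc K) = P K" by (metis le_SucI le_refl)
  have Tk: "\<exists>s'\<in>carrier R. (T ^^ k) (s \<odot>\<^bsub>M\<^esub> g (k + j)) = s' \<odot>\<^bsub>M\<^esub> g j" if "s \<in> carrier R" for s k j
    using that
  proof (induction k arbitrary: s)
    case (Suc k)
    obtain s1 where s1: "s1 \<in> carrier R" "T (s \<odot>\<^bsub>M\<^esub> g (Suc k + j)) = s1 \<odot>\<^bsub>M\<^esub> g (k + j)"
      using TG[OF Suc.prems gc[of "k + j"]] by (auto simp: g_def)
    then show ?case using Suc.IH[OF s1(1)] by (simp add: funpow_swap1)
  qed auto
  have TK: "(T ^^ k) ((c \<otimes> c) \<odot>\<^bsub>M\<^esub> g k) = (c \<otimes> c) \<odot>\<^bsub>M\<^esub> \<eta>" for k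
  proof (induction k)
    case (Suc k)
    have "T ((c \<otimes> c) \<odot>\<^bsub>M\<^esub> g (Suc k)) = (c \<otimes> c) \<odot>\<^bsub>M\<^esub> g k"
      using TGc[OF gc[of k]] by (simp add: g_def)
    then show ?case using Suc by (simp add: funpow_swap1)
  qed (simp add: g_def)
  have Tkc: "(T ^^ k) x \<in> carrier M" if "x \<in> carrier M" for x k
    using that by (induction k) (auto intro: Tc)
  have Tkadd: "(T ^^ k) (x \<oplus>\<^bsub>M\<^esub> y) = (T ^^ k) x \<oplus>\<^bsub>M\<^esub> (T ^^ k) y" if "x \<in> carrier M" "y \<in> carrier M" for x y k
    using that by (induction k) (auto simp: Tadd Tkc)
  \<comment> \<open>The scalars \<open>s\<close> make \<open>?P\<close> a submodule although \<open>T\<close> is not linear.\<close>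
  let ?P = "{x \<in> carrier M. \<forall>s\<in>carrier R. (T ^^ K) (s \<odot>\<^bsub>M\<^esub> x) \<in> N}"
  have "submodule ?P R M"
  proof (rule submoduleI)
    have "(T ^^ K) \<zero>\<^bsub>M\<^esub> = \<zero>\<^bsub>M\<^esub>"
      using Tkadd[of "\<zero>\<^bsub>M\<^esub>" "\<zero>\<^bsub>M\<^esub>" K] Tkc[of "\<zero>\<^bsub>M\<^esub>" K] by simp
    then show "\<zero>\<^bsub>M\<^esub> \<in> ?P" using submodule_zero[OF N] by simp
    show smult: "a \<odot>\<^bsub>M\<^esub> x \<in> ?P" if "a \<in> carrier R" "x \<in> ?P" for a x
      using that by (auto simp: smult_assoc1[symmetric])
    show "\<ominus>\<^bsub>M\<^esub> x \<in> ?P" if "x \<in> ?P" for x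
      using smult[of "\<ominus> \<one>" x] that by (simp add: smult_l_minus)
    show "x \<oplus>\<^bsub>M\<^esub> y \<in> ?P" if "x \<in> ?P" "y \<in> ?P" for x y
      using that submoduleE(5)[OF N] by (auto simp: smult_r_distr Tkadd)
  qed auto
  moreover have "g j \<in> ?P" if "j \<ge> Suc K" for j
  proof -
    have "(T ^^ K) (s \<odot>\<^bsub>M\<^esub> g j) \<in> N" if s: "s \<in> carrier R" for s
    proof -
      have j: "j = K + Suc (j - Suc K)" using \<open>j \<ge> Suc K\<close> by simp
      obtain s' where "s' \<in> carrier R" "(T ^^ K) (s \<odot>\<^bsub>M\<^esub> g j) = s' \<odot>\<^bsub>M\<^esub> g (Suc (j - Suc K))"
        using Tk[OF s, of K "Suc (j - Suc K)"] j by auto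
      then show ?thesis using submoduleE(4)[OF N _ gN] by simp
    qed
    then show ?thesis using gc by simp
  qed
  ultimately have "P (Suc K) \<subseteq> ?P" by (rule Pleast)
  then have "g K \<in> ?P" using gP[of K K] K by auto
  then have "(T ^^ K) ((c \<otimes> c) \<odot>\<^bsub>M\<^esub> g K) \<in> N" using c by simp
  then show ?thesis using TK by (simp add: c_def)
qed

end

text \<open>If \<open>r\<^sup>p\<close> kills \<open>L / N\<close>, then \<open>F(r x) = r\<^sup>p F(x)\<close> vanishes in \<open>L / N\<close> for \<open>x \<in> L\<close>, and so does \<open>r x\<close> by injectivity.
  An arbitrary power of \<open>r\<close> is reduced to this by passing to a power with exponent \<open>p\<^sup>k\<close>.\<close>

lemma (in module) radical_annihilator_if_injective:
  assumes N: "submodule N R M" and L: "submodule L R M" and NL: "N \<subseteq> L"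
    and F: "\<And>x. x \<in> carrier M \<Longrightarrow> F x \<in> carrier M"
      "\<And>x y. x \<in> carrier M \<Longrightarrow> y \<in> carrier M \<Longrightarrow> F (x \<oplus>\<^bsub>M\<^esub> y) = F x \<oplus>\<^bsub>M\<^esub> F y"
      "\<And>r x. r \<in> carrier R \<Longrightarrow> x \<in> carrier M \<Longrightarrow> F (r \<odot>\<^bsub>M\<^esub> x) = (r [^] p) \<odot>\<^bsub>M\<^esub> F x"
    and stable: "F ` N \<subseteq> N" "F ` L \<subseteq> L" and p: "(p::nat) \<ge> 2"
    and inj: "inj_on (quotient_map M N F) (carrier (subquotient M L N))"
  shows "ideal_radical R {r \<in> carrier R. \<forall>x\<in>L. r \<odot>\<^bsub>M\<^esub> x \<in> N} = {r \<in> carrier R. \<forall>x\<in>L. r \<odot>\<^bsub>M\<^esub> x \<in> N}"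
    (is "ideal_radical R ?J = ?J")
proof -
  note Lc = submodule_carrier[OF L]
  note ideal_J = annihilator_subquotient_ideal[OF N L]
  have qm: "quotient_map M N F (N +>\<^bsub>M\<^esub> x) = N +>\<^bsub>M\<^esub> F x" if "x \<in> carrier M" for x
  proof (rule quotient_map_coset[OF N, where Z = "carrier M"])
    show "F b \<in> N" if "b \<in> N" for b using stable(1) that by blast
  qed (fact F submoduleE(1)[OF N] that subset_refl)+
  have carr: "N +>\<^bsub>M\<^esub> x \<in> carrier (subquotient M L N)" if "x \<in> L" for x
    using that by (auto simp: subquotient_def quotient_module_def A_RCOSETS_def' a_r_coset_def')
  have step: "r \<in> ?J" if r: "r \<in> carrier R" and rp: "r [^] p \<in> ?J" for r
  proof -
    have "r \<odot>\<^bsub>M\<^esub> x \<in> N" if x: "x \<in> L" for x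
    proof -
      have xc: "x \<in> carrier M" "r \<odot>\<^bsub>M\<^esub> x \<in> carrier M"
        using Lc[OF x] smult_closed[OF r Lc[OF x]] by this
      note zc = M.zero_closed
      have "F (r \<odot>\<^bsub>M\<^esub> x) \<in> N"
      proof -
        have "F x \<in> L" using stable(2) x by blast
        then show ?thesis unfolding F(3)[OF r xc(1)] using rp by blast
      qed
      moreover have "F \<zero>\<^bsub>M\<^esub> \<in> N" using stable(1) submodule_zero[OF N] by blast
      ultimately have "quotient_map M N F (N +>\<^bsub>M\<^esub> (r \<odot>\<^bsub>M\<^esub> x)) = quotient_map M N F (N +>\<^bsub>M\<^esub> \<zero>\<^bsub>M\<^esub>)"
        unfolding qm[OF xc(2)] qm[OF zc]
        using coset_eq_self_iff[OF N F(1)[OF xc(2)]] coset_eq_self_iff[OF N F(1)[OF zc]] by blast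
      then have "N +>\<^bsub>M\<^esub> (r \<odot>\<^bsub>M\<^esub> x) = N +>\<^bsub>M\<^esub> \<zero>\<^bsub>M\<^esub>"
        by (rule inj_onD[OF inj])
           (rule carr[OF submoduleE(4)[OF L r x]], rule carr[OF submodule_zero[OF L]])
      then show ?thesis
        using coset_eq_self_iff[OF N xc(2)] coset_eq_self_iff[OF N zc] submodule_zero[OF N] by blast
    qed
    then show ?thesis using r by simp
  qed
  have descend: "r \<in> ?J" if r: "r \<in> carrier R" and rk: "r [^] (p ^ k) \<in> ?J" for r k
    using rk
  proof (induction k)
    case 0
    then show ?case using r R.nat_pow_eone by simp
  next
    case (Suc k)
    have "(r [^] (p ^ k)) [^] p \<in> ?J"
      using Suc.prems r by (simp add: R.nat_pow_pow mult.commute)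
    then show ?case using Suc.IH step[of "r [^] (p ^ k)"] r by simp
  qed
  show ?thesis
  proof (rule equalityI; rule subsetI)
    fix r assume "r \<in> ideal_radical R ?J"
    then obtain k :: nat where r: "r \<in> carrier R" "r [^] k \<in> ?J" by (auto simp: ideal_radical_def)
    have "k < 2 ^ k" by (rule less_exp)
    also have "2 ^ k \<le> p ^ k" by (rule power_mono[OF p]) simp
    finally have "r [^] (p ^ k) = r [^] (p ^ k - k) \<otimes> r [^] k"
      using r(1) by (simp add: R.nat_pow_mult)
    then have "r [^] (p ^ k) \<in> ?J"
      using ideal.I_l_closed[OF ideal_J r(2), of "r [^] (p ^ k - k)"] r(1) by simp
    then show "r \<in> ?J" using descend r(1) by blast
  next
    fix r assume r: "r \<in> ?J"
    then have "r [^] (1::nat) \<in> ?J" using R.nat_pow_eone by simp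
    then show "r \<in> ideal_radical R ?J" using r unfolding ideal_radical_def by blast
  qed
qed

section \<open>Trace maps on localizations\<close>

lemma pushforward_hom:
  fixes R (structure)
  assumes "\<phi> \<in> Hom_module R (frobenius_pushforward R p e (regular_module R)) (regular_module R)"
  shows "x \<in> carrier R \<Longrightarrow> \<phi> x \<in> carrier R"
    and "x \<in> carrier R \<Longrightarrow> y \<in> carrier R \<Longrightarrow> \<phi> (x \<oplus> y) = \<phi> x \<oplus> \<phi> y"
    and "r \<in> carrier R \<Longrightarrow> x \<in> carrier R \<Longrightarrow> \<phi> (r [^] (p ^ e) \<otimes> x) = r \<otimes> \<phi> x"
  using assms by (auto simp: Hom_module_def frobenius_pushforward_def regular_module_def)

context denominators
begin

text \<open>The map on fractions induced by a \<open>p\<^sup>e\<close>-inverse linear \<open>\<phi>\<close>: with \<open>q = p\<^sup>e\<close>, write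
  \<open>a / s = a s\<^sup>q\<^sup>-\<^sup>1 / s\<^sup>q\<close> and take the denominator \<open>s\<^sup>q\<close> out of \<open>\<phi>\<close>.\<close>

definition trace_on_fractions :: "('a \<Rightarrow> 'a) \<Rightarrow> nat \<Rightarrow> ('a \<times> 'a) set \<Rightarrow> ('a \<times> 'a) set" where
  "trace_on_fractions \<phi> q X = (\<Union>(a, s)\<in>X. fraction R S (\<phi> (a \<otimes> s [^] (q - 1))) s)"

context
  fixes \<phi> :: "'a \<Rightarrow> 'a" and p e q :: nat
  assumes q: "q = p ^ e" "q > 0"
    and \<phi>: "\<phi> \<in> Hom_module R (frobenius_pushforward R p e (regular_module R)) (regular_module R)"
begin

lemmas \<phi>_closed = pushforward_hom(1)[OF \<phi>]
  and \<phi>_add = pushforward_hom(2)[OF \<phi>]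
  and \<phi>_smult = pushforward_hom(3)[OF \<phi>, folded q(1)]

lemma pow_q: "x \<in> carrier R \<Longrightarrow> x [^] q = x \<otimes> x [^] (q - 1)"
  using q(2) nat_pow_Suc2[of x "q - 1"] by simp

lemma trace_fraction:
  assumes a: "a \<in> carrier R" "s \<in> S"
  shows "trace_on_fractions \<phi> q (fraction R S a s) = fraction R S (\<phi> (a \<otimes> s [^] (q - 1))) s"
  unfolding trace_on_fractions_def
proof (rule fraction_Union[OF a])
  fix b t u assume b: "b \<in> carrier R" "t \<in> S" and u: "u \<in> S" "u \<otimes> (t \<otimes> a) = u \<otimes> (s \<otimes> b)"
  have "u \<otimes> (s \<otimes> \<phi> (b \<otimes> t [^] (q - 1))) = (u \<otimes> s) \<otimes> \<phi> (b \<otimes> t [^] (q - 1))"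
    using a b u(1) \<phi>_closed by (simp add: m_assoc)
  also have "\<dots> = \<phi> ((u \<otimes> s) [^] q \<otimes> (b \<otimes> t [^] (q - 1)))"
    using a b u(1) by (intro \<phi>_smult[symmetric]) auto
  also have "(u \<otimes> s) [^] q \<otimes> (b \<otimes> t [^] (q - 1))
      = (u [^] (q - 1) \<otimes> s [^] (q - 1) \<otimes> t [^] (q - 1)) \<otimes> (u \<otimes> (s \<otimes> b))"
    using a b u(1) by (simp add: nat_pow_distrib pow_q m_ac)
  also have "\<dots> = (u [^] (q - 1) \<otimes> s [^] (q - 1) \<otimes> t [^] (q - 1)) \<otimes> (u \<otimes> (t \<otimes> a))"
    using u(2) by simp
  also have "\<dots> = (u \<otimes> t) [^] q \<otimes> (a \<otimes> s [^] (q - 1))"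
    using a b u(1) by (simp add: nat_pow_distrib pow_q m_ac)
  also have "\<phi> \<dots> = (u \<otimes> t) \<otimes> \<phi> (a \<otimes> s [^] (q - 1))"
    using a b u(1) by (intro \<phi>_smult) auto
  also have "\<dots> = u \<otimes> (t \<otimes> \<phi> (a \<otimes> s [^] (q - 1)))"
    using a b u(1) \<phi>_closed by (simp add: m_assoc)
  finally show "fraction R S (\<phi> (b \<otimes> t [^] (q - 1))) t = fraction R S (\<phi> (a \<otimes> s [^] (q - 1))) s"
    using a b u(1) \<phi>_closed by (intro fraction_eqI[where u = u]) auto
qed

lemma trace_closed:
  "x \<in> carrier (localization R S) \<Longrightarrow> trace_on_fractions \<phi> q x \<in> carrier (localization R S)"
  by (erule localization_cases) (auto simp: trace_fraction \<phi>_closed)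

lemma trace_add:
  assumes "x \<in> carrier (localization R S)" "y \<in> carrier (localization R S)"
  shows "trace_on_fractions \<phi> q (x \<oplus>\<^bsub>localization R S\<^esub> y)
    = trace_on_fractions \<phi> q x \<oplus>\<^bsub>localization R S\<^esub> trace_on_fractions \<phi> q y"
proof -
  from assms(1) obtain a s where a: "a \<in> carrier R" "s \<in> S" "x = fraction R S a s" by (rule localization_cases)
  from assms(2) obtain b t where b: "b \<in> carrier R" "t \<in> S" "y = fraction R S b t" by (rule localization_cases)
  have "(t \<otimes> a \<oplus> s \<otimes> b) \<otimes> (s \<otimes> t) [^] (q - 1)
      = t [^] q \<otimes> (a \<otimes> s [^] (q - 1)) \<oplus> s [^] q \<otimes> (b \<otimes> t [^] (q - 1))"
    using a b by (simp add: nat_pow_distrib pow_q l_distr r_distr m_ac)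
  then have "\<phi> ((t \<otimes> a \<oplus> s \<otimes> b) \<otimes> (s \<otimes> t) [^] (q - 1))
      = t \<otimes> \<phi> (a \<otimes> s [^] (q - 1)) \<oplus> s \<otimes> \<phi> (b \<otimes> t [^] (q - 1))"
    using a b by (simp add: \<phi>_add \<phi>_smult)
  then show ?thesis
    using a b \<phi>_closed mult_denom by (simp add: fraction_add trace_fraction)
qed

lemma trace_frobenius:
  assumes r: "r \<in> carrier R" and x: "x \<in> carrier (localization R S)"
  shows "trace_on_fractions \<phi> q (r \<odot>\<^bsub>localization R S\<^esub> (x [^]\<^bsub>localization R S\<^esub> q)) = \<phi> r \<odot>\<^bsub>localization R S\<^esub> x"
proof -
  from x obtain a s where a: "a \<in> carrier R" "s \<in> S" "x = fraction R S a s" by (rule localization_cases)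
  have "(r \<otimes> a [^] q) \<otimes> (s [^] q) [^] (q - 1) = (a \<otimes> s [^] (q - 1)) [^] q \<otimes> r"
    using a r by (simp add: nat_pow_distrib nat_pow_pow mult.commute m_ac)
  then have "\<phi> ((r \<otimes> a [^] q) \<otimes> (s [^] q) [^] (q - 1)) = (a \<otimes> s [^] (q - 1)) \<otimes> \<phi> r"
    using a r by (simp add: \<phi>_smult)
  then have "trace_on_fractions \<phi> q (r \<odot>\<^bsub>localization R S\<^esub> (x [^]\<^bsub>localization R S\<^esub> q))
      = fraction R S ((a \<otimes> s [^] (q - 1)) \<otimes> \<phi> r) (s [^] q)"
    using a r pow_denom by (simp add: fraction_pow fraction_smult trace_fraction)
  also have "\<dots> = fraction R S (\<phi> r \<otimes> a) s"
    using a r \<phi>_closed pow_denom one_denom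
    by (intro fraction_eqI[where u = \<one>]) (auto simp: pow_q m_ac intro!: mult_denom)
  also have "\<dots> = \<phi> r \<odot>\<^bsub>localization R S\<^esub> x"
    using a r \<phi>_closed by (simp add: fraction_smult)
  finally show ?thesis .
qed

end
end

section \<open>Local cohomology and its induced maps\<close>

context cech_complex
begin

abbreviation (input) "top_face \<equiv> {..<length fs}"

lemma cech_module_eq: "cech_module R fs i = product_module (cech_index fs i) (cech_ring R fs)"
  by (simp add: cech_module_def product_module_def)

lemma cech_indexD: "S \<in> cech_index fs i \<Longrightarrow> S \<subseteq> top_face"
  by (simp add: cech_index_def)

lemma cech_ring_module: "S \<subseteq> top_face \<Longrightarrow> module R (cech_ring R fs S)"
  by (rule cube.Q_module)

lemma cech_module_module: "module R (cech_module R fs i)"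
  unfolding cech_module_eq by (rule product_module_is_module) (auto intro: cech_ring_module dest: cech_indexD)

lemma cech_component:
  "c \<in> carrier (cech_module R fs i) \<Longrightarrow> S \<in> cech_index fs i \<Longrightarrow> c S \<in> carrier (cech_ring R fs S)"
  unfolding cech_module_eq by (rule product_module_closed)

lemma cocycle_component:
  "z \<in> cech_cocycles R fs i \<Longrightarrow> S \<in> cech_index fs i \<Longrightarrow> z S \<in> carrier (cech_ring R fs S)"
  by (rule cech_component) (simp_all add: cech_cocycles_def)

lemma cech_index_remove:
  assumes "T \<subseteq> top_face" "j \<in> T"
  shows "T - {j} \<in> cech_index fs i \<longleftrightarrow> T \<in> cech_index fs (i + 1)"
proof -
  have "finite T" using assms(1) finite_subset by blast
  then have "card T = Suc (card (T - {j}))" using assms(2) by (metis card_Suc_Diff1)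
  then show ?thesis using assms by (auto simp: cech_index_def)
qed

lemma top_face_Int: "T \<subseteq> top_face \<Longrightarrow> T \<inter> top_face = T"
  by auto

lemma total_closed:
  "c \<in> carrier (cube.cochains top_face) \<Longrightarrow> T \<subseteq> top_face \<Longrightarrow> c T \<in> carrier (cech_ring R fs T)"
  using cube.cochain_closed[of c top_face T] by (simp add: top_face_Int)

lemma cech_differential_apply:
  assumes c: "c \<in> carrier (cube.cochains top_face)" and T: "T \<in> cech_index fs (i + 1)"
    and eq: "\<And>S. S \<in> cech_index fs i \<Longrightarrow> c' S = c S"
  shows "cech_differential R fs i c' T = cube.cube_diff top_face c T"
proof -
  note T' = cech_indexD[OF T]
  interpret Q: module R "cech_ring R fs T" by (rule cech_ring_module[OF T'])
  have rc: "cech_restriction R fs T (c (T - {j})) \<in> carrier (cech_ring R fs T)" for j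
    using cube.res_face_closed[OF c T', of j] by (simp add: top_face_Int[OF T'])
  have tc: "cube.cube_coeff top_face T j \<odot>\<^bsub>cech_ring R fs T\<^esub> cech_restriction R fs T (c (T - {j}))
      \<in> carrier (cech_ring R fs T)" if "j \<in> T" for j
    using cube.face_term_closed[OF c T' that] by (simp add: top_face_Int[OF T'])
  have "cech_differential R fs i c' T = (\<Oplus>\<^bsub>cech_ring R fs T\<^esub>j\<in>T.
      cube.cube_coeff top_face T j \<odot>\<^bsub>cech_ring R fs T\<^esub> cech_restriction R fs T (c (T - {j})))"
    unfolding cech_differential_def restrict_apply'[OF T]
  proof (rule Q.M.finsum_cong'[OF refl])
    fix j assume j: "j \<in> T"
    have "c' (T - {j}) = c (T - {j})"
      using cech_index_remove[OF T' j] T by (intro eq) simp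
    then show "(let x = cech_restriction R fs T (c' (T - {j}))
           in if even (card {k \<in> T. k < j}) then x else \<ominus>\<^bsub>cech_ring R fs T\<^esub> x) =
      cube.cube_coeff top_face T j \<odot>\<^bsub>cech_ring R fs T\<^esub> cech_restriction R fs T (c (T - {j}))"
      using rc[of j] j T'
      by (auto simp: cube.cube_coeff_def shuffle_sign_def neg_one_pow Q.smult_l_minus)
  qed (use tc in auto)
  then show ?thesis by (simp add: cube.cube_diff_apply[OF T'] top_face_Int[OF T'])
qed

text \<open>The Cech complex in degree \<open>i\<close> is the direct summand of the total complex with components at the
  faces with \<open>i\<close> elements; cocycles and coboundaries are the images of the total ones.\<close>

definition homogeneous_part :: "int \<Rightarrow> (nat set \<Rightarrow> ('a \<times> 'a) set) \<Rightarrow> nat set \<Rightarrow> ('a \<times> 'a) set" where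
  "homogeneous_part i c = restrict c (cech_index fs i)"

definition extend_by_zero :: "int \<Rightarrow> (nat set \<Rightarrow> ('a \<times> 'a) set) \<Rightarrow> nat set \<Rightarrow> ('a \<times> 'a) set" where
  "extend_by_zero i c = (\<lambda>T\<in>Pow top_face. if T \<in> cech_index fs i then c T else \<zero>\<^bsub>cech_ring R fs T\<^esub>)"

lemma homogeneous_part_hom:
  "homogeneous_part i \<in> Hom_module R (cube.cochains top_face) (cech_module R fs i)"
proof -
  interpret C: module R "cube.cochains top_face" by (rule cube.cochains_module)
  interpret C': module R "cech_module R fs i" by (rule cech_module_module)
  have cl: "homogeneous_part i c \<in> carrier (cech_module R fs i)" if "c \<in> carrier (cube.cochains top_face)" for c
    unfolding homogeneous_part_def cech_module_eq
    by (rule product_moduleI) (use total_closed[OF that] cech_indexD in blast)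
  have "homogeneous_part i (x \<oplus>\<^bsub>cube.cochains top_face\<^esub> y)
      = homogeneous_part i x \<oplus>\<^bsub>cech_module R fs i\<^esub> homogeneous_part i y" for x y
    by (rule ext)
       (auto simp: homogeneous_part_def cech_module_def cube.cochain_simps top_face_Int dest: cech_indexD)
  moreover have "homogeneous_part i (r \<odot>\<^bsub>cube.cochains top_face\<^esub> y)
      = r \<odot>\<^bsub>cech_module R fs i\<^esub> homogeneous_part i y" for r y
    by (rule ext)
       (auto simp: homogeneous_part_def cech_module_def cube.cochain_simps top_face_Int dest: cech_indexD)
  ultimately show ?thesis using cl by (auto simp: Hom_module_def)
qed

lemma homogeneous_part_closed:
  "c \<in> carrier (cube.cochains top_face) \<Longrightarrow> homogeneous_part i c \<in> carrier (cech_module R fs i)"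
  using homogeneous_part_hom[of i] by (auto simp: Hom_module_def)

lemma extend_closed:
  assumes "c \<in> carrier (cech_module R fs i)"
  shows "extend_by_zero i c \<in> carrier (cube.cochains top_face)"
  unfolding extend_by_zero_def
proof (rule cube.cochainI)
  fix T assume T: "T \<subseteq> top_face"
  interpret Q: module R "cech_ring R fs T" by (rule cech_ring_module[OF T])
  show "(if T \<in> cech_index fs i then c T else \<zero>\<^bsub>cech_ring R fs T\<^esub>) \<in> carrier (cech_ring R fs (T \<inter> top_face))"
    using assms by (auto simp: top_face_Int[OF T] cech_module_def)
qed

lemma homogeneous_part_extend:
  assumes "c \<in> carrier (cech_module R fs i)"
  shows "homogeneous_part i (extend_by_zero i c) = c"
proof (rule ext)
  fix T
  show "homogeneous_part i (extend_by_zero i c) T = c T"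
  proof (cases "T \<in> cech_index fs i")
    case True
    then show ?thesis using cech_indexD[OF True] by (simp add: homogeneous_part_def extend_by_zero_def)
  next
    case False
    then show ?thesis
      using assms PiE_arb[of c "cech_index fs i" _ T] by (simp add: homogeneous_part_def cech_module_def)
  qed
qed

lemma cech_differential_homogeneous:
  assumes c: "c \<in> carrier (cube.cochains top_face)"
  shows "cech_differential R fs i (homogeneous_part i c) = homogeneous_part (i + 1) (cube.cube_diff top_face c)"
proof (rule ext)
  fix T
  show "cech_differential R fs i (homogeneous_part i c) T = homogeneous_part (i + 1) (cube.cube_diff top_face c) T"
  proof (cases "T \<in> cech_index fs (i + 1)")
    case True
    have "cech_differential R fs i (homogeneous_part i c) T = cube.cube_diff top_face c T"
      by (rule cech_differential_apply[OF c True]) (simp add: homogeneous_part_def)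
    then show ?thesis using True by (simp add: homogeneous_part_def)
  qed (simp add: cech_differential_def homogeneous_part_def)
qed

lemma homogeneous_part_zero: "homogeneous_part i \<zero>\<^bsub>cube.cochains top_face\<^esub> = \<zero>\<^bsub>cech_module R fs i\<^esub>"
  by (rule ext)
     (auto simp: homogeneous_part_def cech_module_def cube.cochain_simps top_face_Int dest: cech_indexD)

lemma cech_cocycles_eq: "cech_cocycles R fs i = homogeneous_part i ` cube.cube_cocycles top_face"
proof (rule equalityI; rule subsetI)
  fix c assume c: "c \<in> cech_cocycles R fs i"
  then have cc: "c \<in> carrier (cech_module R fs i)" and dc: "cech_differential R fs i c = \<zero>\<^bsub>cech_module R fs (i + 1)\<^esub>"
    by (auto simp: cech_cocycles_def)
  let ?c = "extend_by_zero i c"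
  have ec: "?c \<in> carrier (cube.cochains top_face)" by (rule extend_closed[OF cc])
  interpret C: module R "cube.cochains top_face" by (rule cube.cochains_module)
  have "cube.cube_diff top_face ?c = \<zero>\<^bsub>cube.cochains top_face\<^esub>"
  proof (rule cube.cochain_eqI[where V = top_face])
    fix T assume T: "T \<subseteq> top_face"
    show "cube.cube_diff top_face ?c T = \<zero>\<^bsub>cube.cochains top_face\<^esub> T"
    proof (cases "T \<in> cech_index fs (i + 1)")
      case True
      have "cech_differential R fs i c T = cube.cube_diff top_face ?c T"
        by (rule cech_differential_apply[OF ec True]) (auto simp: extend_by_zero_def dest: cech_indexD)
      then show ?thesis
        using dc True T by (simp add: cech_module_def cube.cochain_simps[OF T] top_face_Int)
    next
      case False
      have "cube.cube_diff top_face ?c T = \<zero>\<^bsub>cech_ring R fs (T \<inter> top_face)\<^esub>"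
      proof (rule cube.cube_diff_zero[OF ec T])
        fix j assume j: "j \<in> T"
        have "T - {j} \<subseteq> top_face" "T - {j} \<notin> cech_index fs i" using T False cech_index_remove[OF T j] by auto
        then show "?c (T - {j}) = \<zero>\<^bsub>cech_ring R fs ((T - {j}) \<inter> top_face)\<^esub>"
          by (simp add: extend_by_zero_def top_face_Int)
      qed
      then show ?thesis by (simp add: cube.cochain_simps[OF T])
    qed
  qed (use ec in \<open>auto intro: cube.cube_diff_closed\<close>)
  then have "?c \<in> cube.cube_cocycles top_face" using ec by (simp add: cube.cube_cocycles_def)
  then show "c \<in> homogeneous_part i ` cube.cube_cocycles top_face"
    using homogeneous_part_extend[OF cc] by (metis image_eqI)
next
  fix c assume "c \<in> homogeneous_part i ` cube.cube_cocycles top_face"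
  then obtain d where d: "d \<in> carrier (cube.cochains top_face)"
    "cube.cube_diff top_face d = \<zero>\<^bsub>cube.cochains top_face\<^esub>" "c = homogeneous_part i d"
    by (auto simp: cube.cube_cocycles_def)
  then show "c \<in> cech_cocycles R fs i"
    using cech_differential_homogeneous[OF d(1), of i] homogeneous_part_zero homogeneous_part_closed
    by (auto simp: cech_cocycles_def)
qed

lemma cech_coboundaries_eq: "cech_coboundaries R fs i = homogeneous_part i ` cube.cube_coboundaries top_face"
proof (rule equalityI; rule subsetI)
  fix c assume "c \<in> cech_coboundaries R fs i"
  then obtain w where w: "w \<in> carrier (cech_module R fs (i - 1))" "c = cech_differential R fs (i - 1) w"
    by (auto simp: cech_coboundaries_def)
  have "c = homogeneous_part i (cube.cube_diff top_face (extend_by_zero (i - 1) w))"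
    using cech_differential_homogeneous[OF extend_closed[OF w(1)], of "i - 1"]
      homogeneous_part_extend[OF w(1)] w(2) by simp
  then show "c \<in> homogeneous_part i ` cube.cube_coboundaries top_face"
    using extend_closed[OF w(1)] by (auto simp: cube.cube_coboundaries_def)
next
  fix c assume "c \<in> homogeneous_part i ` cube.cube_coboundaries top_face"
  then obtain w where w: "w \<in> carrier (cube.cochains top_face)"
    "c = homogeneous_part i (cube.cube_diff top_face w)"
    by (auto simp: cube.cube_coboundaries_def)
  then have "c = cech_differential R fs (i - 1) (homogeneous_part (i - 1) w)"
    using cech_differential_homogeneous[OF w(1), of "i - 1"] by simp
  then show "c \<in> cech_coboundaries R fs i"
    using homogeneous_part_closed[OF w(1)] by (auto simp: cech_coboundaries_def)
qed

lemma cech_cocycles_submodule: "submodule (cech_cocycles R fs i) R (cech_module R fs i)"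
  unfolding cech_cocycles_eq
  by (rule module.submodule_image[OF cube.cochains_module cech_module_module homogeneous_part_hom
        cube.cube_cocycles_submodule])

lemma cech_coboundaries_submodule: "submodule (cech_coboundaries R fs i) R (cech_module R fs i)"
  unfolding cech_coboundaries_eq
  by (rule module.submodule_image[OF cube.cochains_module cech_module_module homogeneous_part_hom
        cube.cube_coboundaries_submodule])

lemma cech_coboundaries_subset: "cech_coboundaries R fs i \<subseteq> cech_cocycles R fs i"
  unfolding cech_coboundaries_eq cech_cocycles_eq using cube.cube_coboundaries_subset by blast

lemma cech_artinian:
  assumes "noetherian_ring R" and mx: "maximalideal \<mm> R" and gen: "\<mm> = genideal R (set fs)"
  shows "artinian_between R (cech_module R fs i) (cech_cocycles R fs i) (cech_coboundaries R fs i)"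
proof -
  interpret C': module R "cech_module R fs i" by (rule cech_module_module)
  have img: "(!) fs ` {..<length fs} = set fs"
    by (auto simp: set_conv_nth)
  have "artinian_between R (cube.cochains top_face) (cube.cube_cocycles top_face) (cube.cube_coboundaries top_face)"
    by (rule cube.artinian_cohomology[OF _ mx])
       (use cech_ring_empty_noetherian[OF assms(1)] gen img in auto)
  then show ?thesis
  proof (rule artinian_between_hom[OF cube.cochains_module cech_module_module homogeneous_part_hom
        cube.cube_cocycles_submodule cube.cube_coboundaries_submodule cube.cube_coboundaries_subset
        cech_coboundaries_submodule, rotated 3])
    show "homogeneous_part i b \<in> cech_coboundaries R fs i" if "b \<in> cube.cube_coboundaries top_face" for b
      using that by (auto simp: cech_coboundaries_eq)
    show Zc: "cech_cocycles R fs i \<subseteq> carrier (cech_module R fs i)"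
      using C'.submoduleE(1)[OF cech_cocycles_submodule] .
    fix z assume z: "z \<in> cech_cocycles R fs i"
    then obtain u where u: "u \<in> cube.cube_cocycles top_face" "z = homogeneous_part i u"
      by (auto simp: cech_cocycles_eq)
    have "z \<in> carrier (cech_module R fs i)" using z Zc by blast
    then have "z \<ominus>\<^bsub>cech_module R fs i\<^esub> homogeneous_part i u = \<zero>\<^bsub>cech_module R fs i\<^esub>"
      using u(2) by (simp add: a_minus_def C'.M.r_neg)
    then show "\<exists>u\<in>cube.cube_cocycles top_face. z \<ominus>\<^bsub>cech_module R fs i\<^esub> homogeneous_part i u \<in> cech_coboundaries R fs i"
      using u(1) C'.submodule_zero[OF cech_coboundaries_submodule] by (intro bexI[of _ u]) simp_all
  qed
qed

definition cochain_map :: "(nat set \<Rightarrow> ('a \<times> 'a) set \<Rightarrow> ('a \<times> 'a) set) \<Rightarrow> int \<Rightarrow> 'a cochain \<Rightarrow> 'a cochain" where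
  "cochain_map h i c = (\<lambda>S\<in>cech_index fs i. h S (c S))"

text \<open>Families of additive maps between the Cech rings that are compatible with restriction. They are
  not required to be linear: the Frobenius is \<open>p\<close>-linear and the trace maps are \<open>p\<^sup>e\<close>-inverse linear.\<close>

definition natural_additive :: "(nat set \<Rightarrow> ('a \<times> 'a) set \<Rightarrow> ('a \<times> 'a) set) \<Rightarrow> bool" where
  "natural_additive h \<longleftrightarrow>
     (\<forall>S. S \<subseteq> top_face \<longrightarrow>
        (\<forall>x\<in>carrier (cech_ring R fs S). h S x \<in> carrier (cech_ring R fs S)) \<and>
        (\<forall>x\<in>carrier (cech_ring R fs S). \<forall>y\<in>carrier (cech_ring R fs S).
           h S (x \<oplus>\<^bsub>cech_ring R fs S\<^esub> y) = h S x \<oplus>\<^bsub>cech_ring R fs S\<^esub> h S y) \<and>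
        (\<forall>T x. S \<subseteq> T \<longrightarrow> T \<subseteq> top_face \<longrightarrow> x \<in> carrier (cech_ring R fs S) \<longrightarrow>
           h T (cech_restriction R fs T x) = cech_restriction R fs T (h S x)))"

abbreviation (input) cech_H :: "int \<Rightarrow> ('a, 'a cochain set) module" where
  "cech_H i \<equiv> local_cohomology R fs i"

abbreviation (input) cocycle_class :: "int \<Rightarrow> 'a cochain \<Rightarrow> 'a cochain set" where
  "cocycle_class i z \<equiv> cech_coboundaries R fs i +>\<^bsub>cech_module R fs i\<^esub> z"

lemma cocycle_module: "module R ((cech_module R fs i)\<lparr>carrier := cech_cocycles R fs i\<rparr>)"
  by (rule submodule.submodule_is_module[OF cech_cocycles_submodule cech_module_module])

lemma coboundaries_in_cocycles:
  "submodule (cech_coboundaries R fs i) R ((cech_module R fs i)\<lparr>carrier := cech_cocycles R fs i\<rparr>)"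
  by (rule module.submodule_of_submodule[OF cech_module_module cech_cocycles_submodule
        cech_coboundaries_submodule cech_coboundaries_subset])

lemma local_cohomology_module: "module R (local_cohomology R fs i)"
  unfolding local_cohomology_def subquotient_def
  by (rule module.quotient_module_is_module[OF cocycle_module coboundaries_in_cocycles])

lemma coset_restrict: "B +>\<^bsub>M\<lparr>carrier := Z\<rparr>\<^esub> z = B +>\<^bsub>M\<^esub> z"
  by (simp add: a_r_coset_def')

lemma local_cohomology_carrier:
  "carrier (local_cohomology R fs i) = {cocycle_class i z | z. z \<in> cech_cocycles R fs i}"
  unfolding local_cohomology_def subquotient_def
  using module.quotient_module_carrier[OF cocycle_module, of i "cech_coboundaries R fs i"]
  by (simp add: coset_restrict)

lemma local_cohomology_add:
  assumes "z \<in> cech_cocycles R fs i" "z' \<in> cech_cocycles R fs i"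
  shows "cocycle_class i z \<oplus>\<^bsub>local_cohomology R fs i\<^esub> cocycle_class i z' = cocycle_class i (z \<oplus>\<^bsub>cech_module R fs i\<^esub> z')"
  unfolding local_cohomology_def subquotient_def
  using module.quotient_add_coset[OF cocycle_module coboundaries_in_cocycles, of z i z'] assms
  by (simp add: coset_restrict)

lemma local_cohomology_smult:
  assumes "r \<in> carrier R" "z \<in> cech_cocycles R fs i"
  shows "r \<odot>\<^bsub>local_cohomology R fs i\<^esub> cocycle_class i z = cocycle_class i (r \<odot>\<^bsub>cech_module R fs i\<^esub> z)"
  unfolding local_cohomology_def subquotient_def
  using module.quotient_smult_coset[OF cocycle_module coboundaries_in_cocycles assms(1), of z i] assms(2)
  by (simp add: coset_restrict)

lemma local_cohomology_artinian:
  assumes "noetherian_ring R" and mx: "maximalideal \<mm> R" and gen: "\<mm> = genideal R (set fs)"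
  shows "artinian_between R (local_cohomology R fs i) (carrier (local_cohomology R fs i)) {\<zero>\<^bsub>local_cohomology R fs i\<^esub>}"
proof -
  interpret M: module R "(cech_module R fs i)\<lparr>carrier := cech_cocycles R fs i\<rparr>" by (rule cocycle_module)
  have "artinian_between R ((cech_module R fs i)\<lparr>carrier := cech_cocycles R fs i\<rparr>) (cech_cocycles R fs i)
      (cech_coboundaries R fs i)"
    by (rule module.artinian_between_restrict[OF cech_module_module cech_cocycles_submodule cech_artinian[OF assms]])
  then show ?thesis
    unfolding local_cohomology_def subquotient_def M.quotient_module_zero
    by (intro M.quotient_artinian[OF coboundaries_in_cocycles]) simp
qed

context
  fixes h assumes h: "natural_additive h"
begin

lemma h_closed: "S \<subseteq> top_face \<Longrightarrow> x \<in> carrier (cech_ring R fs S) \<Longrightarrow> h S x \<in> carrier (cech_ring R fs S)"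
  using h by (simp add: natural_additive_def)

lemma h_add: "S \<subseteq> top_face \<Longrightarrow> x \<in> carrier (cech_ring R fs S) \<Longrightarrow> y \<in> carrier (cech_ring R fs S) \<Longrightarrow>
    h S (x \<oplus>\<^bsub>cech_ring R fs S\<^esub> y) = h S x \<oplus>\<^bsub>cech_ring R fs S\<^esub> h S y"
  using h by (simp add: natural_additive_def)

lemma h_res: "S \<subseteq> T \<Longrightarrow> T \<subseteq> top_face \<Longrightarrow> x \<in> carrier (cech_ring R fs S) \<Longrightarrow>
    h T (cech_restriction R fs T x) = cech_restriction R fs T (h S x)"
  using h unfolding natural_additive_def by (meson subset_trans)

lemma h_zero_minus:
  assumes S: "S \<subseteq> top_face"
  shows "h S \<zero>\<^bsub>cech_ring R fs S\<^esub> = \<zero>\<^bsub>cech_ring R fs S\<^esub>"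
    and "x \<in> carrier (cech_ring R fs S) \<Longrightarrow> h S (\<ominus>\<^bsub>cech_ring R fs S\<^esub> x) = \<ominus>\<^bsub>cech_ring R fs S\<^esub> h S x"
proof -
  interpret Q: module R "cech_ring R fs S" by (rule cech_ring_module[OF S])
  show 0: "h S \<zero>\<^bsub>cech_ring R fs S\<^esub> = \<zero>\<^bsub>cech_ring R fs S\<^esub>"
    using h_add[OF S Q.M.zero_closed Q.M.zero_closed] h_closed[OF S Q.M.zero_closed] by simp
  assume x: "x \<in> carrier (cech_ring R fs S)"
  have "h S (\<ominus>\<^bsub>cech_ring R fs S\<^esub> x) \<oplus>\<^bsub>cech_ring R fs S\<^esub> h S x = \<zero>\<^bsub>cech_ring R fs S\<^esub>"
    using h_add[OF S _ x, of "\<ominus>\<^bsub>cech_ring R fs S\<^esub> x"] x 0 by (simp add: Q.M.l_neg)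
  then show "h S (\<ominus>\<^bsub>cech_ring R fs S\<^esub> x) = \<ominus>\<^bsub>cech_ring R fs S\<^esub> h S x"
    using x h_closed[OF S] by (intro Q.M.minus_equality[symmetric]) auto
qed

lemma cochain_map_closed:
  "c \<in> carrier (cech_module R fs i) \<Longrightarrow> cochain_map h i c \<in> carrier (cech_module R fs i)"
  unfolding cochain_map_def cech_module_eq
  by (rule product_moduleI, rule h_closed[OF cech_indexD product_module_closed[where Q = "cech_ring R fs"]])

lemma cochain_map_add:
  assumes "c \<in> carrier (cech_module R fs i)" "c' \<in> carrier (cech_module R fs i)"
  shows "cochain_map h i (c \<oplus>\<^bsub>cech_module R fs i\<^esub> c')
    = cochain_map h i c \<oplus>\<^bsub>cech_module R fs i\<^esub> cochain_map h i c'"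
proof (rule ext)
  fix S
  show "cochain_map h i (c \<oplus>\<^bsub>cech_module R fs i\<^esub> c') S
    = (cochain_map h i c \<oplus>\<^bsub>cech_module R fs i\<^esub> cochain_map h i c') S"
  proof (cases "S \<in> cech_index fs i")
    case True
    have "c S \<in> carrier (cech_ring R fs S)" "c' S \<in> carrier (cech_ring R fs S)"
      using assms True by (auto intro: cech_component)
    then show ?thesis
      using True h_add[OF cech_indexD[OF True]] by (simp add: cochain_map_def cech_module_def)
  qed (simp add: cochain_map_def cech_module_def)
qed

lemma cochain_map_differential:
  assumes c: "c \<in> carrier (cech_module R fs i)"
  shows "cech_differential R fs i (cochain_map h i c) = cochain_map h (i + 1) (cech_differential R fs i c)"
proof (rule ext)
  fix T
  show "cech_differential R fs i (cochain_map h i c) T = cochain_map h (i + 1) (cech_differential R fs i c) T"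
  proof (cases "T \<in> cech_index fs (i + 1)")
    case True
    have T: "T \<subseteq> top_face" by (rule cech_indexD[OF True])
    have fin: "finite T" using T finite_subset by blast
    interpret Q: module R "cech_ring R fs T" by (rule cech_ring_module[OF T])
    let ?s = "\<lambda>j x. if even (card {k \<in> T. k < j}) then x else \<ominus>\<^bsub>cech_ring R fs T\<^esub> x"
    have idx: "T - {j} \<in> cech_index fs i" if "j \<in> T" for j
      using cech_index_remove[OF T that] True by simp
    have cj: "c (T - {j}) \<in> carrier (cech_ring R fs (T - {j}))" if "j \<in> T" for j
      by (rule cech_component[OF c idx[OF that]])
    have rc: "cech_restriction R fs T (c (T - {j})) \<in> carrier (cech_ring R fs T)" if "j \<in> T" for j
      by (rule cube.res_closed[OF _ T cj[OF that]]) auto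
    have "cech_differential R fs i (cochain_map h i c) T
        = (\<Oplus>\<^bsub>cech_ring R fs T\<^esub>j\<in>T. h T (?s j (cech_restriction R fs T (c (T - {j})))))"
      unfolding cech_differential_def restrict_apply'[OF True]
    proof (rule Q.M.finsum_cong'[OF refl])
      fix j assume j: "j \<in> T"
      have "cech_restriction R fs T (cochain_map h i c (T - {j})) = h T (cech_restriction R fs T (c (T - {j})))"
        using h_res[OF _ T cj[OF j]] idx[OF j] by (auto simp: cochain_map_def)
      then show "(let x = cech_restriction R fs T (cochain_map h i c (T - {j})) in ?s j x)
          = h T (?s j (cech_restriction R fs T (c (T - {j}))))"
        using h_zero_minus(2)[OF T rc[OF j]] by simp
    qed (use rc h_closed[OF T] in auto)
    also have "\<dots> = h T (\<Oplus>\<^bsub>cech_ring R fs T\<^esub>j\<in>T. ?s j (cech_restriction R fs T (c (T - {j}))))"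
      by (rule additive_finsum[symmetric, OF Q.M.abelian_group_axioms Q.M.abelian_group_axioms fin])
         (use h_closed[OF T] h_add[OF T] rc in auto)
    also have "\<dots> = cochain_map h (i + 1) (cech_differential R fs i c) T"
      using True by (simp add: cochain_map_def cech_differential_def Let_def)
    finally show ?thesis .
  qed (simp add: cech_differential_def cochain_map_def)
qed

lemma cochain_map_cocycle:
  assumes "z \<in> cech_cocycles R fs i"
  shows "cochain_map h i z \<in> cech_cocycles R fs i"
proof -
  have z: "z \<in> carrier (cech_module R fs i)" "cech_differential R fs i z = \<zero>\<^bsub>cech_module R fs (i + 1)\<^esub>"
    using assms by (auto simp: cech_cocycles_def)
  have "cochain_map h (i + 1) \<zero>\<^bsub>cech_module R fs (i + 1)\<^esub> = \<zero>\<^bsub>cech_module R fs (i + 1)\<^esub>"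
    using h_zero_minus(1) by (auto simp: cochain_map_def cech_module_def fun_eq_iff dest: cech_indexD)
  then show ?thesis
    using z cochain_map_closed[OF z(1)] cochain_map_differential[OF z(1)] by (simp add: cech_cocycles_def)
qed

lemma cochain_map_coboundary:
  assumes "b \<in> cech_coboundaries R fs i"
  shows "cochain_map h i b \<in> cech_coboundaries R fs i"
proof -
  obtain w where w: "w \<in> carrier (cech_module R fs (i - 1))" "b = cech_differential R fs (i - 1) w"
    using assms by (auto simp: cech_coboundaries_def)
  then have "cochain_map h i b = cech_differential R fs (i - 1) (cochain_map h (i - 1) w)"
    using cochain_map_differential[OF w(1)] by simp
  then show ?thesis using cochain_map_closed[OF w(1)] by (auto simp: cech_coboundaries_def)
qed

abbreviation (input) induced :: "int \<Rightarrow> 'a cochain set \<Rightarrow> 'a cochain set" where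
  "induced i \<equiv> quotient_map (cech_module R fs i) (cech_coboundaries R fs i) (cochain_map h i)"

lemma induced_class:
  assumes z: "z \<in> cech_cocycles R fs i"
  shows "induced i (cocycle_class i z) = cocycle_class i (cochain_map h i z)"
proof (rule module.quotient_map_coset[OF cech_module_module cech_coboundaries_submodule, where Z = "cech_cocycles R fs i"])
  show "cech_cocycles R fs i \<subseteq> carrier (cech_module R fs i)" by (auto simp: cech_cocycles_def)
qed (use z cech_coboundaries_subset[of i] cochain_map_coboundary in
      \<open>auto simp: cech_cocycles_def intro: cochain_map_closed cochain_map_add\<close>)

lemma induced_closed: "x \<in> carrier (cech_H i) \<Longrightarrow> induced i x \<in> carrier (cech_H i)"
  using induced_class[of _ i] cochain_map_cocycle[of _ i] unfolding local_cohomology_carrier by auto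

lemma induced_add:
  assumes "x \<in> carrier (cech_H i)" "y \<in> carrier (cech_H i)"
  shows "induced i (x \<oplus>\<^bsub>cech_H i\<^esub> y) = induced i x \<oplus>\<^bsub>cech_H i\<^esub> induced i y"
proof -
  obtain z z' where z: "z \<in> cech_cocycles R fs i" "x = cocycle_class i z"
    "z' \<in> cech_cocycles R fs i" "y = cocycle_class i z'"
    using assms unfolding local_cohomology_carrier by auto
  have "z \<oplus>\<^bsub>cech_module R fs i\<^esub> z' \<in> cech_cocycles R fs i"
    by (rule module.submoduleE(5)[OF cech_module_module cech_cocycles_submodule z(1,3)])
  moreover have "z \<in> carrier (cech_module R fs i)" "z' \<in> carrier (cech_module R fs i)"
    using z by (auto simp: cech_cocycles_def)
  ultimately show ?thesis
    using z induced_class cochain_map_cocycle by (simp add: local_cohomology_add cochain_map_add)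
qed

end

context
  fixes p :: nat
  assumes p: "Factorial_Ring.prime p" and char: "add_pow R p \<one> = \<zero>"
begin

abbreviation (input) frob :: "nat \<Rightarrow> nat set \<Rightarrow> ('a \<times> 'a) set \<Rightarrow> ('a \<times> 'a) set" where
  "frob e \<equiv> \<lambda>S x. x [^]\<^bsub>cech_ring R fs S\<^esub> (p ^ e)"

lemma natural_frobenius: "natural_additive (frob e)"
  unfolding natural_additive_def
proof (intro allI impI conjI ballI)
  fix S assume S: "S \<subseteq> top_face"
  interpret S: denominators R "cech_denoms R fs S" by (rule cech_denominators[OF S])
  fix x assume "x \<in> carrier (cech_ring R fs S)"
  then obtain a s where a: "a \<in> carrier R" "s \<in> cech_denoms R fs S" "x = fraction R (cech_denoms R fs S) a s"
    by (rule cech_ring_cases[OF S])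
  show "x [^]\<^bsub>cech_ring R fs S\<^esub> (p ^ e) \<in> carrier (cech_ring R fs S)"
    unfolding cech_ring_def using a S.pow_denom by (auto simp: S.fraction_pow)
  fix y assume "y \<in> carrier (cech_ring R fs S)"
  then obtain b t where b: "b \<in> carrier R" "t \<in> cech_denoms R fs S" "y = fraction R (cech_denoms R fs S) b t"
    by (rule cech_ring_cases[OF S])
  show "(x \<oplus>\<^bsub>cech_ring R fs S\<^esub> y) [^]\<^bsub>cech_ring R fs S\<^esub> (p ^ e) =
    x [^]\<^bsub>cech_ring R fs S\<^esub> (p ^ e) \<oplus>\<^bsub>cech_ring R fs S\<^esub> y [^]\<^bsub>cech_ring R fs S\<^esub> (p ^ e)"
    unfolding cech_ring_def using a b S.pow_denom S.mult_denom
    by (simp add: S.fraction_pow S.fraction_add frobenius_iter_add[OF p char] nat_pow_distrib)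
next
  fix S T x assume S: "S \<subseteq> top_face" and ST: "S \<subseteq> T" "T \<subseteq> top_face" and "x \<in> carrier (cech_ring R fs S)"
  then obtain a s where a: "a \<in> carrier R" "s \<in> cech_denoms R fs S" "x = fraction R (cech_denoms R fs S) a s"
    by (auto elim: cech_ring_cases[OF S])
  interpret S: denominators R "cech_denoms R fs S" by (rule cech_denominators[OF S])
  interpret T: denominators R "cech_denoms R fs T" by (rule cech_denominators[OF ST(2)])
  show "cech_restriction R fs T x [^]\<^bsub>cech_ring R fs T\<^esub> (p ^ e) = cech_restriction R fs T (x [^]\<^bsub>cech_ring R fs S\<^esub> (p ^ e))"
    unfolding cech_ring_def using a cech_denoms_mono[OF ST(1)] S.pow_denom
    by (simp add: S.fraction_pow T.fraction_pow cech_restriction_fraction[OF ST])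
qed

lemma local_cohomology_frobenius_eq:
  "local_cohomology_frobenius R p fs i =
     quotient_map (cech_module R fs i) (cech_coboundaries R fs i) (cochain_map (frob 1) i)"
proof -
  have "cech_frobenius R p fs i = cochain_map (frob 1) i"
    by (rule ext) (simp add: cech_frobenius_def cochain_map_def)
  then show ?thesis by (simp add: local_cohomology_frobenius_def)
qed

lemma cech_ring_pow_pow:
  assumes S: "S \<subseteq> top_face" and x: "x \<in> carrier (cech_ring R fs S)"
  shows "(x [^]\<^bsub>cech_ring R fs S\<^esub> (m::nat)) [^]\<^bsub>cech_ring R fs S\<^esub> (k::nat) = x [^]\<^bsub>cech_ring R fs S\<^esub> (m * k)"
proof -
  interpret S: denominators R "cech_denoms R fs S" by (rule cech_denominators[OF S])
  from x obtain a s where a: "a \<in> carrier R" "s \<in> cech_denoms R fs S" "x = fraction R (cech_denoms R fs S) a s"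
    by (rule cech_ring_cases[OF S])
  show ?thesis
    unfolding cech_ring_def using a S.pow_denom by (simp add: S.fraction_pow nat_pow_pow)
qed

lemma frobenius_iterate_class:
  assumes z: "z \<in> cech_cocycles R fs i"
  shows "(local_cohomology_frobenius R p fs i ^^ e) (cocycle_class i z) = cocycle_class i (cochain_map (frob e) i z)"
proof (induction e)
  case 0
  have zc: "z \<in> carrier (cech_module R fs i)" using z by (simp add: cech_cocycles_def)
  have "cochain_map (frob 0) i z = z"
  proof (rule ext)
    fix S
    show "cochain_map (frob 0) i z S = z S"
    proof (cases "S \<in> cech_index fs i")
      case True
      note S = cech_indexD[OF True]
      interpret S: denominators R "cech_denoms R fs S" by (rule cech_denominators[OF S])
      have "z S \<in> carrier (cech_ring R fs S)" by (rule cech_component[OF zc True])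
      then obtain a s where "a \<in> carrier R" "s \<in> cech_denoms R fs S" "z S = fraction R (cech_denoms R fs S) a s"
        by (rule cech_ring_cases[OF S])
      then have "z S [^]\<^bsub>cech_ring R fs S\<^esub> (1::nat) = z S"
        unfolding cech_ring_def using nat_pow_eone S.fraction_pow[of a s 1] by (simp only: S.denom_closed)
      then show ?thesis using True by (simp add: cochain_map_def)
    next
      case False
      then show ?thesis
        using zc PiE_arb[of z "cech_index fs i" _ S] by (simp add: cochain_map_def cech_module_def)
    qed
  qed
  then show ?case by simp
next
  case (Suc e)
  have "cochain_map (frob 1) i (cochain_map (frob e) i z) = cochain_map (frob (Suc e)) i z"
  proof (rule ext)
    fix S
    show "cochain_map (frob 1) i (cochain_map (frob e) i z) S = cochain_map (frob (Suc e)) i z S"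
    proof (cases "S \<in> cech_index fs i")
      case True
      have "z S \<in> carrier (cech_ring R fs S)" by (rule cocycle_component[OF z True])
      then show ?thesis
        using True cech_ring_pow_pow[OF cech_indexD[OF True], of "z S" "p ^ e" p]
        by (simp add: cochain_map_def mult.commute)
    qed (simp add: cochain_map_def)
  qed
  then show ?case
    using Suc induced_class[OF natural_frobenius cochain_map_cocycle[OF natural_frobenius z], of 1 e]
    by (simp add: local_cohomology_frobenius_eq)
qed

lemma frobenius_smult:
  assumes r: "r \<in> carrier R" and x: "x \<in> carrier (cech_H i)"
  shows "local_cohomology_frobenius R p fs i (r \<odot>\<^bsub>cech_H i\<^esub> x)
    = (r [^] p) \<odot>\<^bsub>cech_H i\<^esub> local_cohomology_frobenius R p fs i x"
proof -
  obtain z where z: "z \<in> cech_cocycles R fs i" "x = cocycle_class i z"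
    using x unfolding local_cohomology_carrier by auto
  have rz: "r \<odot>\<^bsub>cech_module R fs i\<^esub> z \<in> cech_cocycles R fs i"
    by (rule module.submoduleE(4)[OF cech_module_module cech_cocycles_submodule r z(1)])
  have "cochain_map (frob 1) i (r \<odot>\<^bsub>cech_module R fs i\<^esub> z) = (r [^] p) \<odot>\<^bsub>cech_module R fs i\<^esub> cochain_map (frob 1) i z"
  proof (rule ext)
    fix S
    show "cochain_map (frob 1) i (r \<odot>\<^bsub>cech_module R fs i\<^esub> z) S = ((r [^] p) \<odot>\<^bsub>cech_module R fs i\<^esub> cochain_map (frob 1) i z) S"
    proof (cases "S \<in> cech_index fs i")
      case True
      note S = cech_indexD[OF True]
      interpret S: denominators R "cech_denoms R fs S" by (rule cech_denominators[OF S])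
      have "z S \<in> carrier (cech_ring R fs S)" by (rule cocycle_component[OF z(1) True])
      then obtain a s where a: "a \<in> carrier R" "s \<in> cech_denoms R fs S" "z S = fraction R (cech_denoms R fs S) a s"
        by (rule cech_ring_cases[OF S])
      have "(r \<odot>\<^bsub>cech_ring R fs S\<^esub> z S) [^]\<^bsub>cech_ring R fs S\<^esub> p = (r [^] p) \<odot>\<^bsub>cech_ring R fs S\<^esub> (z S [^]\<^bsub>cech_ring R fs S\<^esub> p)"
        unfolding cech_ring_def using a r S.pow_denom by (simp add: S.fraction_pow S.fraction_smult nat_pow_distrib)
      then show ?thesis using True by (simp add: cochain_map_def cech_module_def)
    qed (simp add: cochain_map_def cech_module_def)
  qed
  then show ?thesis
    using z rz r induced_class[OF natural_frobenius, of _ i 1] cochain_map_cocycle[OF natural_frobenius z(1), of 1]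
    by (simp add: local_cohomology_frobenius_eq local_cohomology_smult)
qed

lemma frobenius_closed: "x \<in> carrier (cech_H i) \<Longrightarrow> local_cohomology_frobenius R p fs i x \<in> carrier (cech_H i)"
  unfolding local_cohomology_frobenius_eq by (rule induced_closed[OF natural_frobenius])

lemma frobenius_additive:
  "x \<in> carrier (cech_H i) \<Longrightarrow> y \<in> carrier (cech_H i) \<Longrightarrow>
    local_cohomology_frobenius R p fs i (x \<oplus>\<^bsub>cech_H i\<^esub> y)
      = local_cohomology_frobenius R p fs i x \<oplus>\<^bsub>cech_H i\<^esub> local_cohomology_frobenius R p fs i y"
  unfolding local_cohomology_frobenius_eq by (rule induced_add[OF natural_frobenius])

context
  fixes \<phi> :: "'a \<Rightarrow> 'a" and e :: nat
  assumes \<phi>: "\<phi> \<in> Hom_module R (frobenius_pushforward R p e (regular_module R)) (regular_module R)"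
begin

lemmas \<phi>_props = pushforward_hom[OF \<phi>]

lemma q_pos: "p ^ e > 0"
  using p prime_gt_0_nat by simp

abbreviation (input) tr :: "nat set \<Rightarrow> ('a \<times> 'a) set \<Rightarrow> ('a \<times> 'a) set" where
  "tr \<equiv> \<lambda>S. denominators.trace_on_fractions R (cech_denoms R fs S) \<phi> (p ^ e)"

lemma natural_trace: "natural_additive tr"
  unfolding natural_additive_def
proof (intro allI impI conjI ballI)
  fix S assume S: "S \<subseteq> top_face"
  interpret S: denominators R "cech_denoms R fs S" by (rule cech_denominators[OF S])
  fix x assume x: "x \<in> carrier (cech_ring R fs S)"
  then show "tr S x \<in> carrier (cech_ring R fs S)"
    unfolding cech_ring_def by (rule S.trace_closed[OF refl q_pos \<phi>])
  fix y assume "y \<in> carrier (cech_ring R fs S)"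
  with x show "tr S (x \<oplus>\<^bsub>cech_ring R fs S\<^esub> y) = tr S x \<oplus>\<^bsub>cech_ring R fs S\<^esub> tr S y"
    unfolding cech_ring_def by (rule S.trace_add[OF refl q_pos \<phi>])
next
  fix S T x assume S: "S \<subseteq> top_face" and ST: "S \<subseteq> T" "T \<subseteq> top_face" and "x \<in> carrier (cech_ring R fs S)"
  then obtain a s where a: "a \<in> carrier R" "s \<in> cech_denoms R fs S" "x = fraction R (cech_denoms R fs S) a s"
    by (auto elim: cech_ring_cases[OF S])
  interpret S: denominators R "cech_denoms R fs S" by (rule cech_denominators[OF S])
  interpret T: denominators R "cech_denoms R fs T" by (rule cech_denominators[OF ST(2)])
  show "tr T (cech_restriction R fs T x) = cech_restriction R fs T (tr S x)"
    using a cech_denoms_mono[OF ST(1)] \<phi>_props(1)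
    by (simp add: cech_restriction_fraction[OF ST] S.trace_fraction[OF refl q_pos \<phi>]
        T.trace_fraction[OF refl q_pos \<phi>])
qed

lemma trace_frobenius_class:
  assumes r: "r \<in> carrier R" and x: "x \<in> carrier (cech_H i)"
  shows "quotient_map (cech_module R fs i) (cech_coboundaries R fs i) (cochain_map tr i)
      (r \<odot>\<^bsub>cech_H i\<^esub> (local_cohomology_frobenius R p fs i ^^ e) x) = \<phi> r \<odot>\<^bsub>cech_H i\<^esub> x"
proof -
  obtain z where z: "z \<in> cech_cocycles R fs i" "x = cocycle_class i z"
    using x unfolding local_cohomology_carrier by auto
  let ?z = "cochain_map (frob e) i z"
  have fz: "?z \<in> cech_cocycles R fs i" by (rule cochain_map_cocycle[OF natural_frobenius z(1)])
  have rfz: "r \<odot>\<^bsub>cech_module R fs i\<^esub> ?z \<in> cech_cocycles R fs i"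
    by (rule module.submoduleE(4)[OF cech_module_module cech_cocycles_submodule r fz])
  have "cochain_map tr i (r \<odot>\<^bsub>cech_module R fs i\<^esub> ?z) = \<phi> r \<odot>\<^bsub>cech_module R fs i\<^esub> z"
  proof (rule ext)
    fix S
    show "cochain_map tr i (r \<odot>\<^bsub>cech_module R fs i\<^esub> ?z) S = (\<phi> r \<odot>\<^bsub>cech_module R fs i\<^esub> z) S"
    proof (cases "S \<in> cech_index fs i")
      case True
      interpret S: denominators R "cech_denoms R fs S" by (rule cech_denominators[OF cech_indexD[OF True]])
      have "z S \<in> carrier (localization R (cech_denoms R fs S))"
        using cocycle_component[OF z(1) True] by (simp add: cech_ring_def)
      from S.trace_frobenius[OF refl q_pos \<phi> r this] show ?thesis
        using True by (simp add: cochain_map_def cech_module_def cech_ring_def)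
    qed (simp add: cochain_map_def cech_module_def)
  qed
  then show ?thesis
    using z r rfz fz \<phi>_props(1) induced_class[OF natural_trace rfz]
    by (simp add: frobenius_iterate_class local_cohomology_smult)
qed

text \<open>For \<open>e = 0\<close> the map \<open>\<phi>\<close> is multiplication by \<open>\<phi>(1)\<close>. For \<open>e > 0\<close> the square of
  \<open>\<phi>(r)\<close> annihilates \<open>L / N\<close> by \<open>trace_square_annihilates\<close>, whose hypothesis \<open>q \<ge> 2\<close> holds then.\<close>

lemma trace_preserves_radical_annihilator:
  assumes noeth: "noetherian_ring R" and mx: "maximalideal \<mm> R" and gen: "\<mm> = genideal R (set fs)"
    and N: "F_stable R (cech_H i) (local_cohomology_frobenius R p fs i) N"
    and L: "F_stable R (cech_H i) (local_cohomology_frobenius R p fs i) L" and NL: "N \<subseteq> L"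
    and J: "J = {r \<in> carrier R. \<forall>x\<in>L. r \<odot>\<^bsub>cech_H i\<^esub> x \<in> N}" and rad: "ideal_radical R J = J"
  shows "\<phi> ` J \<subseteq> J"
proof
  interpret H: module R "cech_H i" by (rule local_cohomology_module)
  have N': "submodule N R (cech_H i)" and L': "submodule L R (cech_H i)"
    and FL: "\<And>x. x \<in> L \<Longrightarrow> local_cohomology_frobenius R p fs i x \<in> L"
    using N L by (auto simp: F_stable_def)
  have ideal_J: "ideal J R" unfolding J by (rule H.annihilator_subquotient_ideal[OF N' L'])
  fix c assume "c \<in> \<phi> ` J"
  then obtain r where r: "r \<in> J" "c = \<phi> r" by auto
  have rR: "r \<in> carrier R" using r(1) ideal.Icarr[OF ideal_J] by blast
  have c: "c \<in> carrier R" using \<phi>_props(1)[OF rR] r(2) by simp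
  show "c \<in> J"
  proof (cases "e = 0")
    case True
    have "\<phi> (r \<otimes> \<one>) = r \<otimes> \<phi> \<one>"
      using \<phi>_props(3)[OF rR one_closed] True rR nat_pow_eone by simp
    then show ?thesis using r rR ideal.I_r_closed[OF ideal_J r(1) \<phi>_props(1)[OF one_closed]] by simp
  next
    case False
    have "p \<ge> 2" using p prime_ge_2_nat by blast
    then have q: "p ^ e \<ge> 2" using False self_le_power[of p e] by linarith
    have Fe: "(local_cohomology_frobenius R p fs i ^^ k) x \<in> A"
      if "x \<in> A" "\<And>x. x \<in> A \<Longrightarrow> local_cohomology_frobenius R p fs i x \<in> A" for A x k
      using that by (induction k) auto
    have "(c \<otimes> c) \<odot>\<^bsub>cech_H i\<^esub> \<eta> \<in> N" if \<eta>: "\<eta> \<in> L" for \<eta>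
      unfolding r(2)
    proof (rule H.trace_square_annihilates[where \<phi> = \<phi> and r = r and F = "local_cohomology_frobenius R p fs i ^^ e" and q = "p ^ e"
          and \<psi> = "quotient_map (cech_module R fs i) (cech_coboundaries R fs i) (cochain_map tr i)" and L = L])
      show "artinian_between R (cech_H i) (carrier (cech_H i)) {\<zero>\<^bsub>cech_H i\<^esub>}"
        by (rule local_cohomology_artinian[OF noeth mx gen])
      show "(local_cohomology_frobenius R p fs i ^^ e) x \<in> carrier (cech_H i)" if "x \<in> carrier (cech_H i)" for x
        by (rule Fe[OF that frobenius_closed])
      show "(local_cohomology_frobenius R p fs i ^^ e) x \<in> L" if "x \<in> L" for x
        by (rule Fe[OF that FL])
      show "r \<odot>\<^bsub>cech_H i\<^esub> x \<in> N" if "x \<in> L" for x using r(1) that by (simp add: J)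
    qed (use q \<phi>_props N' L' NL rR \<eta> induced_closed[OF natural_trace] induced_add[OF natural_trace]
          trace_frobenius_class in auto)
    then have "c \<otimes> c \<in> J" using c by (simp add: J)
    then have "c [^] (2::nat) \<in> J" using c by (simp add: numeral_2_eq_2)
    then have "c \<in> ideal_radical R J" using c by (auto simp: ideal_radical_def)
    then show ?thesis using rad by simp
  qed
qed

end
end
end

section \<open>Uniformly compatible annihilators\<close>

theorem theorem1p5:
  fixes R :: "('a, 'b) ring_scheme"
    and \<mm> :: "'a set"
    and p :: nat
    and fs :: "'a list"
    and i :: int
  assumes "noetherian_local_ring R \<mm>"
    and "prime_characteristic R p"
    and "F_finite R p"
    and "adically_complete R \<mm>"
    and "set fs \<subseteq> carrier R"
    and "\<mm> = genideal R (set fs)"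
  shows
    "(\<forall>N L J.
        F_stable R (local_cohomology R fs i) (local_cohomology_frobenius R p fs i) N \<and>
        F_stable R (local_cohomology R fs i) (local_cohomology_frobenius R p fs i) L \<and>
        N \<subseteq> L \<and>
        J = annihilator R (subquotient (local_cohomology R fs i) L N) \<longrightarrow>
        (ideal_radical R J = J \<longrightarrow> uniformly_compatible R p J) \<and>
        (inj_on (quotient_map (local_cohomology R fs i) N (local_cohomology_frobenius R p fs i))
           (carrier (subquotient (local_cohomology R fs i) L N)) \<longrightarrow> ideal_radical R J = J)) \<and>
     (F_anti_nilpotent R p fs \<longrightarrow>
      (\<forall>N L J.
        F_stable R (local_cohomology R fs i) (local_cohomology_frobenius R p fs i) N \<and>
        F_stable R (local_cohomology R fs i) (local_cohomology_frobenius R p fs i) L \<and>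
        N \<subseteq> L \<and>
        J = annihilator R (subquotient (local_cohomology R fs i) L N) \<longrightarrow>
        uniformly_compatible R p J))"
proof -
  interpret cring R using assms(1) by (simp add: noetherian_local_ring_def)
  have noeth: "noetherian_ring R" and mx: "maximalideal \<mm> R"
    using assms(1) by (auto simp: noetherian_local_ring_def)
  have p: "Factorial_Ring.prime p" and char: "add_pow R p \<one>\<^bsub>R\<^esub> = \<zero>\<^bsub>R\<^esub>"
    using assms(2) by (auto simp: prime_characteristic_def)
  interpret cech_complex R fs by unfold_locales (rule assms(5))
  let ?H = "local_cohomology R fs i" and ?F = "local_cohomology_frobenius R p fs i"
  interpret H: module R ?H by (rule local_cohomology_module)
  have ann: "annihilator R (subquotient ?H L N) = {r \<in> carrier R. \<forall>x\<in>L. r \<odot>\<^bsub>?H\<^esub> x \<in> N}"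
    if "F_stable R ?H ?F N" "F_stable R ?H ?F L" "N \<subseteq> L" for N L
    using that by (intro H.annihilator_subquotient) (auto simp: F_stable_def)
  have compatible: "uniformly_compatible R p J"
    if st: "F_stable R ?H ?F N" "F_stable R ?H ?F L" "N \<subseteq> L"
      and J: "J = annihilator R (subquotient ?H L N)" and rad: "ideal_radical R J = J"
    for N L J
  proof -
    note J' = J[unfolded ann[OF st]]
    have "ideal J R"
      unfolding J' using st by (intro H.annihilator_subquotient_ideal) (auto simp: F_stable_def)
    moreover have "\<phi> ` J \<subseteq> J"
      if "\<phi> \<in> Hom_module R (frobenius_pushforward R p e (regular_module R)) (regular_module R)" for \<phi> e
      by (rule trace_preserves_radical_annihilator[OF p char that noeth mx assms(6) st J' rad])
    ultimately show ?thesis by (auto simp: uniformly_compatible_def)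
  qed
  have radical: "ideal_radical R J = J"
    if st: "F_stable R ?H ?F N" "F_stable R ?H ?F L" "N \<subseteq> L"
      and J: "J = annihilator R (subquotient ?H L N)"
      and inj: "inj_on (quotient_map ?H N ?F) (carrier (subquotient ?H L N))"
    for N L J
    unfolding J ann[OF st]
  proof (rule H.radical_annihilator_if_injective[OF _ _ st(3) _ _ _ _ _ _ inj])
    show "submodule N R ?H" "submodule L R ?H" "?F ` N \<subseteq> N" "?F ` L \<subseteq> L"
      using st by (auto simp: F_stable_def)
    show "p \<ge> 2" using p prime_ge_2_nat by blast
  qed (fact frobenius_closed[OF p char] frobenius_additive[OF p char] frobenius_smult[OF p char])+
  have inj: "inj_on (quotient_map ?H N ?F) (carrier (subquotient ?H L N))"
    if "F_anti_nilpotent R p fs" "F_stable R ?H ?F N" "F_stable R ?H ?F L" for N L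
  proof (rule inj_on_subset)
    show "inj_on (quotient_map ?H N ?F) (carrier (quotient_module ?H N))"
      using that by (simp add: F_anti_nilpotent_def anti_nilpotent_def)
    have "L \<subseteq> carrier ?H" using that(3) H.submoduleE(1) by (simp add: F_stable_def)
    then show "carrier (subquotient ?H L N) \<subseteq> carrier (quotient_module ?H N)"
      by (auto simp: subquotient_def quotient_module_def A_RCOSETS_def' coset_restrict)
  qed
  show ?thesis
  proof (intro conjI allI impI; elim conjE)
    fix N L J
    assume st: "F_stable R ?H ?F N" "F_stable R ?H ?F L" "N \<subseteq> L"
      and J: "J = annihilator R (subquotient ?H L N)"
    show "uniformly_compatible R p J" if "ideal_radical R J = J"
      by (rule compatible[OF st J that])
    show "ideal_radical R J = J" if "inj_on (quotient_map ?H N ?F) (carrier (subquotient ?H L N))"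
      by (rule radical[OF st J that])
    show "uniformly_compatible R p J" if "F_anti_nilpotent R p fs"
      by (rule compatible[OF st J radical[OF st J inj[OF that st(1,2)]]])
  qed
qed

end
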